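(* Let $d\ge1$, $\lambda>0$, $\varepsilon>0$, let $\mathcal{X}$ be a compact subset of $\mathbb{R}^d$, and let $\alpha,\beta$ be two probability measures on $\mathcal{X}$. Suppose that the ground cost function $C$ belongs to $\mathcal{C}^1(\mathbb{R}^d\times\mathbb{R}^d,\mathbb{R}^+)$. Let $p\ge1$ be an integer and let $V$ be a Hilbert space that is included in $\mathcal{B}_p$ and such that, for some constant $c_V>0$, $\|v\|_{p,\infty}\le c_V\|v\|_V$ for all $v\in V$. Then the function $$v\in L^2_V\mapsto S_{C,\varepsilon}\big((\phi^v_1)_\sharp\alpha,\beta\big)$$ is weakly continuous. If additionally $e^{-C/\varepsilon}$ defines a positive universal kernel, then the functional $$J_\lambda(v):=S_{C,\varepsilon}\big((\phi^v_1)_\sharp\alpha,\beta\big)+\lambda\|v\|_{L^2_V}^2,\qquad v\in L^2_V,$$ admits minimizers over $L^2_V$.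
   Context: $\mathcal{C}^p(\mathbb{R}^{d_1},\mathbb{R}^{d_2})$ is the set of $p$-times continuously Fréchet-differentiable functions; $\|F\|_{p,\infty}=\max_{0\le k\le p}\sup_x\|F^{(k)}(x)\|_{op}$, where $F^{(k)}$ is the $k$-th derivative, $F^{(0)}=F$ (with the Euclidean norm for $k=0$), and $\|L\|_{op}=\sup\{\|L[\delta_1,\dots,\delta_k]\| : \|\delta_i\|\le1\}$. $\mathbb{R}^+=[0,\infty)$. $\mathcal{B}_p$ is the space of functions in $\mathcal{C}^p(\mathbb{R}^d,\mathbb{R}^d)$ whose derivatives of order $0,\dots,p$ vanish at infinity, with norm $\|\cdot\|_{p,\infty}$. $V$ has inner product $\langle\cdot,\cdot\rangle_V$ and norm $\|\cdot\|_V$. $L^2_V$ is the Hilbert space of time-dependent vector fields $t\in[0,1]\mapsto v_t\in V$ with $\int_0^1\|v_t\|_V^2\,dt<\infty$, with inner product $\langle v,u\rangle_{L^2_V}=\int_0^1\langle v_t,u_t\rangle_V\,dt$ and norm $\|v\|_{L^2_V}$. A sequence $\{v^n\}$ in $L^2_V$ converges weakly to $v$ if $\langle v^n,u\rangle_{L^2_V}\to\langle v,u\rangle_{L^2_V}$ for every $u\in L^2_V$. A function $\Psi:L^2_V\to\mathbb{R}$ is called weakly continuous if $\Psi(v^n)\to\Psi(v)$ for every sequence $\{v^n\}$ converging weakly to some $v\in L^2_V$. For $v\in L^2_V$, $\phi^v=(\phi^v_t)_{t\in[0,1]}$ is the unique solution of $\phi_t(x)=x+\int_0^t v_s(\phi_s(x))\,ds$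 for all $x\in\mathbb{R}^d$, $t\in[0,1]$. $F_\sharp\mu=\mu\circ F^{-1}$ is the push-forward. For compactly supported probability measures $\mu,\nu$ on $\mathbb{R}^d$, $$\mathcal{T}_{C,\varepsilon}(\mu,\nu)=\min_{\pi\in\Pi(\mu,\nu)}\int C\,d\pi+\varepsilon\,\mathrm{KL}(\pi\,|\,\mu\otimes\nu),$$ where $\Pi(\mu,\nu)$ is the set of couplings of $\mu$ and $\nu$, and $\mathrm{KL}(\rho|\rho')=\int\log(d\rho/d\rho')\,d\rho$ if $\rho\ll\rho'$, $+\infty$ otherwise. The Sinkhorn divergence is $S_{C,\varepsilon}(\mu,\nu)=\mathcal{T}_{C,\varepsilon}(\mu,\nu)-\tfrac12\mathcal{T}_{C,\varepsilon}(\mu,\mu)-\tfrac12\mathcal{T}_{C,\varepsilon}(\nu,\nu)$. "$e^{-C/\varepsilon}$ defines a positive universal kernel" is meant in the usual sense: $(x,y)\mapsto e^{-C(x,y)/\varepsilon}$ is a continuous, symmetric, positive definite kernel on $\mathbb{R}^d$ whose reproducing kernel Hilbert space is, on each compact set, dense in the continuous functions for the supremum norm. *)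

theory Defs
  imports "HOL-Probability.Probability"
begin

section \<open>Functions of class $C^p$ and the space $B_p$\<close>

text \<open>\<open>nderiv k F x [\<delta>\<^sub>1, \<dots>, \<delta>\<^sub>k]\<close> is \<open>F\<^sup>(\<^sup>k\<^sup>)(x)[\<delta>\<^sub>1, \<dots>, \<delta>\<^sub>k]\<close>.  A \<open>k\<close>-linear map is
  encoded as a function on lists, of which only the values on lists of length \<open>k\<close> matter; this
  avoids a type depending on \<open>k\<close>.\<close>

primrec nderiv ::
  "nat \<Rightarrow> ('a::real_normed_vector \<Rightarrow> 'b::real_normed_vector) \<Rightarrow> 'a \<Rightarrow> 'a list \<Rightarrow> 'b" where
  "nderiv 0 F x ds = F x"
| "nderiv (Suc k) F x ds = frechet_derivative (\<lambda>y. nderiv k F y (tl ds)) (at x) (hd ds)"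

definition mlin_norm ::
  "nat \<Rightarrow> ('a::real_normed_vector list \<Rightarrow> 'b::real_normed_vector) \<Rightarrow> real" where
  "mlin_norm k L = (SUP ds\<in>{ds. length ds = k \<and> (\<forall>d\<in>set ds. norm d \<le> 1)}. norm (L ds))"

text \<open>For \<open>k < p\<close>, the map \<open>x \<mapsto> F\<^sup>(\<^sup>k\<^sup>)(x)\<close> is Frechet differentiable in operator norm with
  derivative \<open>F\<^sup>(\<^sup>k\<^sup>+\<^sup>1\<^sup>)\<close>, and every \<open>F\<^sup>(\<^sup>k\<^sup>)\<close> with \<open>k \<le> p\<close> is continuous in operator norm.  The
  differentiability of the evaluations \<open>y \<mapsto> nderiv k F y ds\<close> ensures that
  \<open>frechet_derivative\<close> in the definition of \<open>nderiv\<close> is a genuine (linear) derivative.\<close>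

definition C_class ::
  "nat \<Rightarrow> ('a::euclidean_space \<Rightarrow> 'b::euclidean_space) set" where
  "C_class p = {F.
     (\<forall>k<p. \<forall>x.
        (\<forall>ds. length ds = k \<longrightarrow> (\<lambda>y. nderiv k F y ds) differentiable (at x)) \<and>
        ((\<lambda>h. mlin_norm k
            (\<lambda>ds. nderiv k F (x + h) ds - nderiv k F x ds - nderiv (Suc k) F x (h # ds)) / norm h)
          \<longlongrightarrow> 0) (at 0)) \<and>
     (\<forall>k\<le>p. \<forall>x. ((\<lambda>y. mlin_norm k (\<lambda>ds. nderiv k F y ds - nderiv k F x ds)) \<longlongrightarrow> 0) (at x))}"

definition B_space :: "nat \<Rightarrow> ('a::euclidean_space \<Rightarrow> 'a) set" where
  "B_space p = {F \<in> C_class p.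
     \<forall>k\<le>p. ((\<lambda>x. mlin_norm k (nderiv k F x)) \<longlongrightarrow> 0) at_infinity}"

text \<open>The suprema are suprema of real sets, hence meaningful only for bounded derivatives;
  this is the case on \<open>B_space p\<close>.\<close>

definition Cp_norm :: "nat \<Rightarrow> ('a::euclidean_space \<Rightarrow> 'b::euclidean_space) \<Rightarrow> real" where
  "Cp_norm p F = Max ((\<lambda>k. SUP x. mlin_norm k (nderiv k F x)) ` {..p})"

section \<open>Time-dependent vector fields and flows\<close>

text \<open>Elements of \<open>L\<^sup>2\<^sub>V\<close> are represented by functions rather than by classes modulo null sets.
  Borel measurability is the right notion for separable \<open>V\<close>; a Hilbert space continuously
  embedded in \<open>B_space p\<close> is separable, because the point evaluations at a countable dense set
  of points separate its elements.\<close>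

definition L2V :: "(real \<Rightarrow> 'v::real_inner) set" where
  "L2V = {v. v \<in> borel_measurable (lebesgue_on {0..1}) \<and>
             integrable (lebesgue_on {0..1}) (\<lambda>t. (norm (v t))\<^sup>2)}"

definition L2V_inner :: "(real \<Rightarrow> 'v::real_inner) \<Rightarrow> (real \<Rightarrow> 'v) \<Rightarrow> real" where
  "L2V_inner v u = (\<integral>t. inner (v t) (u t) \<partial>lebesgue_on {0..1})"

definition L2V_norm :: "(real \<Rightarrow> 'v::real_inner) \<Rightarrow> real" where
  "L2V_norm v = sqrt (L2V_inner v v)"

definition L2V_weakly_converges ::
  "(nat \<Rightarrow> real \<Rightarrow> 'v::real_inner) \<Rightarrow> (real \<Rightarrow> 'v) \<Rightarrow> bool" where
  "L2V_weakly_converges vs v \<longleftrightarrow>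
     (\<forall>u\<in>L2V. (\<lambda>n. L2V_inner (vs n) u) \<longlonglongrightarrow> L2V_inner v u)"

text \<open>Constant sequences show that a weakly continuous function takes the same value on functions
  that agree almost everywhere.\<close>

definition L2V_weakly_continuous :: "((real \<Rightarrow> 'v::real_inner) \<Rightarrow> real) \<Rightarrow> bool" where
  "L2V_weakly_continuous \<Psi> \<longleftrightarrow>
     (\<forall>vs v. (\<forall>n. vs n \<in> L2V) \<longrightarrow> v \<in> L2V \<longrightarrow> L2V_weakly_converges vs v \<longrightarrow>
        (\<lambda>n. \<Psi> (vs n)) \<longlonglongrightarrow> \<Psi> v)"

definition is_flow ::
  "(real \<Rightarrow> 'a \<Rightarrow> 'a) \<Rightarrow> (real \<Rightarrow> 'a \<Rightarrow> 'a::euclidean_space) \<Rightarrow> bool" where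
  "is_flow w \<phi> \<longleftrightarrow>
     (\<forall>x. \<forall>t\<in>{0..1}. integrable (lebesgue_on {0..t}) (\<lambda>s. w s (\<phi> s x)) \<and>
        \<phi> t x = x + (\<integral>s. w s (\<phi> s x) \<partial>lebesgue_on {0..t}))"

text \<open>The restriction to \<open>extensional {0..1}\<close> fixes the irrelevant values at times outside
  \<open>[0,1]\<close>, without which the solution could not be unique.\<close>

definition flow :: "(real \<Rightarrow> 'a \<Rightarrow> 'a) \<Rightarrow> real \<Rightarrow> 'a \<Rightarrow> 'a::euclidean_space" where
  "flow w = (THE \<phi>. \<phi> \<in> extensional {0..1} \<and> is_flow w \<phi>)"

section \<open>Entropic optimal transport and the Sinkhorn divergence\<close>

definition prob_measure_on :: "'a::euclidean_space set \<Rightarrow> 'a measure \<Rightarrow> bool" where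
  "prob_measure_on X \<mu> \<longleftrightarrow> prob_space \<mu> \<and> sets \<mu> = sets borel \<and> emeasure \<mu> X = 1"

definition couplings ::
  "'a::euclidean_space measure \<Rightarrow> 'a measure \<Rightarrow> ('a \<times> 'a) measure set" where
  "couplings \<mu> \<nu> = {\<pi>. prob_space \<pi> \<and> sets \<pi> = sets borel \<and>
                       distr \<pi> borel fst = \<mu> \<and> distr \<pi> borel snd = \<nu>}"

text \<open>\<open>KL(\<rho> | \<rho>')\<close> for probability measures.  For \<open>\<rho> \<lless> \<rho>'\<close> the negative part of
  \<open>log (d\<rho>/d\<rho>')\<close> is always \<open>\<rho>\<close>-integrable, so non-integrability means that the integral
  is \<open>\<infinity>\<close>.  Note that \<open>KL_divergence\<close> takes the reference measure first.\<close>

definition KL :: "'b measure \<Rightarrow> 'b measure \<Rightarrow> ereal" where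
  "KL \<rho> \<rho>' =
     (if absolutely_continuous \<rho>' \<rho> \<and> integrable \<rho> (entropy_density (exp 1) \<rho>' \<rho>)
      then ereal (KL_divergence (exp 1) \<rho>' \<rho>) else \<infinity>)"

text \<open>The minimum is attained and finite for compactly supported \<open>\<mu>\<close>, \<open>\<nu>\<close> and continuous
  \<open>C \<ge> 0\<close>, so that it equals the infimum and \<open>real_of_ereal\<close> is harmless.\<close>

definition entropic_OT ::
  "('a \<times> 'a \<Rightarrow> real) \<Rightarrow> real \<Rightarrow> 'a::euclidean_space measure \<Rightarrow> 'a measure \<Rightarrow> real" where
  "entropic_OT C \<epsilon> \<mu> \<nu> = real_of_ereal
     (INF \<pi>\<in>couplings \<mu> \<nu>.
        enn2ereal (\<integral>\<^sup>+ z. ennreal (C z) \<partial>\<pi>) + ereal \<epsilon> * KL \<pi> (\<mu> \<Otimes>\<^sub>M \<nu>))"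

definition sinkhorn_divergence ::
  "('a \<times> 'a \<Rightarrow> real) \<Rightarrow> real \<Rightarrow> 'a::euclidean_space measure \<Rightarrow> 'a measure \<Rightarrow> real" where
  "sinkhorn_divergence C \<epsilon> \<mu> \<nu> =
     entropic_OT C \<epsilon> \<mu> \<nu> - entropic_OT C \<epsilon> \<mu> \<mu> / 2 - entropic_OT C \<epsilon> \<nu> \<nu> / 2"

section \<open>Positive universal kernels\<close>

definition positive_definite_kernel :: "('a \<Rightarrow> 'a \<Rightarrow> real) \<Rightarrow> bool" where
  "positive_definite_kernel k \<longleftrightarrow>
     (\<forall>A c. finite A \<longrightarrow> 0 \<le> (\<Sum>x\<in>A. \<Sum>y\<in>A. c x * c y * k x y))"

text \<open>\<open>H\<close> with inner product \<open>ip\<close> is a Hilbert space of functions with reproducing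
  kernel \<open>k\<close>.\<close>

definition is_RKHS ::
  "('a \<Rightarrow> 'a \<Rightarrow> real) \<Rightarrow> ('a \<Rightarrow> real) set \<Rightarrow> (('a \<Rightarrow> real) \<Rightarrow> ('a \<Rightarrow> real) \<Rightarrow> real) \<Rightarrow> bool" where
  "is_RKHS k H ip \<longleftrightarrow>
     (\<lambda>x. 0) \<in> H \<and>
     (\<forall>f\<in>H. \<forall>g\<in>H. (\<lambda>x. f x + g x) \<in> H) \<and>
     (\<forall>a. \<forall>f\<in>H. (\<lambda>x. a * f x) \<in> H) \<and>
     (\<forall>f\<in>H. \<forall>g\<in>H. ip f g = ip g f) \<and>
     (\<forall>f\<in>H. \<forall>g\<in>H. \<forall>h\<in>H. ip (\<lambda>x. f x + g x) h = ip f h + ip g h) \<and>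
     (\<forall>a. \<forall>f\<in>H. \<forall>g\<in>H. ip (\<lambda>x. a * f x) g = a * ip f g) \<and>
     (\<forall>f\<in>H. 0 \<le> ip f f \<and> (ip f f = 0 \<longrightarrow> f = (\<lambda>x. 0))) \<and>
     (let nrm = (\<lambda>f. sqrt (ip f f)) in
        \<forall>F. (\<forall>n::nat. F n \<in> H) \<longrightarrow>
            (\<forall>e>0. \<exists>N. \<forall>m\<ge>N. \<forall>n\<ge>N. nrm (\<lambda>x. F m x - F n x) < e) \<longrightarrow>
            (\<exists>f\<in>H. (\<lambda>n. nrm (\<lambda>x. F n x - f x)) \<longlonglongrightarrow> 0)) \<and>
     (\<forall>x. k x \<in> H \<and> (\<forall>f\<in>H. ip f (k x) = f x))"

text \<open>The RKHS of a symmetric positive definite kernel exists and is unique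
  (Moore--Aronszajn), so the existential quantifier below just names it.\<close>

definition positive_universal_kernel :: "('a::euclidean_space \<Rightarrow> 'a \<Rightarrow> real) \<Rightarrow> bool" where
  "positive_universal_kernel k \<longleftrightarrow>
     continuous_on UNIV (\<lambda>(x, y). k x y) \<and>
     (\<forall>x y. k x y = k y x) \<and>
     positive_definite_kernel k \<and>
     (\<exists>H ip. is_RKHS k H ip \<and>
        (\<forall>K f. compact K \<longrightarrow> continuous_on K f \<longrightarrow>
           (\<forall>e>0. \<exists>h\<in>H. \<forall>x\<in>K. \<bar>h x - f x\<bar> < e)))"

section \<open>The matching functional\<close>

text \<open>The Hilbert space \<open>V\<close> of vector fields is given by a type \<open>'v\<close> together with an
  injective linear map \<open>\<iota>\<close> sending an element of \<open>V\<close> to the vector field that it is.\<close>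

definition J_functional ::
  "real \<Rightarrow> ('v \<Rightarrow> 'a \<Rightarrow> 'a) \<Rightarrow> ('a \<times> 'a \<Rightarrow> real) \<Rightarrow> real \<Rightarrow> 'a::euclidean_space measure \<Rightarrow>
   'a measure \<Rightarrow> (real \<Rightarrow> 'v::real_inner) \<Rightarrow> real" where
  "J_functional lam \<iota> C \<epsilon> \<alpha> \<beta> v =
     sinkhorn_divergence C \<epsilon> (distr \<alpha> borel (flow (\<lambda>t. \<iota> (v t)) 1)) \<beta> + lam * (L2V_norm v)\<^sup>2"

end

theory Submission
  imports Defs "HOL-Complex_Analysis.Great_Picard"
begin

text \<open>The flow depends continuously on the velocity field for the weak topology: the difference of two
  flow lines satisfies a Gronwall inequality whose source term is a weakly convergent pairing, since
  \<open>v \<mapsto> v(y)\<close> is represented by a vector of \<open>V\<close>.  The time-one maps are injective, and the relative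
  entropy does not change under injective maps, so transporting the measure amounts to changing the
  cost \<open>C\<close> into \<open>C \<circ> (\<phi> \<times> id)\<close> or \<open>C \<circ> (\<phi> \<times> \<phi>)\<close>; and the entropic cost is 1-Lipschitz in \<open>C\<close> for the
  supremum norm on the supports.  This gives weak continuity without any duality theory.

  For the existence of minimizers, \<open>S \<ge> 0\<close> is needed, because \<open>C\<close> may grow arbitrarily fast.  A
  measure \<open>\<mu>\<close> with compact support has a symmetric Schrodinger potential \<open>f\<close>, that is,
  \<open>\<integral> exp (f(x) + f(y) - C(x,y)/\<epsilon>) d\<mu>(y) = 1\<close>; it yields a coupling that bounds \<open>T(\<mu>,\<mu>)\<close> from above.
  Testing weak duality for \<open>T(\<mu>,\<nu>)\<close> with the two symmetric potentials leaves the term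
  \<open>1 - \<integral>\<integral> exp (f(x) + g(y) - C(x,y)/\<epsilon>) d\<mu> d\<nu>\<close>, which is nonnegative by positive definiteness of the
  kernel.  The direct method then applies.\<close>

section \<open>Complete semi-inner product spaces\<close>

text \<open>The velocity is only square integrable in time, so the Lipschitz constant
  \<open>c * norm (v t)\<close> of the field has no bound in \<open>t\<close>. Everything about
  flows therefore rests on one estimate: if \<open>A\<close> dominates the integral of
  \<open>K\<^sup>2\<close>, the Volterra operator with kernel \<open>K\<close> maps the weight
  \<open>exp (2 * A * t)\<close> to at most half of itself. Picard iteration, stability, uniqueness
  and, with time reversed, injectivity follow from it. Where sequences of fields are compared, one
  \<open>A\<close> must serve all of them; it exists because weakly convergent sequences are
  bounded. Entropic costs are compared coupling by coupling, which leaves the entropy term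
  untouched. This works only for fixed marginals: if the measures moved, the reference product and
  with it the entropy would move too, hence the return to \<open>\<alpha>\<close>,
  \<open>\<beta>\<close> before the limit. The map whose fixed point is a symmetric potential is
  only nonexpansive for the supremum norm. Damping gives approximate fixed points, and the modulus
  of continuity of the cost, which they all inherit, gives compactness.\<close>

text \<open>The space of square integrable vector fields is a set of functions rather than a type of
  classes, so its inner product is only semidefinite and the vector space operations are parameters.\<close>

lemma quadratic_nonneg_imp_linear_zero:
  fixes b c :: real
  assumes q: "\<And>t. 0 \<le> t * b + t\<^sup>2 * c" and c: "0 \<le> c"
  shows "b = 0"
proof -
  \<comment> \<open>At \<open>t = - b * s / 2\<close> the linear term is -b^2 s/2, while
    \<open>s * c \<le> 1\<close> keeps the quadratic term at most b^2 s/4. The 1 in the denominator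
    covers c = 0.\<close>
  define s where "s = 1 / (c + 1)"
  have s: "0 < s" "s * c \<le> 1" using c by (simp_all add: s_def)
  have "0 \<le> - (b\<^sup>2 * s) / 2 + b\<^sup>2 * s * (s * c / 4)"
    using q[of "- b * s / 2"] by (simp add: power2_eq_square field_simps)
  also have "\<dots> \<le> - (b\<^sup>2 * s) / 2 + b\<^sup>2 * s * (1 / 4)"
    using s by (intro add_left_mono mult_left_mono) auto
  finally have "b\<^sup>2 * s \<le> 0" by (simp add: mult.commute)
  then show ?thesis using s by (simp add: mult_le_0_iff)
qed

locale semi_inner_product =
  fixes H :: "'h set"
    and add :: "'h \<Rightarrow> 'h \<Rightarrow> 'h"
    and scl :: "real \<Rightarrow> 'h \<Rightarrow> 'h"
    and ip :: "'h \<Rightarrow> 'h \<Rightarrow> real"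
  assumes nonempty: "H \<noteq> {}"
    and add_closed: "\<lbrakk>x \<in> H; y \<in> H\<rbrakk> \<Longrightarrow> add x y \<in> H"
    and scl_closed: "x \<in> H \<Longrightarrow> scl a x \<in> H"
    and ip_commute: "\<lbrakk>x \<in> H; y \<in> H\<rbrakk> \<Longrightarrow> ip x y = ip y x"
    and ip_add_left: "\<lbrakk>x \<in> H; y \<in> H; z \<in> H\<rbrakk> \<Longrightarrow> ip (add x y) z = ip x z + ip y z"
    and ip_scl_left: "\<lbrakk>x \<in> H; z \<in> H\<rbrakk> \<Longrightarrow> ip (scl a x) z = a * ip x z"
    and ip_nonneg: "x \<in> H \<Longrightarrow> 0 \<le> ip x x"
begin

definition nrm :: "'h \<Rightarrow> real" where "nrm x = sqrt (ip x x)"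

definition sub :: "'h \<Rightarrow> 'h \<Rightarrow> 'h" where "sub x y = add x (scl (-1) y)"

text \<open>Only a pseudometric: square integrable fields that agree almost everywhere are at
  distance 0.\<close>

definition dst :: "'h \<Rightarrow> 'h \<Rightarrow> real" where "dst x y = nrm (sub x y)"

lemma sub_closed: "\<lbrakk>x \<in> H; y \<in> H\<rbrakk> \<Longrightarrow> sub x y \<in> H"
  by (simp add: sub_def add_closed scl_closed)

lemma ip_sub_left: "\<lbrakk>x \<in> H; y \<in> H; z \<in> H\<rbrakk> \<Longrightarrow> ip (sub x y) z = ip x z - ip y z"
  by (simp add: sub_def ip_add_left ip_scl_left scl_closed)

lemma ip_add_right: "\<lbrakk>x \<in> H; y \<in> H; z \<in> H\<rbrakk> \<Longrightarrow> ip z (add x y) = ip z x + ip z y"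
  using ip_add_left[of x y z] ip_commute add_closed by metis

lemma ip_scl_right: "\<lbrakk>x \<in> H; z \<in> H\<rbrakk> \<Longrightarrow> ip z (scl a x) = a * ip z x"
  using ip_scl_left[of x z a] ip_commute scl_closed by metis

lemma ip_sub_right: "\<lbrakk>x \<in> H; y \<in> H; z \<in> H\<rbrakk> \<Longrightarrow> ip z (sub x y) = ip z x - ip z y"
  by (simp add: sub_def ip_add_right ip_scl_right scl_closed)

lemma nrm_nonneg: "x \<in> H \<Longrightarrow> 0 \<le> nrm x"
  by (simp add: nrm_def ip_nonneg)

lemma nrm_square: "x \<in> H \<Longrightarrow> (nrm x)\<^sup>2 = ip x x"
  by (simp add: nrm_def ip_nonneg)

lemma dst_square:
  "\<lbrakk>x \<in> H; y \<in> H\<rbrakk> \<Longrightarrow> (dst x y)\<^sup>2 = ip x x - 2 * ip x y + ip y y"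
  using ip_commute[of x y]
  by (simp add: dst_def nrm_square sub_closed ip_sub_left ip_sub_right)

lemma dst_nonneg: "\<lbrakk>x \<in> H; y \<in> H\<rbrakk> \<Longrightarrow> 0 \<le> dst x y"
  by (simp add: dst_def nrm_nonneg sub_closed)

lemma cauchy_schwarz:
  assumes x: "x \<in> H" and y: "y \<in> H"
  shows "\<bar>ip x y\<bar> \<le> nrm x * nrm y"
proof -
  have q: "0 \<le> ip x x + 2 * t * ip x y + t\<^sup>2 * ip y y" for t
  proof -
    have "0 \<le> ip (add x (scl t y)) (add x (scl t y))"
      by (intro ip_nonneg add_closed scl_closed x y)
    then show ?thesis
      using x y ip_commute[OF x y]
      by (simp add: ip_add_left ip_add_right ip_scl_left ip_scl_right add_closed scl_closed
          power2_eq_square algebra_simps)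
  qed
  have "(ip x y)\<^sup>2 \<le> ip x x * ip y y"
  proof (cases "ip y y = 0")
    case True
    \<comment> \<open>A vector with \<open>ip y y = 0\<close> need not be zero. The polynomial of
      \<open>q\<close> is then affine in \<open>t\<close>, and at the \<open>t\<close> chosen below
      it would equal -1.\<close>
    have "ip x y = 0"
    proof (rule ccontr)
      assume "ip x y \<noteq> 0"
      then show False
        using q[of "- (ip x x + 1) / (2 * ip x y)"] True by (simp add: field_simps)
    qed
    then show ?thesis by (simp add: True)
  next
    case False
    then have pos: "0 < ip y y" using ip_nonneg[OF y] by simp
    have "0 \<le> ip x x - (ip x y)\<^sup>2 / ip y y"
      using q[of "- ip x y / ip y y"] pos by (simp add: power2_eq_square field_simps)
    then show ?thesis using pos by (simp add: field_simps)
  qed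
  then have "sqrt ((ip x y)\<^sup>2) \<le> sqrt (ip x x * ip y y)" by (rule real_sqrt_le_mono)
  then show ?thesis by (simp add: nrm_def real_sqrt_mult)
qed

lemma nrm_add_le:
  assumes x: "x \<in> H" and y: "y \<in> H"
  shows "nrm (add x y) \<le> nrm x + nrm y"
proof (rule power2_le_imp_le)
  have "(nrm (add x y))\<^sup>2 = (nrm x)\<^sup>2 + 2 * ip x y + (nrm y)\<^sup>2"
    using x y ip_commute[OF x y]
    by (simp add: nrm_square add_closed ip_add_left ip_add_right)
  also have "\<dots> \<le> (nrm x)\<^sup>2 + 2 * (nrm x * nrm y) + (nrm y)\<^sup>2"
    using cauchy_schwarz[OF x y] by auto
  finally show "(nrm (add x y))\<^sup>2 \<le> (nrm x + nrm y)\<^sup>2"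
    by (simp add: power2_eq_square algebra_simps)
qed (simp add: nrm_nonneg x y)

lemma ip_diff_le:
  assumes "x \<in> H" "y \<in> H" "u \<in> H"
  shows "\<bar>ip x u - ip y u\<bar> \<le> dst x y * nrm u"
  using cauchy_schwarz[OF sub_closed[OF assms(1,2)] assms(3)] assms
  by (simp add: dst_def ip_sub_left)

lemma dst_triangle:
  assumes x: "x \<in> H" and y: "y \<in> H" and z: "z \<in> H"
  shows "dst x z \<le> dst x y + dst y z"
proof -
  \<comment> \<open>The two vectors need not be equal, as the locale assumes no vector space laws;
    their inner products are.\<close>
  have "nrm (sub x z) = nrm (add (sub x y) (sub y z))"
    using x y z unfolding nrm_def
    by (simp add: ip_sub_left ip_sub_right ip_add_left ip_add_right sub_closed add_closed algebra_simps)
  then show ?thesis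
    using nrm_add_le[OF sub_closed[OF x y] sub_closed[OF y z]] by (simp add: dst_def)
qed

lemma dst_geometric:
  assumes X: "\<And>n::nat. X n \<in> H" and q: "0 \<le> q" "q < 1" and fast: "\<And>n. dst (X n) (X (Suc n)) \<le> q ^ n"
  shows "dst (X k) (X (k + m)) \<le> q ^ k / (1 - q)"
proof -
  \<comment> \<open>The exact partial sum of the geometric series is what closes the
    induction.\<close>
  have "dst (X k) (X (k + m)) \<le> q ^ k * (1 - q ^ m) / (1 - q)"
  proof (induction m)
    case 0
    have "dst (X k) (X k) = 0" using dst_square[OF X X, of k k] by simp
    then show ?case by simp
  next
    case (Suc m)
    have "dst (X k) (X (k + Suc m)) \<le> q ^ k * (1 - q ^ m) / (1 - q) + q ^ (k + m)"
      using dst_triangle[OF X[of k] X[of "k + m"] X[of "Suc (k + m)"]] Suc fast[of "k + m"]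
      unfolding add_Suc_right by linarith
    also have "\<dots> = q ^ k * (1 - q ^ Suc m) / (1 - q)"
      using q by (simp add: power_add field_simps)
    finally show ?case .
  qed
  also have "\<dots> \<le> q ^ k * 1 / (1 - q)"
    using q by (intro divide_right_mono mult_left_mono) auto
  finally show ?thesis by simp
qed

end

text \<open>Completeness is asked only for sequences with \<open>dst (X n) (X (Suc n))\<close> at
  most 2^(-n), the squares being spelled out in \<open>ip\<close>. Every sequence built below can be
  made that fast, and for such sequences pointwise almost everywhere convergence in L2 needs no
  subsequence.\<close>

locale semi_hilbert = semi_inner_product H add scl ip
  for H :: "'h set" and add :: "'h \<Rightarrow> 'h \<Rightarrow> 'h" and scl :: "real \<Rightarrow> 'h \<Rightarrow> 'h"
    and ip :: "'h \<Rightarrow> 'h \<Rightarrow> real" +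
  assumes complete_fast:
      "\<lbrakk>\<And>n::nat. X n \<in> H;
        \<And>n. ip (X n) (X n) - 2 * ip (X n) (X (Suc n)) + ip (X (Suc n)) (X (Suc n)) \<le> (1/4) ^ n\<rbrakk>
       \<Longrightarrow> \<exists>y\<in>H. (\<lambda>n. ip (X n) (X n) - 2 * ip (X n) y + ip y y) \<longlonglongrightarrow> 0"
begin

lemma fast_cauchy_limit:
  assumes X: "\<And>n. X n \<in> H" and fast: "\<And>n::nat. dst (X n) (X (Suc n)) \<le> (1/2) ^ n"
  obtains y where "y \<in> H" "(\<lambda>n. dst (X n) y) \<longlonglongrightarrow> 0"
proof -
  have "ip (X n) (X n) - 2 * ip (X n) (X (Suc n)) + ip (X (Suc n)) (X (Suc n)) \<le> (1/4) ^ n" for n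
  proof -
    have "(dst (X n) (X (Suc n)))\<^sup>2 \<le> ((1/2) ^ n)\<^sup>2"
      by (intro power_mono fast dst_nonneg X)
    also have "((1/2) ^ n)\<^sup>2 = (1/4::real) ^ n"
      by (simp add: power2_eq_square flip: power_mult_distrib)
    finally show ?thesis by (simp add: dst_square X)
  qed
  from complete_fast[OF X this] obtain y
    where y: "y \<in> H" and "(\<lambda>n. (dst (X n) y)\<^sup>2) \<longlonglongrightarrow> 0"
    by (auto simp: dst_square X)
  from tendsto_real_sqrt[OF this(2)] have "(\<lambda>n. dst (X n) y) \<longlonglongrightarrow> 0"
    by (simp add: dst_nonneg X y)
  with y that show ?thesis by blast
qed

text \<open>The representer is the minimizer of \<open>ip u u - 2 * f u\<close>: the bound on
  \<open>f\<close> keeps this functional bounded below, minimizing sequences are Cauchy by the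
  parallelogram identity, and the first variation at the minimizer \<open>v\<close> in direction
  \<open>u\<close> is \<open>2 * (ip v u - f u)\<close>.\<close>

lemma riesz:
  assumes f_add: "\<And>x y. \<lbrakk>x \<in> H; y \<in> H\<rbrakk> \<Longrightarrow> f (add x y) = f x + f y"
    and f_scl: "\<And>a x. x \<in> H \<Longrightarrow> f (scl a x) = a * f x"
    and f_bound: "\<And>x. x \<in> H \<Longrightarrow> \<bar>f x\<bar> \<le> B * nrm x"
  shows "\<exists>v\<in>H. \<forall>u\<in>H. ip v u = f u"
proof -
  define q where "q u = ip u u - 2 * f u" for u
  have lower: "- B\<^sup>2 \<le> q u" if "u \<in> H" for u
  proof -
    have "0 \<le> (nrm u - B)\<^sup>2" by simp
    then show ?thesis
      using f_bound[OF that] nrm_square[OF that]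
      by (simp add: q_def power2_eq_square algebra_simps)
  qed
  define I where "I = Inf (q ` H)"
  have bdd: "bdd_below (q ` H)" using lower by (auto simp: bdd_below_def)
  have I_le: "I \<le> q u" if "u \<in> H" for u
    unfolding I_def by (rule cInf_lower) (use that bdd in auto)
  \<comment> \<open>The exponent \<open>Suc n\<close> leaves room: the parallelogram bound then
    gives (5/8) 4^(-n), below the 4^(-n) that completeness asks for.\<close>
  have "\<exists>u\<in>H. q u < I + (1/4) ^ Suc n" for n
  proof -
    have "Inf (q ` H) < I + (1/4) ^ Suc n" by (simp add: I_def)
    then show ?thesis
      using cInf_lessD[of "q ` H"] nonempty by blast
  qed
  then obtain X where X: "\<And>n. X n \<in> H" and qX: "\<And>n. q (X n) < I + (1/4) ^ Suc n" by metis
  \<comment> \<open>With the midpoint \<open>?m\<close>, the squared distance equals 2 q(x) + 2 q(y)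
    - 4 q(m), and q(m) is at least \<open>I\<close>.\<close>
  have parallelogram: "(dst x y)\<^sup>2 \<le> 2 * (q x - I) + 2 * (q y - I)" if x: "x \<in> H" and y: "y \<in> H" for x y
  proof -
    let ?m = "scl (1/2) (add x y)"
    have m: "?m \<in> H" using x y by (simp add: add_closed scl_closed)
    have "ip ?m ?m = (ip x x + 2 * ip x y + ip y y) / 4"
      using x y ip_commute[OF x y]
      by (simp add: ip_add_left ip_add_right ip_scl_left ip_scl_right add_closed scl_closed field_simps)
    moreover have "f ?m = (f x + f y) / 2" using x y by (simp add: f_add f_scl add_closed)
    ultimately show ?thesis
      using I_le[OF m] dst_square[OF x y] by (simp add: q_def)
  qed
  have "dst (X n) (X (Suc n)) \<le> (1/2) ^ n" for n
  proof (rule power2_le_imp_le)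
    have "(dst (X n) (X (Suc n)))\<^sup>2 \<le> 2 * (1/4) ^ Suc n + 2 * (1/4) ^ Suc (Suc n)"
      using parallelogram[OF X X, of n "Suc n"] qX[of n] qX[of "Suc n"] by simp
    also have "\<dots> \<le> (1/4) ^ n" by simp
    also have "\<dots> = ((1/2) ^ n)\<^sup>2" by (simp add: power2_eq_square flip: power_mult_distrib)
    finally show "(dst (X n) (X (Suc n)))\<^sup>2 \<le> ((1/2) ^ n)\<^sup>2" .
  qed simp
  with X obtain v where v: "v \<in> H" and lim: "(\<lambda>n. dst (X n) v) \<longlonglongrightarrow> 0"
    using fast_cauchy_limit by metis
  have "q v \<le> I"
  proof (rule LIMSEQ_le_const)
    \<comment> \<open>Semicontinuity of \<open>q\<close> along the sequence. The absolute value is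
      there because \<open>B\<close> may be negative when all seminorms vanish.\<close>
    have ub: "q v \<le> q (X n) + 2 * dst (X n) v * nrm v + 2 * (\<bar>B\<bar> * dst (X n) v)" for n
    proof -
      have "f (sub (X n) v) = f (X n) - f v"
        using X v by (simp add: sub_def f_add f_scl scl_closed)
      moreover have "\<bar>f (sub (X n) v)\<bar> \<le> B * dst (X n) v"
        unfolding dst_def by (rule f_bound) (simp add: sub_closed X v)
      moreover have "B * dst (X n) v \<le> \<bar>B\<bar> * dst (X n) v"
        by (intro mult_right_mono dst_nonneg X v) simp
      ultimately have "f (X n) - f v \<le> \<bar>B\<bar> * dst (X n) v" by linarith
      moreover have "0 \<le> (dst (X n) v)\<^sup>2" by simp
      ultimately show ?thesis
        using ip_diff_le[OF X v v, of n] dst_square[OF X v, of n] unfolding q_def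
        by (auto simp: algebra_simps)
    qed
    have t: "(\<lambda>n. (I + (1/4) ^ Suc n) + 2 * dst (X n) v * nrm v + 2 * (\<bar>B\<bar> * dst (X n) v))
        \<longlonglongrightarrow> (I + 0) + 2 * 0 * nrm v + 2 * (\<bar>B\<bar> * 0)"
      by (intro tendsto_intros lim LIMSEQ_Suc LIMSEQ_power_zero) simp
    then show "(\<lambda>n. (I + (1/4) ^ Suc n) + 2 * dst (X n) v * nrm v + 2 * (\<bar>B\<bar> * dst (X n) v))
        \<longlonglongrightarrow> I" by simp
    show "\<exists>N. \<forall>n\<ge>N. q v \<le> (I + (1/4) ^ Suc n) + 2 * dst (X n) v * nrm v + 2 * (\<bar>B\<bar> * dst (X n) v)"
      using ub qX by (intro exI[of _ 0]) (smt (verit))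
  qed
  moreover have "ip v u = f u" if u: "u \<in> H" for u
  proof -
    have "0 \<le> t * (2 * (ip v u - f u)) + t\<^sup>2 * ip u u" for t
    proof -
      have "q v \<le> q (add v (scl t u))"
        using \<open>q v \<le> I\<close> I_le[of "add v (scl t u)"] u v by (simp add: add_closed scl_closed)
      then show ?thesis
        using u v ip_commute[OF u v]
        by (simp add: q_def ip_add_left ip_add_right ip_scl_left ip_scl_right add_closed scl_closed
            f_add f_scl power2_eq_square algebra_simps)
    qed
    then have "2 * (ip v u - f u) = 0"
      by (rule quadratic_nonneg_imp_linear_zero) (rule ip_nonneg[OF u])
    then show ?thesis by simp
  qed
  ultimately show ?thesis using v by blast
qed

text \<open>Riesz representation is applied on subspaces, where minimizing sequences must not
  converge out of the subspace; closedness under \<open>dst\<close> limits passes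
  \<open>complete_fast\<close> on.\<close>

lemma closed_subspace:
  assumes "K \<subseteq> H" "K \<noteq> {}"
    and "\<And>x y. \<lbrakk>x \<in> K; y \<in> K\<rbrakk> \<Longrightarrow> add x y \<in> K"
    and "\<And>a x. x \<in> K \<Longrightarrow> scl a x \<in> K"
    and closed: "\<And>X y. \<lbrakk>\<And>n::nat. X n \<in> K; y \<in> H; (\<lambda>n. dst (X n) y) \<longlonglongrightarrow> 0\<rbrakk> \<Longrightarrow> y \<in> K"
  shows "semi_hilbert K add scl ip"
proof
  have KH: "x \<in> H" if "x \<in> K" for x using \<open>K \<subseteq> H\<close> that by blast
  show "ip x y = ip y x" if "x \<in> K" "y \<in> K" for x y
    using that by (intro ip_commute KH)
  show "ip (add x y) z = ip x z + ip y z" if "x \<in> K" "y \<in> K" "z \<in> K" for x y z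
    using that by (intro ip_add_left KH)
  show "ip (scl a x) z = a * ip x z" if "x \<in> K" "z \<in> K" for a x z
    using that by (intro ip_scl_left KH)
  show "0 \<le> ip x x" if "x \<in> K" for x
    using that by (intro ip_nonneg KH)
  fix X :: "nat \<Rightarrow> 'h"
  assume X: "\<And>n. X n \<in> K"
    and fast: "\<And>n. ip (X n) (X n) - 2 * ip (X n) (X (Suc n)) + ip (X (Suc n)) (X (Suc n)) \<le> (1/4) ^ n"
  have XH: "X n \<in> H" for n using X \<open>K \<subseteq> H\<close> by blast
  obtain y where y: "y \<in> H" and lim: "(\<lambda>n. ip (X n) (X n) - 2 * ip (X n) y + ip y y) \<longlonglongrightarrow> 0"
    using complete_fast[OF XH fast] by blast
  have "(\<lambda>n. sqrt ((dst (X n) y)\<^sup>2)) \<longlonglongrightarrow> sqrt 0"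
    using lim by (intro tendsto_real_sqrt) (simp add: dst_square XH y)
  then have "(\<lambda>n. dst (X n) y) \<longlonglongrightarrow> 0" by (simp add: dst_nonneg XH y)
  from closed[OF X y this] lim
  show "\<exists>y\<in>K. (\<lambda>n. ip (X n) (X n) - 2 * ip (X n) y + ip y y) \<longlonglongrightarrow> 0" by blast
qed (rule assms(2) assms(3) assms(4); assumption)+

text \<open>The projection of \<open>u\<close> is the representer, inside the closed subspace
  \<open>K\<close>, of the functional \<open>w \<mapsto> ip u w\<close>.\<close>

lemma projection:
  assumes K: "K \<subseteq> H" "K \<noteq> {}"
    and K_add: "\<And>x y. \<lbrakk>x \<in> K; y \<in> K\<rbrakk> \<Longrightarrow> add x y \<in> K"
    and K_scl: "\<And>a x. x \<in> K \<Longrightarrow> scl a x \<in> K"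
    and K_closed: "\<And>X y. \<lbrakk>\<And>n::nat. X n \<in> K; y \<in> H; (\<lambda>n. dst (X n) y) \<longlonglongrightarrow> 0\<rbrakk> \<Longrightarrow> y \<in> K"
    and u: "u \<in> H"
  shows "\<exists>p\<in>K. \<forall>w\<in>K. ip p w = ip u w"
proof -
  interpret K: semi_hilbert K add scl ip
    by (rule closed_subspace[OF K K_add K_scl K_closed])
  have KH: "x \<in> H" if "x \<in> K" for x using K(1) that by blast
  have bound: "\<bar>ip u x\<bar> \<le> nrm u * K.nrm x" if "x \<in> K" for x
    using cauchy_schwarz[OF u KH[OF that]] by (simp add: K.nrm_def nrm_def)
  have add: "ip u (add x y) = ip u x + ip u y" if "x \<in> K" "y \<in> K" for x y
    using that by (simp add: ip_add_right KH u)
  have scl: "ip u (scl a x) = a * ip u x" if "x \<in> K" for a x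
    using that by (simp add: ip_scl_right KH u)
  show ?thesis by (rule K.riesz[OF add scl bound])
qed

text \<open>Along a subsequence all pairings with the members \<open>X m\<close> converge. The
  vectors \<open>u\<close> whose pairing converges form a closed subspace \<open>K\<close>
  containing every \<open>X m\<close>, and Riesz on \<open>K\<close> represents the limit
  functional. An arbitrary \<open>u\<close> is replaced by its projection on \<open>K\<close>, which
  pairs with all \<open>X n\<close> and with the limit as \<open>u\<close> does.\<close>

lemma weak_compactness:
  assumes X: "\<And>n::nat. X n \<in> H" and B: "\<And>n. nrm (X n) \<le> B"
  shows "\<exists>r y. strict_mono r \<and> y \<in> H \<and> (\<forall>u\<in>H. (\<lambda>n. ip (X (r n)) u) \<longlonglongrightarrow> ip y u)"
proof -
  have "0 \<le> B" using nrm_nonneg[OF X] B order_trans by blast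
  have bound: "\<bar>ip (X n) u\<bar> \<le> B * nrm u" if "u \<in> H" for n u
    by (rule order_trans[OF cauchy_schwarz[OF X that]]) (intro mult_right_mono B nrm_nonneg that)
  define F where "F n m = ip (X n) (X m)" for n m
  \<comment> \<open>Sequential compactness of a countable product of intervals replaces the diagonal
    extraction.\<close>
  define S where "S = PiE UNIV (\<lambda>m::nat. cball (0::real) (B * nrm (X m)))"
  have "compact S"
    using compactin_PiE[of "\<lambda>_::nat. euclidean :: real topology" UNIV "\<lambda>m. cball 0 (B * nrm (X m))"]
    by (simp add: S_def euclidean_product_topology compact_imp_seq_compact)
  moreover have "F n \<in> S" for n
    using bound[OF X] by (auto simp: F_def S_def)
  ultimately obtain l r where r: "strict_mono (r :: nat \<Rightarrow> nat)" and "(F \<circ> r) \<longlonglongrightarrow> l"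
    using compact_imp_seq_compact unfolding seq_compact_def by metis
  then have l: "(\<lambda>n. F (r n) m) \<longlonglongrightarrow> l m" for m
    using continuous_on_tendsto_compose[OF continuous_on_product_coordinates[of m], of "F \<circ> r" l sequentially]
    by (simp add: o_def)
  define K where "K = {u \<in> H. convergent (\<lambda>n. ip (X (r n)) u)}"
  have KH: "x \<in> H" if "x \<in> K" for x using that by (simp add: K_def)
  have XK: "X m \<in> K" for m using l[of m] X by (auto simp: K_def F_def convergent_def)
  have K_add: "add x y \<in> K" if "x \<in> K" "y \<in> K" for x y
    using that X by (auto simp: K_def add_closed ip_add_right intro: convergent_add)
  have K_scl: "scl a x \<in> K" if "x \<in> K" for a x
    using that X by (auto simp: K_def scl_closed ip_scl_right intro: convergent_mult convergent_const)
  have K_closed: "y \<in> K" if Y: "\<And>n::nat. Y n \<in> K" and y: "y \<in> H" and lim: "(\<lambda>n. dst (Y n) y) \<longlonglongrightarrow> 0" for Y y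
  proof -
    have YH: "Y n \<in> H" for n using Y KH by blast
    have "Cauchy (\<lambda>n. ip (X (r n)) y)"
    proof (rule metric_CauchyI)
      fix e :: real assume e: "0 < e"
      \<comment> \<open>One \<open>Y j\<close> near \<open>y\<close> serves all \<open>n\<close> at
        once, since the norms of the \<open>X n\<close> are bounded by \<open>B\<close>.\<close>
      have "(\<lambda>n. B * dst (Y n) y) \<longlonglongrightarrow> B * 0" by (intro tendsto_intros lim)
      then obtain j where j: "B * dst (Y j) y < e / 3"
        using e by (force dest!: order_tendstoD(2)[of _ _ _ "e/3"] simp: eventually_sequentially)
      have cauchy: "Cauchy (\<lambda>n. ip (X (r n)) (Y j))"
        using Y[of j] by (simp add: K_def convergent_Cauchy)
      obtain N where N: "\<And>m n. m \<ge> N \<Longrightarrow> n \<ge> N \<Longrightarrow> \<bar>ip (X (r m)) (Y j) - ip (X (r n)) (Y j)\<bar> < e / 3"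
        using metric_CauchyD[OF cauchy, of "e/3"] e by (auto simp: dist_real_def)
      have close: "\<bar>ip (X n) (Y j) - ip (X n) y\<bar> < e / 3" for n
      proof -
        have "\<bar>ip (X n) (Y j) - ip (X n) y\<bar> \<le> dst (Y j) y * nrm (X n)"
          using ip_diff_le[OF YH y X, of j n] by (simp add: ip_commute[OF X] YH y)
        also have "\<dots> \<le> dst (Y j) y * B" by (intro mult_left_mono B dst_nonneg YH y)
        finally show ?thesis using j by (simp add: mult.commute)
      qed
      show "\<exists>N. \<forall>m\<ge>N. \<forall>n\<ge>N. dist (ip (X (r m)) y) (ip (X (r n)) y) < e"
      proof (intro exI allI impI)
        fix m n assume "N \<le> m" "N \<le> n"
        then show "dist (ip (X (r m)) y) (ip (X (r n)) y) < e"
          using N[of m n] close[of "r m"] close[of "r n"] unfolding dist_real_def by linarith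
      qed
    qed
    then show ?thesis using y by (simp add: K_def real_Cauchy_convergent)
  qed
  have K: "K \<subseteq> H" "K \<noteq> {}" using KH XK by auto
  interpret K: semi_hilbert K add scl ip
    by (rule closed_subspace[OF K K_add K_scl K_closed])
  define f where "f u = lim (\<lambda>n. ip (X (r n)) u)" for u
  have f: "(\<lambda>n. ip (X (r n)) u) \<longlonglongrightarrow> f u" if "u \<in> K" for u
    using that by (simp add: K_def f_def convergent_LIMSEQ_iff)
  have f_add: "f (add x y) = f x + f y" if "x \<in> K" "y \<in> K" for x y
    using LIMSEQ_unique[OF f[OF K_add[OF that]]] tendsto_add[OF f[OF that(1)] f[OF that(2)]]
    by (simp add: ip_add_right X KH that)
  have f_scl: "f (scl a x) = a * f x" if "x \<in> K" for a x
    using LIMSEQ_unique[OF f[OF K_scl[OF that, of a]]] tendsto_mult_left[OF f[OF that], of a]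
    by (simp add: ip_scl_right X KH that)
  have f_bound: "\<bar>f x\<bar> \<le> B * K.nrm x" if "x \<in> K" for x
    using tendsto_rabs[OF f[OF that]] bound[OF KH[OF that]]
    by (intro LIMSEQ_le_const2) (auto simp: K.nrm_def nrm_def)
  have "\<exists>v\<in>K. \<forall>u\<in>K. ip v u = f u" by (rule K.riesz[OF f_add f_scl f_bound])
  then obtain y where y: "y \<in> K" and yf: "\<And>u. u \<in> K \<Longrightarrow> ip y u = f u" by blast
  have "(\<lambda>n. ip (X (r n)) u) \<longlonglongrightarrow> ip y u" if u: "u \<in> H" for u
  proof -
    have "\<exists>p\<in>K. \<forall>w\<in>K. ip p w = ip u w"
      by (rule projection[OF K K_add K_scl K_closed u])
    then obtain p where p: "p \<in> K" and pu: "\<And>w. w \<in> K \<Longrightarrow> ip p w = ip u w" by blast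
    have pu': "ip w p = ip w u" if "w \<in> K" for w
      using pu[OF that] ip_commute[OF KH[OF that]] KH[OF p] u by simp
    show ?thesis
      using f[OF p] yf[OF p] by (simp add: pu' XK y)
  qed
  with r KH[OF y] show ?thesis by blast
qed

text \<open>The gliding hump argument: if the norms were unbounded, then along a subsequence one could
  add to a vector a multiple of norm \<open>3\<^sup>-\<^sup>k\<close> of the \<open>k\<close>-th member, with a sign that makes the
  pairing with that member large, and the later corrections would be too small to cancel this.\<close>

lemma uniform_boundedness:
  assumes X: "\<And>n::nat. X n \<in> H"
    and bdd: "\<And>u. u \<in> H \<Longrightarrow> \<exists>B. \<forall>n. \<bar>ip (X n) u\<bar> \<le> B"
  obtains B where "\<And>n. nrm (X n) \<le> B"
proof (rule ccontr)
  assume "\<not> thesis"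
  have unb: "\<exists>n. B < nrm (X n)" for B
  proof (rule ccontr)
    assume "\<nexists>n. B < nrm (X n)"
    then have "nrm (X n) \<le> B" for n by (auto simp: not_less)
    then have thesis by (rule that)
    with \<open>\<not> thesis\<close> show False ..
  qed
  have "\<forall>k::nat. \<exists>n. 4 ^ k < nrm (X n)" by (intro allI unb)
  from choice[OF this] obtain j where j: "\<And>k::nat. 4 ^ k < nrm (X (j k))" by blast
  have step: "\<exists>w\<in>H. dst u w \<le> (1/3) ^ k \<and> (2/3) * (1/3) ^ k * nrm (X (j k)) \<le> \<bar>ip (X (j k)) w\<bar>"
    if u: "u \<in> H" for u k
  proof -
    let ?x = "X (j k)"
    have pos: "0 < nrm ?x" using j[of k] by (smt (verit) zero_less_power)
    define a where "a = (1/3) ^ k / nrm ?x"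
    have a: "0 < a" using pos by (simp add: a_def)
    have hx: "?x \<in> H" by (rule X)
    have sh: "scl s ?x \<in> H" for s by (simp add: scl_closed X)
    have d: "dst u (add u (scl s ?x)) = \<bar>s\<bar> * nrm ?x" for s
    proof (rule power2_eq_imp_eq)
      show "(dst u (add u (scl s ?x)))\<^sup>2 = (\<bar>s\<bar> * nrm ?x)\<^sup>2"
        using u hx sh[of s] ip_commute[OF u hx]
        by (simp add: dst_square add_closed ip_add_left ip_add_right ip_scl_left ip_scl_right
            power_mult_distrib nrm_square) (simp add: power2_eq_square algebra_simps)
    qed (simp_all add: dst_nonneg nrm_nonneg u hx sh add_closed)
    have v: "ip ?x (add u (scl s ?x)) = ip ?x u + s * (nrm ?x)\<^sup>2" for s
      using u hx sh[of s] by (simp add: ip_add_right ip_scl_right nrm_square)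
    define P where "P = (1/3) ^ k * nrm ?x"
    have an: "a * (nrm ?x)\<^sup>2 = P" using pos by (simp add: a_def P_def power2_eq_square)
    have P: "0 < P" "(2/3) * (1/3) ^ k * nrm ?x = (2/3) * P" using pos by (simp_all add: P_def)
    have close: "\<bar>s\<bar> * nrm ?x = (1/3) ^ k" if "\<bar>s\<bar> = a" for s
      using pos that by (simp add: a_def)
    show ?thesis
    proof (cases "0 \<le> ip ?x u")
      case True
      then have "(2/3) * P \<le> \<bar>ip ?x (add u (scl a ?x))\<bar>" using v[of a] an P(1) by simp
      moreover have "dst u (add u (scl a ?x)) \<le> (1/3) ^ k" using d[of a] close[of a] a by simp
      ultimately show ?thesis unfolding P(2) using u sh add_closed by blast
    next
      case False
      then have "(2/3) * P \<le> \<bar>ip ?x (add u (scl (- a) ?x))\<bar>" using v[of "- a"] an P(1) by simp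
      moreover have "dst u (add u (scl (- a) ?x)) \<le> (1/3) ^ k" using d[of "- a"] close[of "- a"] a by simp
      ultimately show ?thesis unfolding P(2) using u sh add_closed by blast
    qed
  qed
  define g where "g k u = (SOME w. w \<in> H \<and> dst u w \<le> (1/3) ^ k \<and>
      (2/3) * (1/3) ^ k * nrm (X (j k)) \<le> \<bar>ip (X (j k)) w\<bar>)" for k u
  have g: "g k u \<in> H \<and> dst u (g k u) \<le> (1/3) ^ k \<and>
      (2/3) * (1/3) ^ k * nrm (X (j k)) \<le> \<bar>ip (X (j k)) (g k u)\<bar>" if "u \<in> H" for u k
    unfolding g_def by (rule someI_ex) (use step[OF that, of k] in blast)
  obtain z where z: "z \<in> H" using nonempty by blast
  define U where "U = rec_nat z (\<lambda>k u. g k u)"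
  have U_Suc: "U (Suc k) = g k (U k)" for k by (simp add: U_def)
  have U: "U k \<in> H" for k by (induction k) (use z g U_Suc in \<open>auto simp: U_def\<close>)
  have dU: "dst (U k) (U (Suc k)) \<le> (1/3) ^ k" for k using g[OF U, of k k] by (simp add: U_Suc)
  have fast: "dst (U k) (U (Suc k)) \<le> (1/2) ^ k" for k
    by (rule order_trans[OF dU]) (simp add: power_mono)
  obtain u where u: "u \<in> H" and lim: "(\<lambda>n. dst (U n) u) \<longlonglongrightarrow> 0"
    using fast_cauchy_limit[OF U fast] by blast
  have tail: "dst (U k) (U (k + m)) \<le> (3/2) * (1/3) ^ k" for k m
    using dst_geometric[OF U _ _ dU, of k m] by simp
  have du: "dst (U k) u \<le> (3/2) * (1/3) ^ k" for k
  proof (rule LIMSEQ_le_const)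
    show "(\<lambda>m. (3/2) * (1/3) ^ k + dst (U (m + k)) u) \<longlonglongrightarrow> (3/2) * (1/3) ^ k"
      using tendsto_add[OF tendsto_const LIMSEQ_ignore_initial_segment[OF lim, of k]] by simp
    have "dst (U k) u \<le> (3/2) * (1/3) ^ k + dst (U (m + k)) u" for m
      using dst_triangle[OF U[of k] U[of "m + k"] u] tail[of k m]
      unfolding add.commute[of m k] by linarith
    then show "\<exists>N. \<forall>m\<ge>N. dst (U k) u \<le> (3/2) * (1/3) ^ k + dst (U (m + k)) u" by blast
  qed
  \<comment> \<open>Of the fraction 2/3 secured at stage \<open>k\<close>, the later corrections, of
    total size at most (3/2)(1/3)^(k+1) = (1/2)(1/3)^k, cancel at most 1/2, and 1/6 remains. As the
    norm of \<open>X (j k)\<close> exceeds 4^k, the pairing grows like (4/3)^k.\<close>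
  have big: "(1/6) * (4/3) ^ k \<le> \<bar>ip (X (j k)) u\<bar>" for k
  proof -
    let ?x = "X (j k)"
    have "\<bar>ip ?x (U (Suc k)) - ip ?x u\<bar> \<le> dst (U (Suc k)) u * nrm ?x"
      using ip_diff_le[OF U u X, of "Suc k" "j k"] by (simp add: ip_commute[OF X] U u)
    also have "\<dots> \<le> (1/2) * (1/3) ^ k * nrm ?x"
      using du[of "Suc k"] by (intro mult_right_mono nrm_nonneg X) simp
    finally have "(1/6) * (1/3) ^ k * nrm ?x \<le> \<bar>ip ?x u\<bar>"
      using g[OF U, of k k] unfolding U_Suc by linarith
    moreover have "(1/6) * (1/3) ^ k * 4 ^ k \<le> (1/6) * (1/3) ^ k * nrm ?x"
      using j[of k] by (intro mult_left_mono) auto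
    moreover have "(1/6) * (1/3) ^ k * 4 ^ k = (1/6) * (4/3::real) ^ k"
      by (simp add: power_divide)
    ultimately show ?thesis by linarith
  qed
  obtain B where B: "\<And>n. \<bar>ip (X n) u\<bar> \<le> B" using bdd[OF u] by blast
  obtain k where "6 * B < (4/3) ^ k" using real_arch_pow[of "4/3" "6 * B"] by auto
  then show False using big[of k] B[of "j k"] by linarith
qed

end

lemma convergent_summable_diff:
  fixes X :: "nat \<Rightarrow> 'v::banach"
  assumes "summable (\<lambda>n. norm (X n - X (Suc n)))"
  shows "convergent X"
proof -
  have "summable (\<lambda>n. norm (X (Suc n) - X n))"
    using assms by (subst norm_minus_commute)
  then have "summable (\<lambda>n. X (Suc n) - X n)" by (rule summable_norm_cancel)
  then have "convergent (\<lambda>n. (\<Sum>i<n. X (Suc i) - X i) + X 0)"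
    by (intro convergent_add convergent_const) (simp add: summable_iff_convergent)
  then show ?thesis by (simp add: sum_lessThan_telescope)
qed

lemma semi_hilbert_UNIV:
  "semi_hilbert (UNIV :: 'v::{real_inner, banach} set) (+) (*\<^sub>R) (\<bullet>)"
proof
  fix X :: "nat \<Rightarrow> 'v"
  have d: "x \<bullet> x - 2 * (x \<bullet> y) + y \<bullet> y = (norm (x - y))\<^sup>2" for x y :: 'v
    by (simp add: power2_norm_eq_inner inner_diff_left inner_diff_right inner_commute)
  assume "\<And>n. X n \<bullet> X n - 2 * (X n \<bullet> X (Suc n)) + X (Suc n) \<bullet> X (Suc n) \<le> (1/4) ^ n"
  then have *: "(norm (X n - X (Suc n)))\<^sup>2 \<le> (1/4) ^ n" for n unfolding d .
  have "norm (X n - X (Suc n)) \<le> (1/2) ^ n" for n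
  proof (rule power2_le_imp_le)
    show "(norm (X n - X (Suc n)))\<^sup>2 \<le> ((1/2) ^ n)\<^sup>2"
      using *[of n] by (simp add: power2_eq_square flip: power_mult_distrib)
  qed simp
  then have "summable (\<lambda>n. norm (X n - X (Suc n)))"
    by (intro summable_comparison_test[OF _ summable_geometric[of "1/2"]]) auto
  then have "convergent X" by (rule convergent_summable_diff)
  then obtain y where "X \<longlonglongrightarrow> y" by (auto simp: convergent_def)
  then have "(\<lambda>n. (norm (X n - y))\<^sup>2) \<longlonglongrightarrow> (norm (y - y))\<^sup>2" by (intro tendsto_intros)
  then show "\<exists>y\<in>UNIV. (\<lambda>n. X n \<bullet> X n - 2 * (X n \<bullet> y) + y \<bullet> y) \<longlonglongrightarrow> 0"
    unfolding d by auto
qed (auto simp: inner_commute inner_left_distrib inner_right_distrib)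

section \<open>Square integrable functions with values in a separable Hilbert space\<close>

text \<open>A form of the Pettis theorem. Membership in a closed ball about \<open>d\<close> is the
  countable family of scalar conditions \<open>(f x - d) \<bullet> e \<le> r * norm e\<close> with
  \<open>e\<close> in \<open>D\<close>, and every open set is a countable union of balls with
  centres in \<open>D\<close> and radii \<open>1 / Suc n\<close>.\<close>

lemma borel_measurable_weakI:
  fixes f :: "'b \<Rightarrow> 'v::real_inner" and D :: "'v set"
  assumes D: "countable D" "closure D = UNIV"
    and f: "\<And>e. (\<lambda>x. f x \<bullet> e) \<in> borel_measurable M"
  shows "f \<in> borel_measurable M"
proof (rule borel_measurableI)
  fix S :: "'v set" assume S: "open S"
  have norm_le: "norm z \<le> r" if "0 \<le> r" and *: "\<And>e. e \<in> D \<Longrightarrow> z \<bullet> e \<le> r * norm e" for z r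
  proof -
    have "closed {e. z \<bullet> e \<le> r * norm e}"
      by (intro closed_Collect_le continuous_intros)
    then have "closure D \<subseteq> {e. z \<bullet> e \<le> r * norm e}"
      using * by (intro closure_minimal) auto
    then have "z \<bullet> z \<le> r * norm z" using D(2) by auto
    then show ?thesis
      using that(1) by (cases "z = 0") (auto simp: power2_norm_eq_inner[symmetric] power2_eq_square)
  qed
  have ball: "f -` cball d r \<inter> space M \<in> sets M" if "0 \<le> r" for d r
  proof -
    have "f -` cball d r \<inter> space M = {x \<in> space M. \<forall>e\<in>D. (f x - d) \<bullet> e \<le> r * norm e}"
    proof (intro set_eqI iffI)
      fix x assume x: "x \<in> f -` cball d r \<inter> space M"
      have "(f x - d) \<bullet> e \<le> r * norm e" for e
      proof -
        have "(f x - d) \<bullet> e \<le> norm (f x - d) * norm e" by (rule norm_cauchy_schwarz)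
        also have "\<dots> \<le> r * norm e"
          using x by (intro mult_right_mono) (auto simp: dist_norm norm_minus_commute)
        finally show ?thesis .
      qed
      with x show "x \<in> {x \<in> space M. \<forall>e\<in>D. (f x - d) \<bullet> e \<le> r * norm e}" by simp
    next
      fix x assume "x \<in> {x \<in> space M. \<forall>e\<in>D. (f x - d) \<bullet> e \<le> r * norm e}"
      then show "x \<in> f -` cball d r \<inter> space M"
        using norm_le[OF that, of "f x - d"] by (auto simp: dist_norm norm_minus_commute)
    qed
    also have "\<dots> = space M - (\<Union>e\<in>D. {x \<in> space M. \<not> (f x - d) \<bullet> e \<le> r * norm e})"
      by auto
    also have "\<dots> \<in> sets M"
    proof (intro sets.Diff sets.top sets.countable_UN'' D(1))
      show "{x \<in> space M. \<not> (f x - d) \<bullet> e \<le> r * norm e} \<in> sets M" for e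
        using f[of e] unfolding inner_diff_left by measurable
    qed
    finally show ?thesis .
  qed
  define I where "I = {(d, n :: nat). d \<in> D \<and> cball d (1 / Suc n) \<subseteq> S}"
  have S_eq: "S = (\<Union>(d, n)\<in>I. cball d (1 / Suc n))"
  proof (intro set_eqI iffI)
    fix x assume "x \<in> S"
    then obtain e where e: "0 < e" "ball x e \<subseteq> S" using S by (auto simp: open_contains_ball)
    \<comment> \<open>Half of \<open>e\<close>, because the ball about \<open>d\<close> has to
      contain \<open>x\<close> and still lie within \<open>e\<close> of \<open>x\<close>.\<close>
    obtain n where n: "1 / Suc n < e / 2" using nat_approx_posE[of "e/2"] e(1) by auto
    have "x \<in> closure D" using D(2) by simp
    then obtain d where d: "d \<in> D" "dist d x < 1 / Suc n"
      unfolding closure_approachable by (metis divide_pos_pos of_nat_0_less_iff zero_less_Suc zero_less_one)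
    have "cball d (1 / Suc n) \<subseteq> S"
    proof
      fix z assume "z \<in> cball d (1 / Suc n)"
      then have "dist x z < e"
        using d(2) n dist_triangle[of x z d] by (simp add: dist_commute)
      then show "z \<in> S" using e(2) by auto
    qed
    then show "x \<in> (\<Union>(d, n)\<in>I. cball d (1 / Suc n))"
      using d by (intro UN_I[of "(d, n)"]) (auto simp: I_def)
  qed (auto simp: I_def)
  have "f -` S \<inter> space M = (\<Union>(d, n)\<in>I. f -` cball d (1 / Suc n) \<inter> space M)"
    by (subst S_eq) auto
  also have "\<dots> \<in> sets M"
  proof (rule sets.countable_UN'')
    have "I \<subseteq> D \<times> UNIV" by (auto simp: I_def)
    then show "countable I" by (rule countable_subset) (simp add: D(1))
  next
    show "(case i of (d, n) \<Rightarrow> f -` cball d (1 / Suc n) \<inter> space M) \<in> sets M" for i :: "'v \<times> nat"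
      using ball[of "1 / Suc (snd i)" "fst i"] by (simp add: case_prod_beta)
  qed
  finally show "f -` S \<inter> space M \<in> sets M" .
qed

lemma borel_measurable_inner_const:
  fixes f :: "'b \<Rightarrow> 'v::real_inner"
  assumes "f \<in> borel_measurable M"
  shows "(\<lambda>x. f x \<bullet> e) \<in> borel_measurable M"
proof -
  have "(\<lambda>y. y \<bullet> e) \<in> borel_measurable (borel :: 'v measure)"
    by (intro borel_measurable_continuous_onI continuous_intros)
  from measurable_compose[OF assms this] show ?thesis .
qed

abbreviation L01 :: "real measure" where "L01 \<equiv> lebesgue_on {0..1}"

lemma prob_space_L01: "prob_space L01"
  by (rule prob_spaceI) (simp add: emeasure_restrict_space)

interpretation L01: prob_space L01 by (rule prob_space_L01)

text \<open>Without separability a sum of two Borel measurable functions may fail to be Borel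
  measurable. A countable dense set reduces such questions to scalar pairings.\<close>

locale separable_hilbert =
  fixes D :: "'v::{real_inner, banach} set"
  assumes countable_D: "countable D" and dense_D: "closure D = UNIV"
begin

lemmas weakI = borel_measurable_weakI[OF countable_D dense_D]

lemma measurable_add:
  fixes f g :: "'b \<Rightarrow> 'v"
  assumes "f \<in> borel_measurable M" "g \<in> borel_measurable M"
  shows "(\<lambda>x. f x + g x) \<in> borel_measurable M"
  using assms[THEN borel_measurable_inner_const] by (intro weakI) (simp add: inner_add_left)

lemma measurable_scaleR:
  fixes f :: "'b \<Rightarrow> 'v"
  assumes "g \<in> borel_measurable M" "f \<in> borel_measurable M"
  shows "(\<lambda>x. g x *\<^sub>R f x) \<in> borel_measurable M"
  using assms(1) assms(2)[THEN borel_measurable_inner_const] by (intro weakI) simp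

lemma measurable_diff:
  fixes f g :: "'b \<Rightarrow> 'v"
  assumes "f \<in> borel_measurable M" "g \<in> borel_measurable M"
  shows "(\<lambda>x. f x - g x) \<in> borel_measurable M"
  using assms[THEN borel_measurable_inner_const] by (intro weakI) (simp add: inner_diff_left)

text \<open>By polarization only norms of measurable functions occur, so no product Borel structure
  on pairs of vectors enters.\<close>

lemma measurable_inner:
  fixes f g :: "'b \<Rightarrow> 'v"
  assumes f: "f \<in> borel_measurable M" and g: "g \<in> borel_measurable M"
  shows "(\<lambda>x. f x \<bullet> g x) \<in> borel_measurable M"
proof -
  have "(\<lambda>x. ((norm (f x + g x))\<^sup>2 - (norm (f x))\<^sup>2 - (norm (g x))\<^sup>2) / 2) \<in> borel_measurable M"
    using measurable_add[OF f g] f g by measurable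
  moreover have "((norm (f x + g x))\<^sup>2 - (norm (f x))\<^sup>2 - (norm (g x))\<^sup>2) / 2 = f x \<bullet> g x" for x
    by (simp add: power2_norm_eq_inner inner_add_left inner_add_right inner_commute)
  ultimately show ?thesis by simp
qed

lemma L2V_integrable_inner:
  fixes u v :: "real \<Rightarrow> 'v"
  assumes "u \<in> L2V" "v \<in> L2V"
  shows "integrable L01 (\<lambda>t. u t \<bullet> v t)"
proof (rule Bochner_Integration.integrable_bound)
  show "integrable L01 (\<lambda>t. (norm (u t))\<^sup>2 + (norm (v t))\<^sup>2)"
    using assms by (simp add: L2V_def)
  show "(\<lambda>t. u t \<bullet> v t) \<in> borel_measurable L01"
    using assms by (intro measurable_inner) (simp_all add: L2V_def)
  have "\<bar>x \<bullet> y\<bar> \<le> (norm x)\<^sup>2 + (norm y)\<^sup>2" for x y :: 'v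
  proof -
    have "0 \<le> (norm x - norm y)\<^sup>2" "0 \<le> (norm x)\<^sup>2 + (norm y)\<^sup>2" by simp_all
    then show ?thesis
      using Cauchy_Schwarz_ineq2[of x y] unfolding power2_diff by linarith
  qed
  then show "AE t in L01. norm (u t \<bullet> v t) \<le> norm ((norm (u t))\<^sup>2 + (norm (v t))\<^sup>2)"
    by (intro AE_I2) (simp add: abs_of_nonneg)
qed

lemma L2V_add:
  fixes u v :: "real \<Rightarrow> 'v"
  assumes "u \<in> L2V" "v \<in> L2V"
  shows "(\<lambda>t. u t + v t) \<in> L2V"
proof -
  have "integrable L01 (\<lambda>t. u t \<bullet> u t + 2 * (u t \<bullet> v t) + v t \<bullet> v t)"
    using assms by (intro Bochner_Integration.integrable_add integrable_mult_right L2V_integrable_inner)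
  then show ?thesis
    using assms measurable_add[of u L01 v]
    by (simp add: L2V_def power2_norm_eq_inner inner_add_left inner_add_right inner_commute algebra_simps)
qed

lemma L2V_scaleR:
  fixes u :: "real \<Rightarrow> 'v"
  assumes "u \<in> L2V"
  shows "(\<lambda>t. a *\<^sub>R u t) \<in> L2V"
  using assms measurable_scaleR[of "\<lambda>_. a" L01 u] by (simp add: L2V_def power_mult_distrib)

lemma L2V_diff:
  fixes u v :: "real \<Rightarrow> 'v"
  assumes "u \<in> L2V" "v \<in> L2V"
  shows "(\<lambda>t. u t - v t) \<in> L2V"
  using L2V_add[OF assms(1) L2V_scaleR[OF assms(2), of "-1"]] by simp

lemma zero_L2V: "(\<lambda>t. 0 :: 'v) \<in> L2V"
  by (simp add: L2V_def)

lemma semi_inner_product_L2V: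
  "semi_inner_product (L2V :: (real \<Rightarrow> 'v) set) (\<lambda>u v t. u t + v t) (\<lambda>a u t. a *\<^sub>R u t) L2V_inner"
proof
  show "(L2V :: (real \<Rightarrow> 'v) set) \<noteq> {}" using zero_L2V by blast
  show "L2V_inner x y = L2V_inner y x" for x y :: "real \<Rightarrow> 'v"
    by (simp add: L2V_inner_def inner_commute)
qed (simp_all add: L2V_add L2V_scaleR L2V_inner_def inner_add_left L2V_integrable_inner)

lemma L2V_inner_diff:
  fixes u v :: "real \<Rightarrow> 'v"
  assumes "u \<in> L2V" "v \<in> L2V"
  shows "L2V_inner u u - 2 * L2V_inner u v + L2V_inner v v = (\<integral>t. (norm (u t - v t))\<^sup>2 \<partial>L01)"
  using assms
  by (simp add: L2V_inner_def power2_norm_eq_inner inner_diff_left inner_diff_right inner_commute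
      L2V_integrable_inner algebra_simps)

text \<open>The Riesz-Fischer argument. The increments have summable integrals, so they are summable
  at almost every time and the sequence converges there; Fatou's lemma carries the bound on the
  tails over to the distance from the pointwise limit.\<close>

lemma L2V_complete_fast:
  fixes X :: "nat \<Rightarrow> real \<Rightarrow> 'v"
  assumes X: "\<And>n. X n \<in> L2V"
    and fast: "\<And>n. L2V_inner (X n) (X n) - 2 * L2V_inner (X n) (X (Suc n))
      + L2V_inner (X (Suc n)) (X (Suc n)) \<le> (1/4) ^ n"
  shows "\<exists>y\<in>L2V. (\<lambda>n. L2V_inner (X n) (X n) - 2 * L2V_inner (X n) y + L2V_inner y y) \<longlonglongrightarrow> 0"
proof -
  interpret L2: semi_inner_product "L2V :: (real \<Rightarrow> 'v) set" "\<lambda>u v t. u t + v t" "\<lambda>a u t. a *\<^sub>R u t" L2V_inner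
    by (rule semi_inner_product_L2V)
  have Xm: "X n \<in> borel_measurable L01" for n using X[of n] by (simp add: L2V_def)
  have dm: "(\<lambda>t. norm (X n t - X m t)) \<in> borel_measurable L01" for n m
    using measurable_diff[OF Xm Xm, of n m] by measurable
  have dsq: "(L2.dst u v)\<^sup>2 = (\<integral>t. (norm (u t - v t))\<^sup>2 \<partial>L01)" if "u \<in> L2V" "v \<in> L2V" for u v :: "real \<Rightarrow> 'v"
    using L2.dst_square[OF that] L2V_inner_diff[OF that] by simp
  have dsi: "integrable L01 (\<lambda>t. (norm (u t - v t))\<^sup>2)" if "u \<in> L2V" "v \<in> L2V" for u v :: "real \<Rightarrow> 'v"
    using L2V_diff[OF that] by (simp add: L2V_def)
  define g where "g n t = norm (X n t - X (Suc n) t)" for n t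
  have gm [measurable]: "g n \<in> borel_measurable L01" for n unfolding g_def by (rule dm)
  have g_le: "(\<integral>\<^sup>+t. ennreal (g n t) \<partial>L01) \<le> ennreal ((1/2) ^ n)" for n
  proof -
    have i: "integrable L01 (\<lambda>t. (g n t)\<^sup>2)" using dsi[OF X X] by (simp add: g_def)
    \<comment> \<open>The weight 2^n balances the two terms: after integration each is at most
      2^(-n). This takes the place of the Cauchy-Schwarz inequality.\<close>
    have "g n t \<le> (2 ^ n * (g n t)\<^sup>2 + (1/2) ^ n) / 2" for t
    proof -
      have "0 \<le> 2 ^ n * (g n t - (1/2) ^ n)\<^sup>2" by simp
      also have "\<dots> = 2 ^ n * (g n t)\<^sup>2 - 2 * (2 ^ n * (1/2) ^ n) * g n t + (2 ^ n * (1/2) ^ n) * (1/2) ^ n"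
        by (simp add: power2_eq_square algebra_simps)
      also have "2 ^ n * (1/2::real) ^ n = 1" by (simp flip: power_mult_distrib)
      finally show ?thesis by simp
    qed
    then have "(\<integral>\<^sup>+t. ennreal (g n t) \<partial>L01) \<le> (\<integral>\<^sup>+t. ennreal ((2 ^ n * (g n t)\<^sup>2 + (1/2) ^ n) / 2) \<partial>L01)"
      by (intro nn_integral_mono ennreal_leI)
    also have "\<dots> = ennreal (\<integral>t. (2 ^ n * (g n t)\<^sup>2 + (1/2) ^ n) / 2 \<partial>L01)"
      using i by (intro nn_integral_eq_integral) auto
    finally have *: "(\<integral>\<^sup>+t. ennreal (g n t) \<partial>L01) \<le> ennreal (\<integral>t. (2 ^ n * (g n t)\<^sup>2 + (1/2) ^ n) / 2 \<partial>L01)" .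
    have "(\<integral>t. (2 ^ n * (g n t)\<^sup>2 + (1/2) ^ n) / 2 \<partial>L01) = (2 ^ n * (\<integral>t. (g n t)\<^sup>2 \<partial>L01) + (1/2) ^ n) / 2"
      using i L01.prob_space by simp
    also have "\<dots> \<le> (2 ^ n * (1/4) ^ n + (1/2) ^ n) / 2"
      using fast[of n] L2V_inner_diff[OF X X, of n "Suc n"] by (simp add: g_def)
    also have "2 ^ n * (1/4::real) ^ n = (1/2) ^ n" by (simp flip: power_mult_distrib)
    finally have "(\<integral>t. (2 ^ n * (g n t)\<^sup>2 + (1/2) ^ n) / 2 \<partial>L01) \<le> (1/2) ^ n" by simp
    then show ?thesis using * ennreal_leI order_trans by blast
  qed
  define G where "G = {t \<in> space L01. (\<Sum>n. ennreal (g n t)) < \<infinity>}"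
  have G [measurable]: "G \<in> sets L01" unfolding G_def by measurable
  have "(\<integral>\<^sup>+t. (\<Sum>n. ennreal (g n t)) \<partial>L01) = (\<Sum>n. \<integral>\<^sup>+t. ennreal (g n t) \<partial>L01)"
    by (rule nn_integral_suminf) measurable
  also have "\<dots> \<le> (\<Sum>n. ennreal ((1/2) ^ n))" by (intro suminf_le g_le) auto
  also have "\<dots> = ennreal (\<Sum>n. (1/2) ^ n)" by (rule suminf_ennreal2) (auto intro: summable_geometric)
  also have "\<dots> < \<infinity>" by simp
  finally have "AE t in L01. (\<Sum>n. ennreal (g n t)) \<noteq> \<infinity>"
    by (intro nn_integral_noteq_infinite) auto
  then have AE_G: "AE t in L01. t \<in> G"
    by (rule AE_mp) (auto simp: G_def less_top intro!: AE_I2)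
  have conv: "convergent (\<lambda>n. X n t)" if "t \<in> G" for t
  proof -
    have "(\<Sum>n. ennreal (g n t)) \<noteq> top" using that by (simp add: G_def less_top)
    then have "summable (\<lambda>n. g n t)"
      by (rule summable_suminf_not_top[rotated]) (simp add: g_def)
    then show ?thesis unfolding g_def by (rule convergent_summable_diff)
  qed
  \<comment> \<open>The value 0 off \<open>G\<close> makes each pairing of \<open>y\<close> an
    everywhere limit of the functions \<open>indicator G t * (X n t \<bullet> e)\<close>, hence
    measurable.\<close>
  define y where "y t = (if t \<in> G then lim (\<lambda>n. X n t) else 0)" for t
  have lim_y: "(\<lambda>n. X n t) \<longlonglongrightarrow> y t" if "t \<in> G" for t
    using conv[OF that] that by (simp add: y_def convergent_LIMSEQ_iff)
  have ym: "y \<in> borel_measurable L01"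
  proof (rule weakI)
    fix e
    show "(\<lambda>t. y t \<bullet> e) \<in> borel_measurable L01"
    proof (rule borel_measurable_LIMSEQ_real)
      show "(\<lambda>t. indicator G t * (X n t \<bullet> e)) \<in> borel_measurable L01" for n
        using borel_measurable_inner_const[OF Xm, of n e] by measurable
      show "(\<lambda>n. indicator G t * (X n t \<bullet> e)) \<longlonglongrightarrow> y t \<bullet> e" for t
        using tendsto_inner[OF lim_y tendsto_const, of t e] by (cases "t \<in> G") (auto simp: y_def)
    qed
  qed
  have fast': "L2.dst (X n) (X (Suc n)) \<le> (1/2) ^ n" for n
  proof (rule power2_le_imp_le)
    have "((1/2) ^ n)\<^sup>2 = (1/4::real) ^ n"
      by (simp add: power2_eq_square flip: power_mult_distrib)
    then show "(L2.dst (X n) (X (Suc n)))\<^sup>2 \<le> ((1/2) ^ n)\<^sup>2"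
      using fast[of n] L2.dst_square[OF X X] by simp
  qed simp
  have tail: "L2.dst (X n) (X (n + m)) \<le> 2 * (1/2) ^ n" for n m
    using L2.dst_geometric[OF X _ _ fast', of n m] by simp
  have fatou: "(\<integral>\<^sup>+t. ennreal ((norm (X n t - y t))\<^sup>2) \<partial>L01) \<le> ennreal (4 * (1/4) ^ n)" for n
  proof -
    have "(\<integral>\<^sup>+t. ennreal ((norm (X n t - y t))\<^sup>2) \<partial>L01)
        = (\<integral>\<^sup>+t. liminf (\<lambda>m. ennreal ((norm (X n t - X (n + m) t))\<^sup>2)) \<partial>L01)"
    proof (rule nn_integral_cong_AE, rule AE_mp[OF AE_G], rule AE_I2, rule impI)
      fix t assume "t \<in> G"
      then have "(\<lambda>m. X (n + m) t) \<longlonglongrightarrow> y t"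
        using LIMSEQ_ignore_initial_segment[OF lim_y, of t n] by (simp add: add.commute)
      then have "(\<lambda>m. ennreal ((norm (X n t - X (n + m) t))\<^sup>2)) \<longlonglongrightarrow> ennreal ((norm (X n t - y t))\<^sup>2)"
        by (intro tendsto_intros tendsto_ennrealI)
      then show "ennreal ((norm (X n t - y t))\<^sup>2) = liminf (\<lambda>m. ennreal ((norm (X n t - X (n + m) t))\<^sup>2))"
        by (intro lim_imp_Liminf[symmetric]) auto
    qed
    also have "\<dots> \<le> liminf (\<lambda>m. \<integral>\<^sup>+t. ennreal ((norm (X n t - X (n + m) t))\<^sup>2) \<partial>L01)"
      using dm by (intro nn_integral_liminf) auto
    also have "\<dots> \<le> ennreal (4 * (1/4) ^ n)"
    proof (rule Liminf_le)
      show "\<forall>\<^sub>F m in sequentially. (\<integral>\<^sup>+t. ennreal ((norm (X n t - X (n + m) t))\<^sup>2) \<partial>L01) \<le> ennreal (4 * (1/4) ^ n)"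
      proof (rule always_eventually, rule allI)
        fix m
        have "(\<integral>\<^sup>+t. ennreal ((norm (X n t - X (n + m) t))\<^sup>2) \<partial>L01) = ennreal ((L2.dst (X n) (X (n + m)))\<^sup>2)"
          unfolding dsq[OF X X] by (intro nn_integral_eq_integral dsi X) auto
        also have "\<dots> \<le> ennreal ((2 * (1/2) ^ n)\<^sup>2)"
          by (intro ennreal_leI power_mono L2.dst_nonneg X tail)
        also have "(2 * (1/2) ^ n)\<^sup>2 = 4 * (1/4::real) ^ n"
          by (simp add: power2_eq_square flip: power_mult_distrib)
        finally show "(\<integral>\<^sup>+t. ennreal ((norm (X n t - X (n + m) t))\<^sup>2) \<partial>L01) \<le> ennreal (4 * (1/4) ^ n)" .
      qed
    qed simp
    finally show ?thesis .
  qed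
  have di: "integrable L01 (\<lambda>t. (norm (X n t - y t))\<^sup>2)" for n
  proof (rule integrableI_bounded)
    show "(\<lambda>t. (norm (X n t - y t))\<^sup>2) \<in> borel_measurable L01"
      using measurable_diff[OF Xm ym, of n] by measurable
    show "(\<integral>\<^sup>+t. ennreal (norm ((norm (X n t - y t))\<^sup>2)) \<partial>L01) < \<infinity>"
      using fatou[of n] by (auto simp: less_top[symmetric] top_unique elim: order_le_less_trans)
  qed
  \<comment> \<open>Fatou controls only differences, so \<open>y\<close> is recovered as
    \<open>X 0\<close> minus a square integrable function.\<close>
  have "(\<lambda>t. X 0 t - y t) \<in> L2V"
    using measurable_diff[OF Xm ym] di[of 0] by (simp add: L2V_def)
  from L2V_diff[OF X[of 0] this] have y: "y \<in> L2V" by simp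
  have "(\<lambda>n. \<integral>t. (norm (X n t - y t))\<^sup>2 \<partial>L01) \<longlonglongrightarrow> 0"
  proof (rule tendsto_sandwich)
    show "\<forall>\<^sub>F n in sequentially. 0 \<le> (\<integral>t. (norm (X n t - y t))\<^sup>2 \<partial>L01)" by simp
    show "\<forall>\<^sub>F n in sequentially. (\<integral>t. (norm (X n t - y t))\<^sup>2 \<partial>L01) \<le> 4 * (1/4) ^ n"
    proof (rule always_eventually, rule allI)
      fix n
      have "ennreal (\<integral>t. (norm (X n t - y t))\<^sup>2 \<partial>L01) \<le> ennreal (4 * (1/4) ^ n)"
        using fatou[of n] by (subst nn_integral_eq_integral[symmetric]) (auto intro: di)
      then show "(\<integral>t. (norm (X n t - y t))\<^sup>2 \<partial>L01) \<le> 4 * (1/4) ^ n" by (simp add: ennreal_le_iff)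
    qed
    have "(\<lambda>n. 4 * (1/4::real) ^ n) \<longlonglongrightarrow> 4 * 0" by (intro tendsto_intros LIMSEQ_power_zero) simp
    then show "(\<lambda>n. 4 * (1/4::real) ^ n) \<longlonglongrightarrow> 0" by simp
  qed simp
  with y show ?thesis by (intro bexI[of _ y]) (simp_all add: L2V_inner_diff X)
qed

lemma semi_hilbert_L2V:
  "semi_hilbert (L2V :: (real \<Rightarrow> 'v) set) (\<lambda>u v t. u t + v t) (\<lambda>a u t. a *\<^sub>R u t) L2V_inner"
proof -
  interpret semi_inner_product "L2V :: (real \<Rightarrow> 'v) set" "\<lambda>u v t. u t + v t" "\<lambda>a u t. a *\<^sub>R u t" L2V_inner
    by (rule semi_inner_product_L2V)
  show ?thesis by standard (rule L2V_complete_fast)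
qed

end

section \<open>Integration on the unit interval\<close>

lemma integrable_L01_sub:
  fixes f :: "real \<Rightarrow> 'b::euclidean_space"
  assumes "integrable L01 f" "{a..b} \<subseteq> {0..1}"
  shows "integrable (lebesgue_on {a..b}) f"
  using integrable_subinterval[of 0 1 f a b] assms by simp

lemma integrable_mult_continuous:
  fixes K :: "real \<Rightarrow> real" and f :: "real \<Rightarrow> real"
  assumes K: "integrable L01 K" and f: "continuous_on {0..1} f"
  shows "integrable L01 (\<lambda>t. K t * f t)"
proof -
  have fm: "f \<in> borel_measurable L01"
    by (rule continuous_imp_measurable_on_sets_lebesgue[OF f]) simp
  have "bounded (f ` {0..1})" using f compact_continuous_image compact_imp_bounded by blast
  then obtain B where B: "\<forall>t\<in>{0..1}. \<bar>f t\<bar> \<le> B" by (auto simp: bounded_iff)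
  show ?thesis
  proof (rule Bochner_Integration.integrable_bound[OF integrable_mult_right[OF K, of B]])
    show "(\<lambda>t. K t * f t) \<in> borel_measurable L01" using K fm by measurable
    show "AE t in L01. norm (K t * f t) \<le> norm (B * K t)"
    proof (rule AE_I2)
      fix t assume "t \<in> space L01"
      then have "\<bar>f t\<bar> \<le> \<bar>B\<bar>" using bspec[OF B, of t] by simp
      from mult_right_mono[OF this, of "\<bar>K t\<bar>"]
      show "norm (K t * f t) \<le> norm (B * K t)" by (simp add: abs_mult mult.commute)
    qed
  qed
qed

lemma continuous_on_lebesgue_integral:
  fixes f :: "real \<Rightarrow> 'b::euclidean_space"
  assumes f: "integrable L01 f"
  shows "continuous_on {0..1} (\<lambda>t. \<integral>s. f s \<partial>lebesgue_on {0..t})"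
proof -
  have "f integrable_on {0..1}"
    using has_integral_integral_lebesgue_on[OF f] by (auto simp: integrable_on_def)
  then have "continuous_on {0..1} (\<lambda>t. integral {0..t} f)"
    by (rule indefinite_integral_continuous_1)
  moreover have "integral {0..t} f = (\<integral>s. f s \<partial>lebesgue_on {0..t})" if "t \<in> {0..1}" for t
    using that by (intro lebesgue_integral_eq_integral[symmetric] integrable_L01_sub[OF f]) auto
  ultimately show ?thesis by (rule continuous_on_eq)
qed

lemma integral_L01_combine:
  fixes f :: "real \<Rightarrow> 'b::euclidean_space"
  assumes f: "integrable L01 f" and "0 \<le> s" "s \<le> t" "t \<le> 1"
  shows "(\<integral>r. f r \<partial>lebesgue_on {0..t}) - (\<integral>r. f r \<partial>lebesgue_on {0..s}) = (\<integral>r. f r \<partial>lebesgue_on {s..t})"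
  using integral_combine[of 0 t f s] integrable_L01_sub[OF f, of 0 t] assms by simp

lemma integral_sub_le:
  fixes f :: "real \<Rightarrow> real"
  assumes "integrable L01 f" "\<And>t. 0 \<le> f t" "{a..b} \<subseteq> {0..1}"
  shows "(\<integral>t. f t \<partial>lebesgue_on {a..b}) \<le> (\<integral>t. f t \<partial>L01)"
  by (rule integral_mono_lebesgue_on_AE) (use assms in auto)

section \<open>Gronwall estimates for a square integrable kernel\<close>

lemma integral_exp_le:
  fixes c d :: real
  assumes c: "c \<noteq> 0" and ab: "a \<le> b"
  shows "integrable (lebesgue_on {a..b}) (\<lambda>s. exp (c * (s - d)))"
    and "(\<integral>s. exp (c * (s - d)) \<partial>lebesgue_on {a..b}) = exp (c * (b - d)) / c - exp (c * (a - d)) / c"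
proof -
  have "((\<lambda>s. exp (c * (s - d))) has_integral (exp (c * (b - d)) / c - exp (c * (a - d)) / c)) {a..b}"
  proof (rule fundamental_theorem_of_calculus[OF ab])
    fix s assume "s \<in> {a..b}"
    have "((\<lambda>s. exp (c * (s - d)) / c) has_real_derivative exp (c * (s - d))) (at s within {a..b})"
      using c by (auto intro!: derivative_eq_intros)
    then show "((\<lambda>s. exp (c * (s - d)) / c) has_vector_derivative exp (c * (s - d))) (at s within {a..b})"
      by (simp add: has_real_derivative_iff_has_vector_derivative)
  qed
  moreover show i: "integrable (lebesgue_on {a..b}) (\<lambda>s. exp (c * (s - d)))"
    by (rule continuous_imp_integrable_real) (intro continuous_intros)
  ultimately show "(\<integral>s. exp (c * (s - d)) \<partial>lebesgue_on {a..b}) = exp (c * (b - d)) / c - exp (c * (a - d)) / c"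
    using lebesgue_integral_eq_integral[OF i] by (simp add: integral_unique)
qed

text \<open>The arithmetic-geometric mean inequality \<open>K e \<le> K\<^sup>2 / (4 A) + A e\<^sup>2\<close> replaces the
  Cauchy-Schwarz inequality here.\<close>

lemma weighted_kernel_bound:
  fixes K :: "real \<Rightarrow> real"
  assumes K2: "integrable L01 (\<lambda>t. (K t)\<^sup>2)" and Ki: "integrable L01 K"
    and A: "0 < A" "(\<integral>t. (K t)\<^sup>2 \<partial>L01) \<le> A"
    and sub: "{a..b} \<subseteq> {0..1}" "a \<le> b"
    and c: "c = 2 * A \<and> d = b \<or> c = - (2 * A) \<and> d = a"
  shows "(\<integral>s. K s * exp (c * s) \<partial>lebesgue_on {a..b}) \<le> exp (c * d) / 2"
proof -
  have c0: "2 * c \<noteq> 0" using A c by auto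
  note e = integral_exp_le[OF c0 sub(2), of d]
  have Ke: "integrable (lebesgue_on {a..b}) (\<lambda>s. K s * exp (c * s))"
    by (intro integrable_L01_sub[OF _ sub(1)] integrable_mult_continuous Ki continuous_intros)
  have i2: "integrable (lebesgue_on {a..b}) (\<lambda>s. (K s)\<^sup>2)" by (rule integrable_L01_sub[OF K2 sub(1)])
  have "K s * exp (c * s) \<le> exp (c * d) * ((K s)\<^sup>2 / (4 * A) + A * exp (2 * c * (s - d)))" for s
  proof -
    let ?e = "exp (c * (s - d))"
    have "0 \<le> (K s / 2 - A * ?e)\<^sup>2 / A" using A by simp
    also have "\<dots> = (K s)\<^sup>2 / (4 * A) - K s * ?e + A * ?e\<^sup>2"
      using A by (simp add: power2_eq_square field_simps)
    finally have "K s * ?e \<le> (K s)\<^sup>2 / (4 * A) + A * ?e\<^sup>2" by simp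
    moreover have "?e\<^sup>2 = exp (2 * c * (s - d))" by (simp add: exp_double[symmetric] algebra_simps)
    ultimately have "exp (c * d) * (K s * ?e) \<le> exp (c * d) * ((K s)\<^sup>2 / (4 * A) + A * exp (2 * c * (s - d)))"
      by (intro mult_left_mono) auto
    moreover have "exp (c * s) = exp (c * d) * ?e" by (simp add: exp_add[symmetric] algebra_simps)
    ultimately show ?thesis by (simp only: mult.left_commute)
  qed
  then have "(\<integral>s. K s * exp (c * s) \<partial>lebesgue_on {a..b})
      \<le> (\<integral>s. exp (c * d) * ((K s)\<^sup>2 / (4 * A) + A * exp (2 * c * (s - d))) \<partial>lebesgue_on {a..b})"
    using i2 e(1) Ke by (intro integral_mono) auto
  also have "\<dots> = exp (c * d) * ((\<integral>s. (K s)\<^sup>2 \<partial>lebesgue_on {a..b}) / (4 * A)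
      + A * (\<integral>s. exp (2 * c * (s - d)) \<partial>lebesgue_on {a..b}))"
    using i2 e(1) by simp
  \<comment> \<open>\<open>d\<close> is the end of the interval at which the weight is largest, so
    the exponential integrates to at most 1/(4A). Each of the two terms contributes 1/4; this is the
    origin of the rate 2A and of the final factor 1/2.\<close>
  also have "\<dots> \<le> exp (c * d) * (1 / 4 + A * (1 / (4 * A)))"
  proof (intro mult_left_mono add_mono)
    have "(\<integral>s. (K s)\<^sup>2 \<partial>lebesgue_on {a..b}) \<le> A"
      using integral_sub_le[OF K2 _ sub(1)] A(2) by simp
    then show "(\<integral>s. (K s)\<^sup>2 \<partial>lebesgue_on {a..b}) / (4 * A) \<le> 1 / 4" using A by (simp add: field_simps)
    show "(\<integral>s. exp (2 * c * (s - d)) \<partial>lebesgue_on {a..b}) \<le> 1 / (4 * A)"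
      unfolding e(2) using c A by (auto simp: field_simps)
  qed (use A in auto)
  also have "\<dots> = exp (c * d) / 2" using A by simp
  finally show ?thesis .
qed

text \<open>At a point \<open>r\<close> that maximizes \<open>f / E\<close>, with maximum
  \<open>m\<close>, the hypotheses give \<open>m \<le> a + m / 2\<close>. The interval
  \<open>{l t..u t}\<close> is left general so that time can run in either direction.\<close>

lemma gronwall_weighted:
  fixes K f E :: "real \<Rightarrow> real"
  assumes Ki: "integrable L01 K" and K0: "\<And>t. 0 \<le> K t"
    and S: "\<And>t. t \<in> {0..1} \<Longrightarrow> {l t..u t} \<subseteq> {0..1}"
    and E: "continuous_on {0..1} E" "\<And>t. 0 < E t"
    and KE: "\<And>t. t \<in> {0..1} \<Longrightarrow> (\<integral>s. K s * E s \<partial>lebesgue_on {l t..u t}) \<le> E t / 2"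
    and f: "continuous_on {0..1} f" and a: "0 \<le> a"
    and f_le: "\<And>t. t \<in> {0..1} \<Longrightarrow> f t \<le> a * E t + (\<integral>s. K s * f s \<partial>lebesgue_on {l t..u t})"
    and t: "t \<in> {0..1}"
  shows "f t \<le> 2 * a * E t"
proof -
  have "continuous_on {0..1} (\<lambda>t. f t / E t)"
    using E(2) by (intro continuous_on_divide f E(1)) (metis less_irrefl)
  then obtain r where r: "r \<in> {0..1}" and max: "\<And>s. s \<in> {0..1} \<Longrightarrow> f s / E s \<le> f r / E r"
    using continuous_attains_sup[of "{0..1::real}" "\<lambda>t. f t / E t"] by auto
  define m where "m = f r / E r"
  have fm: "f s \<le> m * E s" if "s \<in> {0..1}" for s
    using max[OF that] E(2)[of s] by (simp add: m_def pos_divide_le_eq)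
  have "m \<le> 2 * a"
  proof (cases "m \<le> 0")
    case True then show ?thesis using a by simp
  next
    case False
    have "(\<integral>s. K s * f s \<partial>lebesgue_on {l r..u r}) \<le> (\<integral>s. m * (K s * E s) \<partial>lebesgue_on {l r..u r})"
    proof (rule integral_mono)
      show "integrable (lebesgue_on {l r..u r}) (\<lambda>s. K s * f s)"
        by (intro integrable_L01_sub[OF _ S[OF r]] integrable_mult_continuous Ki f)
      show "integrable (lebesgue_on {l r..u r}) (\<lambda>s. m * (K s * E s))"
        by (intro integrable_mult_right integrable_L01_sub[OF _ S[OF r]] integrable_mult_continuous Ki E)
      fix s assume "s \<in> space (lebesgue_on {l r..u r})"
      then have "s \<in> {0..1}" using S[OF r] by auto
      from mult_left_mono[OF fm[OF this] K0[of s]]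
      show "K s * f s \<le> m * (K s * E s)" by (simp add: algebra_simps)
    qed
    also have "\<dots> = m * (\<integral>s. K s * E s \<partial>lebesgue_on {l r..u r})" by simp
    also have "\<dots> \<le> m * (E r / 2)" using False by (intro mult_left_mono KE r) auto
    finally have "f r \<le> a * E r + m * E r / 2" using f_le[OF r] by simp
    moreover have "f r = m * E r" using E(2)[of r] by (simp add: m_def)
    ultimately have "m * E r \<le> (2 * a) * E r" by (simp add: algebra_simps)
    then show ?thesis using E(2)[of r] by simp
  qed
  then show ?thesis using fm[OF t] E(2)[of t] by (meson mult_right_mono order_trans less_imp_le)
qed

text \<open>The constant depends on the kernel only through the bound \<open>A\<close>, so it is
  uniform over bounded families of velocity fields.\<close>

lemma gronwall_forward:
  fixes K f :: "real \<Rightarrow> real"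
  assumes K: "integrable L01 (\<lambda>t. (K t)\<^sup>2)" "integrable L01 K" "\<And>t. 0 \<le> K t"
    and A: "0 < A" "(\<integral>t. (K t)\<^sup>2 \<partial>L01) \<le> A"
    and f: "continuous_on {0..1} f" and a: "0 \<le> a"
    and f_le: "\<And>t. t \<in> {0..1} \<Longrightarrow> f t \<le> a + (\<integral>s. K s * f s \<partial>lebesgue_on {0..t})"
    and t: "t \<in> {0..1}"
  shows "f t \<le> 2 * a * exp (2 * A)"
proof -
  have "f t \<le> 2 * a * exp (2 * A * t)"
  proof (rule gronwall_weighted[where l = "\<lambda>_. 0" and u = "\<lambda>t. t" and K = K and E = "\<lambda>t. exp (2 * A * t)"])
    show "(\<integral>s. K s * exp (2 * A * s) \<partial>lebesgue_on {0..t}) \<le> exp (2 * A * t) / 2" if "t \<in> {0..1}" for t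
      by (rule weighted_kernel_bound[OF K(1,2) A]) (use that in auto)
    show "f t \<le> a * exp (2 * A * t) + (\<integral>s. K s * f s \<partial>lebesgue_on {0..t})" if "t \<in> {0..1}" for t
    proof -
      have "a * 1 \<le> a * exp (2 * A * t)" using a A that by (intro mult_left_mono) auto
      then show ?thesis using f_le[OF that] by simp
    qed
  qed (use K f a t in \<open>auto intro!: continuous_intros\<close>)
  also have "\<dots> \<le> 2 * a * exp (2 * A)" using t a A by (intro mult_left_mono) auto
  finally show ?thesis .
qed

text \<open>The decreasing weight \<open>exp (- (2 * A) * t)\<close> turns time around. It serves
  for trajectories that meet at time 1, where there is no source term.\<close>

lemma gronwall_backward:
  fixes K f :: "real \<Rightarrow> real"
  assumes K: "integrable L01 (\<lambda>t. (K t)\<^sup>2)" "integrable L01 K" "\<And>t. 0 \<le> K t"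
    and f: "continuous_on {0..1} f"
    and f_le: "\<And>t. t \<in> {0..1} \<Longrightarrow> f t \<le> (\<integral>s. K s * f s \<partial>lebesgue_on {t..1})"
    and t: "t \<in> {0..1}"
  shows "f t \<le> 0"
proof -
  define A where "A = (\<integral>t. (K t)\<^sup>2 \<partial>L01) + 1"
  have "0 \<le> (\<integral>t. (K t)\<^sup>2 \<partial>L01)" by simp
  then have A: "0 < A" "(\<integral>t. (K t)\<^sup>2 \<partial>L01) \<le> A" unfolding A_def by linarith+
  have "f t \<le> 2 * 0 * exp (- (2 * A) * t)"
  proof (rule gronwall_weighted[where l = "\<lambda>t. t" and u = "\<lambda>_. 1" and K = K and E = "\<lambda>t. exp (- (2 * A) * t)"])
    show "(\<integral>s. K s * exp (- (2 * A) * s) \<partial>lebesgue_on {t..1}) \<le> exp (- (2 * A) * t) / 2" if "t \<in> {0..1}" for t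
      by (rule weighted_kernel_bound[OF K(1,2) A]) (use that in auto)
  qed (use K f f_le t in \<open>auto intro!: continuous_intros\<close>)
  then show ?thesis by simp
qed

text \<open>Closeness at the finitely many centres of a cover spreads to \<open>S\<close> because
  the limit inherits the modulus of continuity; three errors of e/4 add up to less than e. It is
  used once for the time variable and once for the space variable, weak convergence giving pointwise
  limits only.\<close>

lemma equicontinuous_uniform_limit:
  fixes F :: "nat \<Rightarrow> 'b::metric_space \<Rightarrow> 'c::metric_space"
  assumes S: "compact S"
    and equi: "\<And>e. 0 < e \<Longrightarrow> \<exists>d>0. \<forall>n. \<forall>x\<in>S. \<forall>y\<in>S. dist x y < d \<longrightarrow> dist (F n x) (F n y) \<le> e"
    and lim: "\<And>x. x \<in> S \<Longrightarrow> (\<lambda>n. F n x) \<longlonglongrightarrow> l x"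
  shows "uniform_limit S F l sequentially"
proof (rule uniform_limitI)
  fix e :: real assume "0 < e"
  then obtain d where d: "0 < d"
    and Fd: "\<And>n x y. x \<in> S \<Longrightarrow> y \<in> S \<Longrightarrow> dist x y < d \<Longrightarrow> dist (F n x) (F n y) \<le> e / 4"
    using equi[of "e / 4"] by auto
  have ld: "dist (l x) (l y) \<le> e / 4" if "x \<in> S" "y \<in> S" "dist x y < d" for x y
    by (rule LIMSEQ_le_const2[OF tendsto_dist[OF lim[OF that(1)] lim[OF that(2)]]]) (use Fd that in auto)
  have "S \<subseteq> (\<Union>c\<in>S. ball c d)" using d by auto
  then obtain k where k: "k \<subseteq> S" "finite k" "S \<subseteq> (\<Union>c\<in>k. ball c d)"
    by (rule compactE_image[OF S open_ball])
  have "\<forall>\<^sub>F n in sequentially. \<forall>c\<in>k. dist (F n c) (l c) < e / 4"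
  proof (intro eventually_ball_finite k(2) ballI)
    fix c assume "c \<in> k"
    then show "\<forall>\<^sub>F n in sequentially. dist (F n c) (l c) < e / 4"
      using k(1) \<open>0 < e\<close> by (intro tendstoD[OF lim]) auto
  qed
  then show "\<forall>\<^sub>F n in sequentially. \<forall>x\<in>S. dist (F n x) (l x) < e"
  proof (rule eventually_mono, intro ballI)
    fix n x assume *: "\<forall>c\<in>k. dist (F n c) (l c) < e / 4" and x: "x \<in> S"
    then obtain c where c: "c \<in> k" "dist c x < d" using k(3) by auto
    then have "c \<in> S" using k(1) by auto
    have "dist (F n x) (l x) \<le> dist (F n x) (F n c) + dist (F n c) (l c) + dist (l c) (l x)"
      using dist_triangle[of "F n x" "l x" "F n c"] dist_triangle[of "F n c" "l x" "l c"] by linarith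
    also have "\<dots> < e"
      using Fd[OF x \<open>c \<in> S\<close>, of n] ld[OF \<open>c \<in> S\<close> x] bspec[OF * c(1)] c(2) \<open>0 < e\<close>
      by (simp add: dist_commute)
    finally show "dist (F n x) (l x) < e" .
  qed
qed

section \<open>Flows of square integrable vector fields\<close>

lemma norm_le_of_inner_le:
  fixes k :: "'v::real_inner"
  assumes "\<And>w. k \<bullet> w \<le> B * norm w" "0 \<le> B"
  shows "norm k \<le> B"
proof (cases "k = 0")
  case False
  have "norm k * norm k \<le> B * norm k"
    using assms(1)[of k] by (simp add: power2_norm_eq_inner[symmetric] power2_eq_square)
  then show ?thesis using False by simp
qed (simp add: assms)

text \<open>Collects what the embedding of V into the space of differentiable fields yields for
  flows: bounds of order 0 and order 1 that are linear in \<open>norm w\<close>.\<close>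

locale vector_fields =
  fixes \<iota> :: "'v::{real_inner, banach} \<Rightarrow> 'a::euclidean_space \<Rightarrow> 'a" and c :: real
  assumes linear_eval: "linear (\<lambda>w. \<iota> w x)" and inj: "inj \<iota>" and c_pos: "0 < c"
    and norm_eval_le: "norm (\<iota> w x) \<le> c * norm w"
    and lipschitz: "norm (\<iota> w x - \<iota> w y) \<le> c * norm w * norm (x - y)"
begin

abbreviation flow1 :: "(real \<Rightarrow> 'v) \<Rightarrow> 'a \<Rightarrow> 'a" where "flow1 v \<equiv> flow (\<lambda>t. \<iota> (v t)) 1"

abbreviation displacement :: "(real \<Rightarrow> 'v) \<Rightarrow> (real \<Rightarrow> 'a) \<Rightarrow> real \<Rightarrow> real \<Rightarrow> 'a" where
  "displacement v y a b \<equiv> \<integral>s. \<iota> (v s) (y s) \<partial>lebesgue_on {a..b}"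

lemmas eval_add = linear_add[OF linear_eval] and eval_scale = linear_scale[OF linear_eval]
  and eval_diff = linear_diff[OF linear_eval]

text \<open>V is a reproducing kernel Hilbert space of vector fields, and \<open>rep y b\<close> is
  its matrix-valued kernel at \<open>y\<close> applied to \<open>b\<close>.\<close>

definition rep :: "'a \<Rightarrow> 'a \<Rightarrow> 'v" where "rep y b = (SOME k. \<forall>w. k \<bullet> w = \<iota> w y \<bullet> b)"

lemma rep_inner: "rep y b \<bullet> w = \<iota> w y \<bullet> b"
proof -
  interpret V: semi_hilbert "UNIV :: 'v set" "(+)" "(*\<^sub>R)" "(\<bullet>)" by (rule semi_hilbert_UNIV)
  have "\<exists>k\<in>UNIV. \<forall>w\<in>UNIV. k \<bullet> w = \<iota> w y \<bullet> b"
  proof (rule V.riesz[where B = "c * norm b"])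
    fix w :: 'v
    have "\<bar>\<iota> w y \<bullet> b\<bar> \<le> norm (\<iota> w y) * norm b" by (rule Cauchy_Schwarz_ineq2)
    also have "\<dots> \<le> c * norm w * norm b" by (intro mult_right_mono norm_eval_le) simp
    finally show "\<bar>\<iota> w y \<bullet> b\<bar> \<le> c * norm b * V.nrm w"
      by (simp add: V.nrm_def norm_eq_sqrt_inner[symmetric] mult_ac)
  qed (simp_all add: eval_add eval_scale inner_add_left)
  then have "\<exists>k. \<forall>w. k \<bullet> w = \<iota> w y \<bullet> b" by simp
  from someI_ex[OF this] show ?thesis by (simp add: rep_def)
qed

lemma rep_norm_le: "norm (rep y b) \<le> c * norm b"
proof (rule norm_le_of_inner_le)
  fix w
  have "\<iota> w y \<bullet> b \<le> norm (\<iota> w y) * norm b" by (rule norm_cauchy_schwarz)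
  also have "\<dots> \<le> c * norm w * norm b" by (intro mult_right_mono norm_eval_le) simp
  finally show "rep y b \<bullet> w \<le> c * norm b * norm w" by (simp add: rep_inner mult_ac)
qed (use c_pos in simp)

lemma rep_lipschitz: "norm (rep y b - rep z b) \<le> c * norm b * norm (y - z)"
proof (rule norm_le_of_inner_le)
  fix w
  have "(\<iota> w y - \<iota> w z) \<bullet> b \<le> norm (\<iota> w y - \<iota> w z) * norm b" by (rule norm_cauchy_schwarz)
  also have "\<dots> \<le> c * norm w * norm (y - z) * norm b" by (intro mult_right_mono lipschitz) simp
  finally show "(rep y b - rep z b) \<bullet> w \<le> c * norm b * norm (y - z) * norm w"
    by (simp add: inner_diff_left rep_inner mult_ac)
qed (use c_pos in simp)

lemma continuous_on_rep: "continuous_on UNIV (\<lambda>y. rep y b)"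
proof (rule lipschitz_on_continuous_on)
  show "(c * norm b)-lipschitz_on UNIV (\<lambda>y. rep y b)"
    by (rule lipschitz_onI) (use rep_lipschitz c_pos in \<open>auto simp: dist_norm\<close>)
qed

lemma continuous_on_eval: "continuous_on UNIV (\<iota> w)"
proof (rule lipschitz_on_continuous_on)
  show "(c * norm w)-lipschitz_on UNIV (\<iota> w)"
    by (rule lipschitz_onI) (use lipschitz c_pos in \<open>auto simp: dist_norm\<close>)
qed

text \<open>The representers of the evaluations at the points of a countable dense set span a dense
  subspace, because a vector orthogonal to all of them is a vector field that vanishes.\<close>

lemma separable: "\<exists>D :: 'v set. countable D \<and> closure D = UNIV"
proof -
  obtain Q :: "'a set" where Q: "countable Q" "\<And>X. open X \<Longrightarrow> X \<noteq> {} \<Longrightarrow> \<exists>q\<in>Q. q \<in> X"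
    using countable_dense_setE by blast
  have cl_Q: "closure Q = UNIV"
  proof (rule ccontr)
    assume "closure Q \<noteq> UNIV"
    then have "\<exists>q\<in>Q. q \<in> - closure Q" by (intro Q(2)) auto
    then show False using closure_subset by auto
  qed
  define E where "E = (\<lambda>(q, b). rep q b) ` (Q \<times> (Basis :: 'a set))"
  \<comment> \<open>Rational combinations are indexed by lists, so their countability is that of
    finite lists over a countable set; concatenation of lists gives sums.\<close>
  define S where "S l = (\<Sum>(r, e)\<leftarrow>l. real_of_rat r *\<^sub>R e)" for l :: "(rat \<times> 'v) list"
  define D where "D = S ` lists (UNIV \<times> E)"
  have cD: "countable D"
    unfolding D_def E_def using Q(1) by (intro countable_image countable_lists countable_SIGMA) (auto simp: countable_finite)
  have D_add: "x + y \<in> D" if xy: "x \<in> D" "y \<in> D" for x y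
  proof -
    obtain l l' where l: "l \<in> lists (UNIV \<times> E)" "x = S l" "l' \<in> lists (UNIV \<times> E)" "y = S l'"
      using xy unfolding D_def by blast
    then have "x + y = S (l @ l')" by (simp add: S_def)
    then show ?thesis using l unfolding D_def by auto
  qed
  have D_scale: "real_of_rat r *\<^sub>R x \<in> D" if x: "x \<in> D" for r x
  proof -
    obtain l where l: "l \<in> lists (UNIV \<times> E)" "x = S l" using x unfolding D_def by blast
    have "real_of_rat r *\<^sub>R S l = S (map (\<lambda>(s, e). (r * s, e)) l)"
      by (induction l) (auto simp: S_def of_rat_mult scaleR_add_right)
    moreover have "map (\<lambda>(s, e). (r * s, e)) l \<in> lists (UNIV \<times> E)" using l(1) by (auto simp: in_lists_conv_set)
    ultimately show ?thesis using l(2) unfolding D_def by auto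
  qed
  have E_D: "e \<in> D" if "e \<in> E" for e
  proof -
    have "e = S [(1, e)]" by (simp add: S_def)
    then show ?thesis using that unfolding D_def by (metis (no_types, lifting) SigmaI UNIV_I image_eqI lists.Cons lists.Nil)
  qed
  have D_nonempty: "0 \<in> D"
    unfolding D_def by (rule image_eqI[of _ _ "[]"]) (simp_all add: S_def)
  define K where "K = closure D"
  have K_add: "x + y \<in> K" if xy: "x \<in> K" "y \<in> K" for x y
  proof -
    obtain X Y where "\<forall>n. X n \<in> D" "X \<longlonglongrightarrow> x" "\<forall>n. Y n \<in> D" "Y \<longlonglongrightarrow> y"
      using xy unfolding K_def closure_sequential by blast
    then have "\<forall>n. X n + Y n \<in> D" "(\<lambda>n. X n + Y n) \<longlonglongrightarrow> x + y" using D_add by (auto intro: tendsto_add)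
    then show ?thesis unfolding K_def closure_sequential by (intro exI[of _ "\<lambda>n. X n + Y n"]) simp
  qed
  have K_scale: "a *\<^sub>R x \<in> K" if x: "x \<in> K" for a x
  proof -
    obtain X where X: "\<forall>n. X n \<in> D" "X \<longlonglongrightarrow> x" using x unfolding K_def closure_sequential by blast
    have "\<exists>r. a < real_of_rat r \<and> real_of_rat r < a + inverse (real (Suc n))" for n
      by (rule of_rat_dense) simp
    then obtain r where r: "\<And>n. a < real_of_rat (r n)" "\<And>n. real_of_rat (r n) < a + inverse (real (Suc n))" by metis
    have "(\<lambda>n. real_of_rat (r n)) \<longlonglongrightarrow> a"
    proof (rule tendsto_sandwich[OF _ _ tendsto_const])
      show "(\<lambda>n. a + inverse (real (Suc n))) \<longlonglongrightarrow> a" by (rule LIMSEQ_inverse_real_of_nat_add)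
    qed (use r in \<open>auto intro!: always_eventually less_imp_le\<close>)
    then have "(\<lambda>n. real_of_rat (r n) *\<^sub>R X n) \<longlonglongrightarrow> a *\<^sub>R x" using X(2) by (intro tendsto_intros)
    moreover have "\<forall>n. real_of_rat (r n) *\<^sub>R X n \<in> D" using D_scale X(1) by blast
    ultimately show ?thesis
      unfolding K_def closure_sequential by (intro exI[of _ "\<lambda>n. real_of_rat (r n) *\<^sub>R X n"]) simp
  qed
  interpret V: semi_hilbert "UNIV :: 'v set" "(+)" "(*\<^sub>R)" "(\<bullet>)" by (rule semi_hilbert_UNIV)
  have dst: "V.dst x y = norm (x - y)" for x y
    by (simp add: V.dst_def V.nrm_def V.sub_def norm_eq_sqrt_inner)
  have K_closed: "y \<in> K" if Y: "\<And>n::nat. Y n \<in> K" and lim: "(\<lambda>n. V.dst (Y n) y) \<longlonglongrightarrow> 0" for Y y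
  proof -
    have "Y \<longlonglongrightarrow> y" using lim unfolding dst by (rule LIM_zero_cancel[OF tendsto_norm_zero_cancel])
    then show ?thesis using closed_sequentially[of K Y y] Y by (simp add: K_def)
  qed
  have "u \<in> K" for u
  proof -
    have "\<exists>p\<in>K. \<forall>w\<in>K. p \<bullet> w = u \<bullet> w"
    proof (rule V.projection)
      show "K \<noteq> {}" using D_nonempty closure_subset unfolding K_def by blast
      show "y \<in> K" if "\<And>n::nat. Y n \<in> K" "y \<in> UNIV" "(\<lambda>n. V.dst (Y n) y) \<longlonglongrightarrow> 0" for Y y
        by (rule K_closed[OF that(1,3)])
    qed (simp_all add: K_add K_scale)
    then obtain p where p: "p \<in> K" and pw: "\<And>w. w \<in> K \<Longrightarrow> p \<bullet> w = u \<bullet> w" by blast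
    have "\<iota> u q = \<iota> p q" if "q \<in> Q" for q
    proof (rule euclidean_eqI)
      fix b :: 'a assume "b \<in> Basis"
      then have "rep q b \<in> K"
        using E_D[of "rep q b"] that closure_subset[of D] by (auto simp: E_def K_def)
      from pw[OF this] show "\<iota> u q \<bullet> b = \<iota> p q \<bullet> b" by (simp add: inner_commute[of _ "rep q b"] rep_inner)
    qed
    then have "Q \<subseteq> {q. \<iota> u q = \<iota> p q}" by blast
    moreover have "closed {q. \<iota> u q = \<iota> p q}" by (intro closed_Collect_eq continuous_on_eval)
    ultimately have "closure Q \<subseteq> {q. \<iota> u q = \<iota> p q}" by (rule closure_minimal)
    then have "\<iota> u = \<iota> p" using cl_Q by auto
    then show ?thesis using inj p by (metis injD)
  qed
  then show ?thesis using cD unfolding K_def by blast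
qed

definition dense_set :: "'v set" where "dense_set = (SOME D. countable D \<and> closure D = UNIV)"

sublocale separable_hilbert dense_set
  by standard (use someI_ex[OF separable] in \<open>simp_all add: dense_set_def\<close>)

lemma integrable_norm_L2V:
  assumes "v \<in> L2V"
  shows "integrable L01 (\<lambda>t. norm (v t :: 'v))"
proof (rule Bochner_Integration.integrable_bound)
  show "integrable L01 (\<lambda>t. 1 + (norm (v t))\<^sup>2)" using assms by (simp add: L2V_def)
  have "v \<in> borel_measurable L01" using assms by (simp add: L2V_def)
  then show "(\<lambda>t. norm (v t)) \<in> borel_measurable L01" by measurable
  have "x \<le> 1 + x\<^sup>2" for x :: real
  proof -
    have "0 \<le> (x - 1/2)\<^sup>2" by simp
    then show ?thesis by (simp add: power2_eq_square algebra_simps)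
  qed
  then show "AE t in L01. norm (norm (v t)) \<le> norm (1 + (norm (v t))\<^sup>2)" by (intro AE_I2) simp
qed

lemma kernel_facts:
  assumes "v \<in> L2V"
  shows "integrable L01 (\<lambda>t. (c * norm (v t :: 'v))\<^sup>2)" "integrable L01 (\<lambda>t. c * norm (v t))"
    "\<And>t. 0 \<le> c * norm (v t)"
  using assms integrable_norm_L2V[OF assms] c_pos by (auto simp: L2V_def power_mult_distrib)

text \<open>The issue is measurability of a moving field evaluated on a moving point: its
  coordinates are the pairings \<open>rep (y s) b \<bullet> v s\<close> of two measurable curves in
  V.\<close>

lemma integrable_along:
  assumes v: "v \<in> L2V" and y: "continuous_on {0..1} y"
  shows "integrable L01 (\<lambda>s. \<iota> (v s) (y s))"
proof (rule Bochner_Integration.integrable_bound[OF kernel_facts(2)[OF v]])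
  have ym: "y \<in> borel_measurable L01"
    by (rule continuous_imp_measurable_on_sets_lebesgue[OF y]) simp
  have "(\<lambda>s. \<iota> (v s) (y s) \<bullet> b) \<in> borel_measurable L01" for b
  proof -
    have "(\<lambda>s. rep (y s) b) \<in> borel_measurable L01"
      using measurable_compose[OF ym borel_measurable_continuous_onI[OF continuous_on_rep]] .
    moreover have "v \<in> borel_measurable L01" using v by (simp add: L2V_def)
    ultimately have "(\<lambda>s. rep (y s) b \<bullet> v s) \<in> borel_measurable L01" by (rule measurable_inner)
    then show ?thesis by (simp add: rep_inner)
  qed
  then show "(\<lambda>s. \<iota> (v s) (y s)) \<in> borel_measurable L01"
    by (subst borel_measurable_euclidean_space) auto
  show "AE s in L01. norm (\<iota> (v s) (y s)) \<le> norm (c * norm (v s))"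
    using norm_eval_le c_pos by (intro AE_I2) simp
qed

text \<open>Puts the difference of two displacements under the same field into the form to which the
  Gronwall estimates apply, with kernel \<open>c * norm (v s)\<close>.\<close>

lemma norm_integral_diff_le:
  assumes v: "v \<in> L2V" and y: "continuous_on {0..1} y" and z: "continuous_on {0..1} z"
    and ab: "{a..b} \<subseteq> {0..1}"
  shows "norm (displacement v y a b - displacement v z a b)
    \<le> (\<integral>s. c * norm (v s) * norm (y s - z s) \<partial>lebesgue_on {a..b})"
proof -
  note i = integrable_L01_sub[OF integrable_along[OF v] ab]
  have "displacement v y a b - displacement v z a b
      = (\<integral>s. \<iota> (v s) (y s) - \<iota> (v s) (z s) \<partial>lebesgue_on {a..b})"
    using i[OF y] i[OF z] by simp
  also have "norm \<dots> \<le> (\<integral>s. norm (\<iota> (v s) (y s) - \<iota> (v s) (z s)) \<partial>lebesgue_on {a..b})"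
    by (rule integral_norm_bound)
  also have "\<dots> \<le> (\<integral>s. c * norm (v s) * norm (y s - z s) \<partial>lebesgue_on {a..b})"
  proof (rule integral_mono)
    show "integrable (lebesgue_on {a..b}) (\<lambda>s. norm (\<iota> (v s) (y s) - \<iota> (v s) (z s)))"
      using i[OF y] i[OF z] by simp
    show "integrable (lebesgue_on {a..b}) (\<lambda>s. c * norm (v s) * norm (y s - z s))"
      by (intro integrable_L01_sub[OF _ ab] integrable_mult_continuous kernel_facts(2)[OF v] continuous_intros y z)
  qed (rule lipschitz)
  finally show ?thesis .
qed

section \<open>Single trajectories: stability, injectivity in the starting point, existence\<close>

definition is_path :: "(real \<Rightarrow> 'v) \<Rightarrow> 'a \<Rightarrow> (real \<Rightarrow> 'a) \<Rightarrow> bool" where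
  "is_path v x y \<longleftrightarrow> (\<forall>t\<in>{0..1}. integrable (lebesgue_on {0..t}) (\<lambda>s. \<iota> (v s) (y s)) \<and>
      y t = x + displacement v y 0 t)"

lemma is_flow_iff: "is_flow (\<lambda>t. \<iota> (v t)) \<phi> \<longleftrightarrow> (\<forall>x. is_path v x (\<lambda>t. \<phi> t x))"
  by (simp add: is_flow_def is_path_def)

lemma is_path_continuous:
  assumes "is_path v x y"
  shows "continuous_on {0..1} y"
proof -
  have "integrable L01 (\<lambda>s. \<iota> (v s) (y s))" using assms unfolding is_path_def by force
  from continuous_on_lebesgue_integral[OF this]
  have "continuous_on {0..1} (\<lambda>t. x + displacement v y 0 t)"
    by (intro continuous_intros)
  then show ?thesis by (rule continuous_on_eq) (use assms in \<open>simp add: is_path_def\<close>)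
qed

lemma is_path_eq:
  assumes "is_path v x y" "t \<in> {0..1}"
  shows "y t = x + displacement v y 0 t"
  using assms by (simp add: is_path_def)

lemma is_path_0: "is_path v x y \<Longrightarrow> y 0 = x"
  using is_path_eq[of v x y 0] by (simp add: integral_eq_zero_null_sets)

text \<open>Equal starting points give uniqueness, different ones a Lipschitz bound for the flow
  map; the explicit \<open>A\<close> allows one constant for a whole sequence of fields.\<close>

lemma path_stability:
  assumes v: "v \<in> L2V" and y: "is_path v x y" and z: "is_path v x' z"
    and A: "0 < A" "(\<integral>t. (c * norm (v t))\<^sup>2 \<partial>L01) \<le> A" and t: "t \<in> {0..1}"
  shows "norm (y t - z t) \<le> 2 * norm (x - x') * exp (2 * A)"
proof (rule gronwall_forward[OF kernel_facts[OF v] A _ _ _ t])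
  show "continuous_on {0..1} (\<lambda>t. norm (y t - z t))"
    by (intro continuous_intros is_path_continuous[OF y] is_path_continuous[OF z])
  fix t :: real assume t: "t \<in> {0..1}"
  then have sub: "{0..t} \<subseteq> {0..1}" by auto
  have "y t - z t = (x - x') + (displacement v y 0 t - displacement v z 0 t)"
    using is_path_eq[OF y t] is_path_eq[OF z t] by simp
  then show "norm (y t - z t) \<le> norm (x - x') + (\<integral>s. c * norm (v s) * norm (y s - z s) \<partial>lebesgue_on {0..t})"
    using norm_triangle_ineq[of "x - x'"
        "displacement v y 0 t - displacement v z 0 t"]
      norm_integral_diff_le[OF v is_path_continuous[OF y] is_path_continuous[OF z] sub] by simp
qed simp

text \<open>Since the endpoints agree, the gap at time \<open>t\<close> is the integral of the
  velocity difference over \<open>{t..1}\<close>, and the estimate run backwards from time 1 makes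
  it vanish.\<close>

lemma path_injective:
  assumes v: "v \<in> L2V" and y: "is_path v x y" and z: "is_path v x' z" and eq: "y 1 = z 1"
  shows "x = x'"
proof -
  note cy = is_path_continuous[OF y] and cz = is_path_continuous[OF z]
  have tail: "w 1 - w t = displacement v w t 1"
    if w: "is_path v x'' w" and t: "t \<in> {0..1}" for w x'' t
    using integral_L01_combine[OF integrable_along[OF v is_path_continuous[OF w]], of t 1] t
      is_path_eq[OF w t] is_path_eq[OF w, of 1] by simp
  have "norm (y 0 - z 0) \<le> 0"
  proof (rule gronwall_backward[OF kernel_facts[OF v], where f = "\<lambda>t. norm (y t - z t)"])
    show "continuous_on {0..1} (\<lambda>t. norm (y t - z t))" by (intro continuous_intros cy cz)
    fix t :: real assume t: "t \<in> {0..1}"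
    then have sub: "{t..1} \<subseteq> {0..1}" by auto
    have "norm (y t - z t) = norm (displacement v y t 1 - displacement v z t 1)"
      unfolding tail[OF y t, symmetric] tail[OF z t, symmetric] using eq by (simp add: norm_minus_commute)
    also have "\<dots> \<le> (\<integral>s. c * norm (v s) * norm (y s - z s) \<partial>lebesgue_on {t..1})"
      by (rule norm_integral_diff_le[OF v cy cz sub])
    finally show "norm (y t - z t) \<le> (\<integral>s. c * norm (v s) * norm (y s - z s) \<partial>lebesgue_on {t..1})" .
  qed simp
  then show ?thesis using is_path_0[OF y] is_path_0[OF z] by simp
qed

text \<open>Picard iteration. The weighted estimate halves the increment at every step over the
  whole interval [0,1], so no gluing of short-time solutions is needed.\<close>

lemma path_exists:
  assumes v: "v \<in> L2V"
  shows "\<exists>y. is_path v x y"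
proof -
  define A where "A = (\<integral>t. (c * norm (v t))\<^sup>2 \<partial>L01) + 1"
  have "0 \<le> (\<integral>t. (c * norm (v t))\<^sup>2 \<partial>L01)" by simp
  then have A: "0 < A" "(\<integral>t. (c * norm (v t))\<^sup>2 \<partial>L01) \<le> A" unfolding A_def by linarith+
  define T where "T y t = x + displacement v y 0 t" for y t
  define Y where "Y n = (T ^^ n) (\<lambda>_. x)" for n
  have Y_Suc: "Y (Suc n) = T (Y n)" for n by (simp add: Y_def)
  have cT: "continuous_on {0..1} (T y)" if "continuous_on {0..1} y" for y
    unfolding T_def by (intro continuous_intros continuous_on_lebesgue_integral integrable_along v that)
  have cY: "continuous_on {0..1} (Y n)" for n
  proof (induction n)
    case 0 show ?case by (simp add: Y_def)
  next
    case (Suc n) then show ?case unfolding Y_Suc by (rule cT)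
  qed
  have "bounded ((\<lambda>t. Y 1 t - Y 0 t) ` {0..1})"
    by (intro compact_imp_bounded compact_continuous_image continuous_intros cY) simp
  then obtain B where B: "\<forall>t\<in>{0..1}. norm (Y 1 t - Y 0 t) \<le> B" by (auto simp: bounded_iff)
  have B0: "0 \<le> B" using order_trans[OF norm_ge_zero bspec[OF B, of 0]] by simp
  \<comment> \<open>The time-dependent weight must stay in the induction hypothesis: it is what
    \<open>weighted_kernel_bound\<close> reproduces with the factor 1/2.\<close>
  have diff: "norm (Y (Suc n) t - Y n t) \<le> B * (1/2) ^ n * exp (2 * A * t)" if "t \<in> {0..1}" for n t
    using that
  proof (induction n arbitrary: t)
    case 0
    have "B * 1 \<le> B * exp (2 * A * t)" using B0 A 0 by (intro mult_left_mono) auto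
    then show ?case using bspec[OF B 0] by simp
  next
    case (Suc n)
    then have sub: "{0..t} \<subseteq> {0..1}" by auto
    have "norm (Y (Suc (Suc n)) t - Y (Suc n) t)
        \<le> (\<integral>s. c * norm (v s) * norm (Y (Suc n) s - Y n s) \<partial>lebesgue_on {0..t})"
      using norm_integral_diff_le[OF v cY cY sub, of "Suc n" n]
      unfolding Y_Suc[of "Suc n"] T_def Y_Suc[of n, symmetric] by (simp add: Y_Suc[of n] T_def)
    also have "\<dots> \<le> (\<integral>s. B * (1/2) ^ n * (c * norm (v s) * exp (2 * A * s)) \<partial>lebesgue_on {0..t})"
    proof (rule integral_mono)
      show "integrable (lebesgue_on {0..t}) (\<lambda>s. c * norm (v s) * norm (Y (Suc n) s - Y n s))"
        by (intro integrable_L01_sub[OF _ sub] integrable_mult_continuous kernel_facts(2)[OF v] continuous_intros cY)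
      show "integrable (lebesgue_on {0..t}) (\<lambda>s. B * (1/2) ^ n * (c * norm (v s) * exp (2 * A * s)))"
        by (intro integrable_mult_right integrable_L01_sub[OF _ sub] integrable_mult_continuous
            kernel_facts(2)[OF v] continuous_intros)
      fix s assume "s \<in> space (lebesgue_on {0..t})"
      then have "s \<in> {0..1}" using sub by auto
      from mult_left_mono[OF Suc.IH[OF this] kernel_facts(3)[OF v, of s]]
      show "c * norm (v s) * norm (Y (Suc n) s - Y n s) \<le> B * (1/2) ^ n * (c * norm (v s) * exp (2 * A * s))"
        by (simp add: mult_ac)
    qed
    also have "\<dots> = B * (1/2) ^ n * (\<integral>s. c * norm (v s) * exp (2 * A * s) \<partial>lebesgue_on {0..t})" by simp
    also have "\<dots> \<le> B * (1/2) ^ n * (exp (2 * A * t) / 2)"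
      using B0 Suc.prems
      by (intro mult_left_mono weighted_kernel_bound[OF kernel_facts(1,2)[OF v] A sub]) auto
    finally show ?case by simp
  qed
  \<comment> \<open>The limit is a telescoping series of increments starting from
    \<open>Y 0 t = x\<close>, so that the Weierstrass test gives uniform convergence.\<close>
  define y where "y t = x + (\<Sum>n. Y (Suc n) t - Y n t)" for t
  have "uniform_limit {0..1} (\<lambda>n t. \<Sum>i<n. Y (Suc i) t - Y i t) (\<lambda>t. \<Sum>n. Y (Suc n) t - Y n t) sequentially"
  proof (rule Weierstrass_m_test)
    show "norm (Y (Suc n) t - Y n t) \<le> B * exp (2 * A) * (1/2) ^ n" if "t \<in> {0..1}" for n t
    proof -
      have "B * (1/2) ^ n * exp (2 * A * t) \<le> B * (1/2) ^ n * exp (2 * A)"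
        using that A B0 by (intro mult_left_mono) auto
      then show ?thesis using diff[OF that, of n] by (simp add: mult_ac)
    qed
    show "summable (\<lambda>n. B * exp (2 * A) * (1/2) ^ n)" by (intro summable_mult summable_geometric) simp
  qed
  then have "uniform_limit {0..1} (\<lambda>n t. x + (\<Sum>i<n. Y (Suc i) t - Y i t)) y sequentially"
    unfolding y_def by (intro uniform_limit_intros)
  moreover have "x + (\<Sum>i<n. Y (Suc i) t - Y i t) = Y n t" for n t
    by (simp add: sum_lessThan_telescope[of "\<lambda>i. Y i t"]) (simp add: Y_def)
  ultimately have ul: "uniform_limit {0..1} Y y sequentially" by simp
  have cy: "continuous_on {0..1} y"
    by (rule uniform_limit_theorem[OF _ ul]) (simp_all add: cY)
  have lim: "(\<lambda>n. Y n t) \<longlonglongrightarrow> y t" if "t \<in> {0..1}" for t by (rule tendsto_uniform_limitI[OF ul that])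
  have "y t = T y t" if t: "t \<in> {0..1}" for t
  proof -
    have sub: "{0..t} \<subseteq> {0..1}" using t by auto
    \<comment> \<open>Pointwise convergence of the iterates is enough here, as
      \<open>c * norm (v s)\<close> dominates the velocities whatever the curve.\<close>
    have "(\<lambda>n. displacement v (Y n) 0 t) \<longlonglongrightarrow> displacement v y 0 t"
    proof (rule integral_dominated_convergence[where w = "\<lambda>s. c * norm (v s)"])
      show "(\<lambda>s. \<iota> (v s) (y s)) \<in> borel_measurable (lebesgue_on {0..t})"
        by (rule borel_measurable_integrable[OF integrable_L01_sub[OF integrable_along[OF v cy] sub]])
      show "(\<lambda>s. \<iota> (v s) (Y n s)) \<in> borel_measurable (lebesgue_on {0..t})" for n
        by (rule borel_measurable_integrable[OF integrable_L01_sub[OF integrable_along[OF v cY] sub]])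
      show "integrable (lebesgue_on {0..t}) (\<lambda>s. c * norm (v s))"
        by (rule integrable_L01_sub[OF kernel_facts(2)[OF v] sub])
      show "AE s in lebesgue_on {0..t}. (\<lambda>n. \<iota> (v s) (Y n s)) \<longlonglongrightarrow> \<iota> (v s) (y s)"
      proof (rule AE_I2)
        fix s assume "s \<in> space (lebesgue_on {0..t})"
        then have "s \<in> {0..1}" using sub by auto
        from continuous_on_tendsto_compose[OF continuous_on_eval lim[OF this]]
        show "(\<lambda>n. \<iota> (v s) (Y n s)) \<longlonglongrightarrow> \<iota> (v s) (y s)" by simp
      qed
      show "AE s in lebesgue_on {0..t}. norm (\<iota> (v s) (Y n s)) \<le> c * norm (v s)" for n
        by (intro AE_I2 norm_eval_le)
    qed
    then have "(\<lambda>n. Y (Suc n) t) \<longlonglongrightarrow> T y t" unfolding Y_Suc T_def by (intro tendsto_intros)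
    moreover have "(\<lambda>n. Y (Suc n) t) \<longlonglongrightarrow> y t" by (rule LIMSEQ_Suc[OF lim[OF t]])
    ultimately show ?thesis by (rule LIMSEQ_unique[symmetric])
  qed
  then have "is_path v x y"
    unfolding is_path_def T_def[symmetric]
    using integrable_L01_sub[OF integrable_along[OF v cy]] by auto
  then show ?thesis by blast
qed

text \<open>The definite description in \<open>flow\<close> needs a unique extensional solution.
  Restriction to [0,1] changes none of the integrals involved, and uniqueness holds for each
  starting point separately.\<close>

lemma flow_is_flow:
  assumes v: "v \<in> L2V"
  shows "is_flow (\<lambda>t. \<iota> (v t)) (flow (\<lambda>t. \<iota> (v t)))"
proof -
  let ?P = "\<lambda>\<phi>. \<phi> \<in> extensional {0..1} \<and> is_flow (\<lambda>t. \<iota> (v t)) \<phi>"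
  have "\<exists>\<phi>. ?P \<phi>"
  proof -
    define Y where "Y x = (SOME y. is_path v x y)" for x
    have Y: "is_path v x (Y x)" for x unfolding Y_def by (rule someI_ex[OF path_exists[OF v]])
    define \<phi> where "\<phi> = restrict (\<lambda>t x. Y x t) {0..1}"
    have eq: "\<phi> t x = Y x t" if "t \<in> {0..1}" for t x using that by (simp add: \<phi>_def)
    have "is_path v x (\<lambda>t. \<phi> t x)" for x
      unfolding is_path_def
    proof
      fix t :: real assume t: "t \<in> {0..1}"
      have e: "\<iota> (v s) (\<phi> s x) = \<iota> (v s) (Y x s)" if "s \<in> space (lebesgue_on {0..t})" for s
        using that t by (simp add: eq)
      have "integrable (lebesgue_on {0..t}) (\<lambda>s. \<iota> (v s) (\<phi> s x)) = integrable (lebesgue_on {0..t}) (\<lambda>s. \<iota> (v s) (Y x s))"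
        by (rule Bochner_Integration.integrable_cong[OF refl e])
      moreover have "(\<integral>s. \<iota> (v s) (\<phi> s x) \<partial>lebesgue_on {0..t}) = (\<integral>s. \<iota> (v s) (Y x s) \<partial>lebesgue_on {0..t})"
        by (rule Bochner_Integration.integral_cong[OF refl e])
      ultimately show "integrable (lebesgue_on {0..t}) (\<lambda>s. \<iota> (v s) (\<phi> s x)) \<and>
          \<phi> t x = x + (\<integral>s. \<iota> (v s) (\<phi> s x) \<partial>lebesgue_on {0..t})"
        using Y[of x] t by (simp only: is_path_def eq)
    qed
    then have "is_flow (\<lambda>t. \<iota> (v t)) \<phi>" by (simp add: is_flow_iff)
    then show ?thesis by (intro exI[of _ \<phi>]) (simp add: \<phi>_def)
  qed
  moreover have "\<phi> = \<psi>" if \<phi>: "?P \<phi>" and \<psi>: "?P \<psi>" for \<phi> \<psi>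
  proof (rule extensionalityI[of _ "{0..1}"])
    fix t :: real assume t: "t \<in> {0..1}"
    show "\<phi> t = \<psi> t"
    proof
      fix x
      have p: "is_path v x (\<lambda>t. \<phi> t x)" "is_path v x (\<lambda>t. \<psi> t x)" using \<phi> \<psi> by (simp_all add: is_flow_iff)
      define A where "A = (\<integral>t. (c * norm (v t))\<^sup>2 \<partial>L01) + 1"
      have "0 \<le> (\<integral>t. (c * norm (v t))\<^sup>2 \<partial>L01)" by simp
      then have A: "0 < A" "(\<integral>t. (c * norm (v t))\<^sup>2 \<partial>L01) \<le> A" unfolding A_def by linarith+
      show "\<phi> t x = \<psi> t x" using path_stability[OF v p A t] by simp
    qed
  qed (use \<phi> \<psi> in auto)
  ultimately have "\<exists>!\<phi>. ?P \<phi>" by blast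
  from theI'[OF this] show ?thesis by (simp add: flow_def)
qed

lemma flow_path: "v \<in> L2V \<Longrightarrow> is_path v x (\<lambda>t. flow (\<lambda>t. \<iota> (v t)) t x)"
  using flow_is_flow by (simp add: is_flow_iff)

end

section \<open>Weakly convergent velocity fields and convergence of their flows\<close>

context vector_fields
begin

text \<open>Each pairing converges, hence is bounded, and the uniform boundedness principle applies.
  One \<open>A\<close> covers the sequence and the limit; the summand 1 in it only ensures
  positivity.\<close>

lemma weakly_convergent_bounded:
  fixes vs :: "nat \<Rightarrow> real \<Rightarrow> 'v"
  assumes vs: "\<And>n. vs n \<in> L2V" and v: "v \<in> L2V" and weak: "L2V_weakly_converges vs v"
  shows "\<exists>A>0. (\<forall>n. (\<integral>t. (c * norm (vs n t))\<^sup>2 \<partial>L01) \<le> A) \<and> (\<integral>t. (c * norm (v t))\<^sup>2 \<partial>L01) \<le> A"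
proof -
  interpret L2: semi_hilbert "L2V :: (real \<Rightarrow> 'v) set" "\<lambda>u v t. u t + v t" "\<lambda>a u t. a *\<^sub>R u t" L2V_inner
    by (rule semi_hilbert_L2V)
  have bdd: "\<exists>B. \<forall>n. \<bar>L2V_inner (vs n) u\<bar> \<le> B" if "u \<in> L2V" for u
  proof -
    have "(\<lambda>n. L2V_inner (vs n) u) \<longlonglongrightarrow> L2V_inner v u"
      using weak that by (simp add: L2V_weakly_converges_def)
    then have "Bseq (\<lambda>n. L2V_inner (vs n) u)" by (rule convergent_imp_Bseq[OF convergentI])
    then show ?thesis by (auto simp: Bseq_def)
  qed
  obtain B where B: "\<forall>n. L2.nrm (vs n) \<le> B"
    using L2.uniform_boundedness[OF vs bdd] by blast
  have sq: "(\<integral>t. (c * norm (u t))\<^sup>2 \<partial>L01) = c\<^sup>2 * (L2.nrm u)\<^sup>2" if "u \<in> L2V" for u :: "real \<Rightarrow> 'v"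
    using L2.nrm_square[OF that] by (simp add: L2V_inner_def power_mult_distrib power2_norm_eq_inner)
  define A where "A = c\<^sup>2 * B\<^sup>2 + c\<^sup>2 * (L2.nrm v)\<^sup>2 + 1"
  have nn: "0 \<le> c\<^sup>2 * B\<^sup>2" "0 \<le> c\<^sup>2 * (L2.nrm v)\<^sup>2" by simp_all
  have "(\<integral>t. (c * norm (vs n t))\<^sup>2 \<partial>L01) \<le> A" for n
  proof -
    have "(L2.nrm (vs n))\<^sup>2 \<le> B\<^sup>2" using B L2.nrm_nonneg[OF vs] by (intro power_mono) auto
    then have "c\<^sup>2 * (L2.nrm (vs n))\<^sup>2 \<le> c\<^sup>2 * B\<^sup>2" by (intro mult_left_mono) auto
    then show ?thesis unfolding sq[OF vs] A_def using nn by linarith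
  qed
  moreover have "(\<integral>t. (c * norm (v t))\<^sup>2 \<partial>L01) \<le> A" unfolding sq[OF v] A_def using nn by linarith
  moreover have "0 < A" unfolding A_def using nn by linarith
  ultimately show ?thesis by blast
qed

text \<open>A small \<eta> makes the first term small for all kernels bounded by \<open>A\<close>,
  and a short interval then makes the second small: displacements are equicontinuous in
  time.\<close>

lemma integral_kernel_small:
  fixes K :: "real \<Rightarrow> real"
  assumes K: "integrable L01 (\<lambda>t. (K t)\<^sup>2)" "integrable L01 K"
    and A: "(\<integral>t. (K t)\<^sup>2 \<partial>L01) \<le> A" and \<eta>: "0 < \<eta>" and ab: "{a..b} \<subseteq> {0..1}" "a \<le> b"
  shows "(\<integral>t. K t \<partial>lebesgue_on {a..b}) \<le> \<eta> * A + (b - a) / (4 * \<eta>)"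
proof -
  have "K t \<le> \<eta> * (K t)\<^sup>2 + 1 / (4 * \<eta>)" for t
  proof -
    have "0 \<le> \<eta> * (K t - 1 / (2 * \<eta>))\<^sup>2" using \<eta> by simp
    also have "\<dots> = \<eta> * (K t)\<^sup>2 - K t + 1 / (4 * \<eta>)" using \<eta> by (simp add: power2_eq_square field_simps)
    finally show ?thesis by simp
  qed
  then have "(\<integral>t. K t \<partial>lebesgue_on {a..b}) \<le> (\<integral>t. \<eta> * (K t)\<^sup>2 + 1 / (4 * \<eta>) \<partial>lebesgue_on {a..b})"
    by (intro integral_mono Bochner_Integration.integrable_add integrable_mult_right integrable_L01_sub[OF K(1) ab(1)]
        integrable_L01_sub[OF K(2) ab(1)] continuous_imp_integrable_real continuous_intros)
  also have "\<dots> = \<eta> * (\<integral>t. (K t)\<^sup>2 \<partial>lebesgue_on {a..b}) + (\<integral>t. 1 / (4 * \<eta>) \<partial>lebesgue_on {a..b})"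
    using integrable_L01_sub[OF K(1) ab(1)]
    by (subst Bochner_Integration.integral_add) (auto intro!: continuous_imp_integrable_real)
  also have "(\<integral>t. 1 / (4 * \<eta>) \<partial>lebesgue_on {a..b}) = (b - a) / (4 * \<eta>)"
    using ab(2) by (simp add: measure_restrict_space)
  also have "\<eta> * (\<integral>t. (K t)\<^sup>2 \<partial>lebesgue_on {a..b}) \<le> \<eta> * A"
    using integral_sub_le[OF K(1) _ ab(1)] A \<eta> by (intro mult_left_mono) auto
  finally show ?thesis by simp
qed

lemma norm_integral_along_le:
  assumes v: "v \<in> L2V" and y: "continuous_on {0..1} y"
    and A: "(\<integral>t. (c * norm (v t))\<^sup>2 \<partial>L01) \<le> A" and \<eta>: "0 < \<eta>" and ab: "{a..b} \<subseteq> {0..1}" "a \<le> b"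
  shows "norm (displacement v y a b) \<le> \<eta> * A + (b - a) / (4 * \<eta>)"
proof -
  have "norm (displacement v y a b) \<le> (\<integral>s. norm (\<iota> (v s) (y s)) \<partial>lebesgue_on {a..b})"
    by (rule integral_norm_bound)
  also have "\<dots> \<le> (\<integral>s. c * norm (v s) \<partial>lebesgue_on {a..b})"
    using integrable_L01_sub[OF integrable_along[OF v y] ab(1)] integrable_L01_sub[OF kernel_facts(2)[OF v] ab(1)]
    by (intro integral_mono norm_eval_le integrable_norm)
  also have "\<dots> \<le> \<eta> * A + (b - a) / (4 * \<eta>)"
    by (rule integral_kernel_small[OF kernel_facts(1,2)[OF v] A \<eta> ab])
  finally show ?thesis .
qed

text \<open>The coordinate \<open>b\<close> of the displacement along the fixed curve
  \<open>y\<close> is the L2 pairing with the test field that equals \<open>rep (y s) b\<close> up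
  to time \<open>t\<close> and 0 afterwards.\<close>

lemma weak_limit_along:
  fixes vs :: "nat \<Rightarrow> real \<Rightarrow> 'v"
  assumes vs: "\<And>n. vs n \<in> L2V" and v: "v \<in> L2V" and weak: "L2V_weakly_converges vs v"
    and y: "continuous_on {0..1} y" and t: "t \<in> {0..1}"
  shows "(\<lambda>n. displacement (vs n) y 0 t) \<longlonglongrightarrow> displacement v y 0 t"
proof -
  have sub: "{0..t} \<subseteq> {0..1}" using t by auto
  have "(\<lambda>n. displacement (vs n) y 0 t \<bullet> b) \<longlonglongrightarrow> displacement v y 0 t \<bullet> b" for b
  proof -
    define u where "u s = (indicat_real {0..t} s) *\<^sub>R rep (y s) b" for s
    have ym: "y \<in> borel_measurable L01"
      by (rule continuous_imp_measurable_on_sets_lebesgue[OF y]) simp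
    have um: "u \<in> borel_measurable L01"
      unfolding u_def
    proof (rule measurable_scaleR)
      have "{0..t} \<in> sets L01" using sub by (simp add: sets_restrict_space_iff)
      then show "indicat_real {0..t} \<in> borel_measurable L01" by measurable
      show "(\<lambda>s. rep (y s) b) \<in> borel_measurable L01"
        using measurable_compose[OF ym borel_measurable_continuous_onI[OF continuous_on_rep]] .
    qed
    have "integrable L01 (\<lambda>s. (norm (u s))\<^sup>2)"
    proof (rule Bochner_Integration.integrable_bound[of _ "\<lambda>_. (c * norm b)\<^sup>2"])
      show "(\<lambda>s. (norm (u s))\<^sup>2) \<in> borel_measurable L01" using um by measurable
      have "norm (u s) \<le> c * norm b" for s
        using rep_norm_le[of "y s" b] c_pos by (simp add: u_def split: split_indicator)
      then show "AE s in L01. norm ((norm (u s))\<^sup>2) \<le> norm ((c * norm b)\<^sup>2)"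
        by (intro AE_I2) (simp add: power_mono)
    qed simp
    with um have u: "u \<in> L2V" by (simp add: L2V_def)
    have ip: "L2V_inner w u = displacement w y 0 t \<bullet> b" if w: "w \<in> L2V" for w
    proof -
      have "L2V_inner w u = (\<integral>s. (if s \<in> {0..t} then \<iota> (w s) (y s) \<bullet> b else 0) \<partial>L01)"
        unfolding L2V_inner_def u_def
        by (intro Bochner_Integration.integral_cong) (auto simp: rep_inner inner_commute[of _ "rep _ _"])
      also have "\<dots> = (\<integral>s. \<iota> (w s) (y s) \<bullet> b \<partial>lebesgue_on {0..t})"
        by (rule integral_restrict) (use sub in auto)
      also have "\<dots> = displacement w y 0 t \<bullet> b"
        by (rule integral_inner_left) (use integrable_L01_sub[OF integrable_along[OF w y] sub] in simp)
      finally show ?thesis .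
    qed
    have "(\<lambda>n. L2V_inner (vs n) u) \<longlonglongrightarrow> L2V_inner v u"
      using weak u by (simp add: L2V_weakly_converges_def)
    then show ?thesis by (simp add: ip vs v)
  qed
  then show ?thesis by (subst tendsto_componentwise_iff) simp
qed

text \<open>The gap between the two trajectories splits into the displacement of \<open>vs n\<close>
  along different curves, which Gronwall absorbs, and the error \<open>r n t\<close> of replacing
  \<open>vs n\<close> by \<open>v\<close> along the limit trajectory. Gronwall needs this error to
  be small uniformly in time, while weak convergence controls one time at a time; equicontinuity
  bridges this.\<close>

lemma flow_tendsto:
  fixes vs :: "nat \<Rightarrow> real \<Rightarrow> 'v"
  assumes vs: "\<And>n. vs n \<in> L2V" and v: "v \<in> L2V" and weak: "L2V_weakly_converges vs v"
  shows "(\<lambda>n. flow1 (vs n) x) \<longlonglongrightarrow> flow1 v x"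
proof -
  obtain A where A: "0 < A" and An: "\<And>n. (\<integral>t. (c * norm (vs n t))\<^sup>2 \<partial>L01) \<le> A"
    and Av: "(\<integral>t. (c * norm (v t))\<^sup>2 \<partial>L01) \<le> A"
    using weakly_convergent_bounded[OF vs v weak] by blast
  define y where "y t = flow (\<lambda>t. \<iota> (v t)) t x" for t
  define yn where "yn n t = flow (\<lambda>t. \<iota> (vs n t)) t x" for n t
  have py: "is_path v x y" unfolding y_def by (rule flow_path[OF v])
  have pyn: "is_path (vs n) x (yn n)" for n unfolding yn_def by (rule flow_path[OF vs])
  note cy = is_path_continuous[OF py] and cyn = is_path_continuous[OF pyn]
  define r where "r n t = displacement (vs n) y 0 t - displacement v y 0 t" for n t
  have ul: "uniform_limit {0..1} r (\<lambda>_. 0) sequentially"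
  proof (rule equicontinuous_uniform_limit)
    fix e :: real assume e: "0 < e"
    \<comment> \<open>With this choice and \<open>t - s < e * \<eta>\<close>, each of the two
      displacements is at most e/4 + e/4.\<close>
    define \<eta> where "\<eta> = e / (4 * A)"
    have \<eta>: "0 < \<eta>" using e A by (simp add: \<eta>_def)
    have le: "dist (r n s) (r n t) \<le> e" if st: "s \<in> {0..1}" "t \<in> {0..1}" "s \<le> t" "t - s < e * \<eta>" for n s t
    proof -
      have sub: "{s..t} \<subseteq> {0..1}" using st by auto
      have "r n t - r n s = displacement (vs n) y s t - displacement v y s t"
        using integral_L01_combine[OF integrable_along[OF vs cy], of s t n] integral_L01_combine[OF integrable_along[OF v cy], of s t] st
        by (simp add: r_def algebra_simps)
      then have "norm (r n t - r n s) \<le> norm (displacement (vs n) y s t) + norm (displacement v y s t)" by (simp add: norm_triangle_ineq4)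
      also have "\<dots> \<le> (\<eta> * A + (t - s) / (4 * \<eta>)) + (\<eta> * A + (t - s) / (4 * \<eta>))"
        by (intro add_mono norm_integral_along_le[OF vs cy An \<eta> sub st(3)] norm_integral_along_le[OF v cy Av \<eta> sub st(3)])
      also have "\<dots> \<le> e"
      proof -
        have "\<eta> * A = e / 4" using A by (simp add: \<eta>_def)
        moreover have "(t - s) / (4 * \<eta>) \<le> e / 4" using st(4) \<eta> by (simp add: field_simps)
        ultimately show ?thesis by linarith
      qed
      finally show ?thesis by (simp add: dist_norm norm_minus_commute)
    qed
    show "\<exists>d>0. \<forall>n. \<forall>s\<in>{0..1}. \<forall>t\<in>{0..1}. dist s t < d \<longrightarrow> dist (r n s) (r n t) \<le> e"
    proof (intro exI conjI allI ballI impI)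
      show "0 < e * \<eta>" using e \<eta> by simp
      fix n and s t :: real
      assume st: "s \<in> {0..1}" "t \<in> {0..1}" "dist s t < e * \<eta>"
      show "dist (r n s) (r n t) \<le> e"
      proof (cases "s \<le> t")
        case True then show ?thesis using st by (intro le) (auto simp: dist_real_def)
      next
        case False
        then have "dist (r n t) (r n s) \<le> e" using st by (intro le) (auto simp: dist_real_def)
        then show ?thesis by (simp add: dist_commute)
      qed
    qed
  next
    show "(\<lambda>n. r n t) \<longlonglongrightarrow> 0" if "t \<in> {0..1}" for t
      using tendsto_diff[OF weak_limit_along[OF vs v weak cy that] tendsto_const, of "displacement v y 0 t"]
      by (simp add: r_def)
  qed simp
  have r0: "\<forall>\<^sub>F n in sequentially. \<forall>t\<in>{0..1}. norm (r n t) < e" if "0 < e" for e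
    using uniform_limitD[OF ul that] by (simp add: dist_norm)
  have "(\<lambda>n. yn n 1) \<longlonglongrightarrow> y 1"
  proof (rule tendstoI)
    fix e :: real assume e: "0 < e"
    \<comment> \<open>Chosen so that the Gronwall bound \<open>2 * d * exp (2 * A)\<close> is
      e/2.\<close>
    define d where "d = e / (4 * exp (2 * A))"
    have d: "0 < d" using e by (simp add: d_def)
    show "\<forall>\<^sub>F n in sequentially. dist (yn n 1) (y 1) < e"
    proof (rule eventually_mono[OF r0[OF d]])
      fix n assume rd: "\<forall>t\<in>{0..1}. norm (r n t) < d"
      have "norm (yn n 1 - y 1) \<le> 2 * d * exp (2 * A)"
      proof (rule gronwall_forward[OF kernel_facts[OF vs] A An, where f = "\<lambda>t. norm (yn n t - y t)"])
        show "continuous_on {0..1} (\<lambda>t. norm (yn n t - y t))" by (intro continuous_intros cy cyn)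
        fix t :: real assume t: "t \<in> {0..1}"
        then have sub: "{0..t} \<subseteq> {0..1}" by auto
        have "yn n t - y t = (displacement (vs n) (yn n) 0 t - displacement (vs n) y 0 t) + r n t"
          using is_path_eq[OF pyn t, of n] is_path_eq[OF py t] by (simp add: r_def)
        then show "norm (yn n t - y t) \<le> d + (\<integral>s. c * norm (vs n s) * norm (yn n s - y s) \<partial>lebesgue_on {0..t})"
          using norm_triangle_ineq[of "displacement (vs n) (yn n) 0 t - displacement (vs n) y 0 t" "r n t"]
            norm_integral_diff_le[OF vs cyn cy sub, of n n] bspec[OF rd t] by simp
      qed (use d in auto)
      also have "\<dots> = e / 2" by (simp add: d_def)
      finally show "dist (yn n 1) (y 1) < e" using e by (simp add: dist_norm)
    qed
  qed
  then show ?thesis by (simp add: yn_def y_def)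
qed

lemma flow_lipschitz:
  assumes v: "v \<in> L2V" and A: "0 < A" "(\<integral>t. (c * norm (v t))\<^sup>2 \<partial>L01) \<le> A"
  shows "norm (flow1 v x - flow1 v y) \<le> 2 * norm (x - y) * exp (2 * A)"
  using path_stability[OF v flow_path[OF v] flow_path[OF v] A, of 1] by simp

lemma flow_continuous:
  assumes v: "v \<in> L2V"
  shows "continuous_on UNIV (flow1 v)"
proof (rule lipschitz_on_continuous_on)
  define A where "A = (\<integral>t. (c * norm (v t))\<^sup>2 \<partial>L01) + 1"
  have "0 \<le> (\<integral>t. (c * norm (v t))\<^sup>2 \<partial>L01)" by simp
  then have A: "0 < A" "(\<integral>t. (c * norm (v t))\<^sup>2 \<partial>L01) \<le> A" unfolding A_def by linarith+
  show "(2 * exp (2 * A))-lipschitz_on UNIV (flow1 v)"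
    by (rule lipschitz_onI) (use flow_lipschitz[OF v A] in \<open>auto simp: dist_norm mult_ac\<close>)
qed

lemma flow_inj: "v \<in> L2V \<Longrightarrow> inj (flow1 v)"
  by (rule injI) (rule path_injective[OF _ flow_path flow_path], auto)

text \<open>The fields are bounded in L2, so all time-one maps share the Lipschitz constant
  \<open>2 * exp (2 * A)\<close>, and the pointwise limit is uniform on compact sets.\<close>

lemma flow_uniform_limit:
  fixes vs :: "nat \<Rightarrow> real \<Rightarrow> 'v"
  assumes vs: "\<And>n. vs n \<in> L2V" and v: "v \<in> L2V" and weak: "L2V_weakly_converges vs v" and X: "compact X"
  shows "uniform_limit X (\<lambda>n. flow1 (vs n)) (flow1 v) sequentially"
proof (rule equicontinuous_uniform_limit[OF X])
  obtain A where A: "0 < A" and An: "\<And>n. (\<integral>t. (c * norm (vs n t))\<^sup>2 \<partial>L01) \<le> A"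
    using weakly_convergent_bounded[OF vs v weak] by blast
  fix e :: real assume e: "0 < e"
  show "\<exists>d>0. \<forall>n. \<forall>x\<in>X. \<forall>y\<in>X. dist x y < d \<longrightarrow>
      dist (flow1 (vs n) x) (flow1 (vs n) y) \<le> e"
  proof (intro exI conjI allI ballI impI)
    show "0 < e / (2 * exp (2 * A))" using e by simp
    fix n and x y :: 'a assume "dist x y < e / (2 * exp (2 * A))"
    then have "2 * norm (x - y) * exp (2 * A) \<le> e" by (simp add: dist_norm field_simps)
    then show "dist (flow1 (vs n) x) (flow1 (vs n) y) \<le> e"
      using flow_lipschitz[OF vs A An, of n x y] by (simp add: dist_norm)
  qed
qed (rule flow_tendsto[OF vs v weak])

end

text \<open>On a compact set the inverse is continuous, and its extension by 0 off the closed image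
  stays Borel. A left inverse defined everywhere is needed to push image measures back.\<close>

lemma continuous_injective_borel_inverse:
  fixes f :: "'a::euclidean_space \<Rightarrow> 'b::euclidean_space"
  assumes X: "compact X" and f: "continuous_on X f" "inj_on f X"
  shows "\<exists>g\<in>borel_measurable borel. \<forall>x\<in>X. g (f x) = x"
proof
  let ?g = "\<lambda>z. if z \<in> f ` X then the_inv_into X f z else 0"
  have "continuous_on (f ` X) (the_inv_into X f)"
    by (rule continuous_on_inv[OF f(1) X]) (use the_inv_into_f_f[OF f(2)] in auto)
  moreover have "f ` X \<in> sets borel"
    using compact_continuous_image[OF f(1) X] by (simp add: borel_closed compact_imp_closed)
  ultimately show "?g \<in> borel_measurable borel"
    by (intro borel_measurable_continuous_on_if) auto
  show "\<forall>x\<in>X. ?g (f x) = x" using the_inv_into_f_f[OF f(2)] by simp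
qed

section \<open>Entropic transport under injective maps\<close>

text \<open>Values stay in \<open>ereal\<close> as long as infima are compared, since
  \<open>real_of_ereal\<close> sends infinity to 0 and is not monotone.\<close>

definition transport_value ::
  "('a \<times> 'a \<Rightarrow> real) \<Rightarrow> real \<Rightarrow> 'a::euclidean_space measure \<Rightarrow> 'a measure \<Rightarrow> ('a \<times> 'a) measure \<Rightarrow> ereal" where
  "transport_value C \<epsilon> \<mu> \<nu> \<pi> = enn2ereal (\<integral>\<^sup>+ z. ennreal (C z) \<partial>\<pi>) + ereal \<epsilon> * KL \<pi> (\<mu> \<Otimes>\<^sub>M \<nu>)"

definition transport_inf ::
  "('a \<times> 'a \<Rightarrow> real) \<Rightarrow> real \<Rightarrow> 'a::euclidean_space measure \<Rightarrow> 'a measure \<Rightarrow> ereal" where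
  "transport_inf C \<epsilon> \<mu> \<nu> = (INF \<pi>\<in>couplings \<mu> \<nu>. transport_value C \<epsilon> \<mu> \<nu> \<pi>)"

lemma entropic_OT_eq: "entropic_OT C \<epsilon> \<mu> \<nu> = real_of_ereal (transport_inf C \<epsilon> \<mu> \<nu>)"
  by (simp add: entropic_OT_def transport_inf_def transport_value_def)

text \<open>Every version of the density computes the entropy, so explicit or composed densities can
  be used in place of \<open>RN_deriv\<close>.\<close>

lemma KL_density_eq:
  assumes "sigma_finite_measure m" and \<rho>: "\<rho> \<in> borel_measurable m"
  shows "KL (density m \<rho>) m =
    (if integrable (density m \<rho>) (\<lambda>z. ln (enn2real (\<rho> z)))
     then ereal (\<integral>z. ln (enn2real (\<rho> z)) \<partial>density m \<rho>) else \<infinity>)"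
proof -
  interpret sigma_finite_measure m by fact
  have "AE z in m. \<rho> z = RN_deriv m (density m \<rho>) z"
    by (rule RN_deriv_unique[OF \<rho> refl])
  then have ae: "AE z in density m \<rho>. entropy_density (exp 1) m (density m \<rho>) z = ln (enn2real (\<rho> z))"
    by (subst AE_density[OF \<rho>]) (auto simp: entropy_density_def log_def elim!: AE_mp)
  have ac: "absolutely_continuous m (density m \<rho>)" by (rule absolutely_continuousI_density[OF \<rho>])
  have em: "entropy_density (exp 1) m (density m \<rho>) \<in> borel_measurable (density m \<rho>)"
    using measurable_entropy_density[of "exp 1" m "density m \<rho>"] by simp
  have lm: "(\<lambda>z. ln (enn2real (\<rho> z))) \<in> borel_measurable (density m \<rho>)" using \<rho> by measurable
  show ?thesis
    using integrable_cong_AE[OF em lm ae] integral_cong_AE[OF em lm ae] ac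
    by (simp add: KL_def KL_divergence_def)
qed

lemma distr_fst_density:
  assumes "sigma_finite_measure M1" "sigma_finite_measure M2"
    and \<rho> [measurable]: "\<rho> \<in> borel_measurable (M1 \<Otimes>\<^sub>M M2)"
  shows "distr (density (M1 \<Otimes>\<^sub>M M2) \<rho>) M1 fst = density M1 (\<lambda>x. \<integral>\<^sup>+y. \<rho> (x, y) \<partial>M2)"
proof (rule measure_eqI)
  interpret M2: sigma_finite_measure M2 by fact
  fix A assume "A \<in> sets (distr (density (M1 \<Otimes>\<^sub>M M2) \<rho>) M1 fst)"
  then have A [measurable]: "A \<in> sets M1" by simp
  have "emeasure (distr (density (M1 \<Otimes>\<^sub>M M2) \<rho>) M1 fst) A =
      (\<integral>\<^sup>+z. \<rho> z * indicator (fst -` A \<inter> space (M1 \<Otimes>\<^sub>M M2)) z \<partial>(M1 \<Otimes>\<^sub>M M2))"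
    by (subst emeasure_distr) (auto simp: emeasure_density)
  also have "\<dots> = (\<integral>\<^sup>+z. \<rho> z * indicator A (fst z) \<partial>(M1 \<Otimes>\<^sub>M M2))"
    by (intro nn_integral_cong) (auto split: split_indicator)
  also have "\<dots> = (\<integral>\<^sup>+x. \<integral>\<^sup>+y. \<rho> (x, y) * indicator A x \<partial>M2 \<partial>M1)"
    by (subst M2.nn_integral_fst[symmetric]) auto
  also have "\<dots> = (\<integral>\<^sup>+x. (\<integral>\<^sup>+y. \<rho> (x, y) \<partial>M2) * indicator A x \<partial>M1)"
    by (intro nn_integral_cong nn_integral_multc) measurable
  also have "\<dots> = emeasure (density M1 (\<lambda>x. \<integral>\<^sup>+y. \<rho> (x, y) \<partial>M2)) A"
    by (subst emeasure_density) auto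
  finally show "emeasure (distr (density (M1 \<Otimes>\<^sub>M M2) \<rho>) M1 fst) A =
      emeasure (density M1 (\<lambda>x. \<integral>\<^sup>+y. \<rho> (x, y) \<partial>M2)) A" .
qed simp

lemma distr_snd_density:
  assumes "sigma_finite_measure M1" "sigma_finite_measure M2"
    and \<rho> [measurable]: "\<rho> \<in> borel_measurable (M1 \<Otimes>\<^sub>M M2)"
  shows "distr (density (M1 \<Otimes>\<^sub>M M2) \<rho>) M2 snd = density M2 (\<lambda>y. \<integral>\<^sup>+x. \<rho> (x, y) \<partial>M1)"
proof (rule measure_eqI)
  interpret M1: sigma_finite_measure M1 by fact
  interpret M2: sigma_finite_measure M2 by fact
  interpret P: pair_sigma_finite M1 M2 ..
  fix A assume "A \<in> sets (distr (density (M1 \<Otimes>\<^sub>M M2) \<rho>) M2 snd)"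
  then have A [measurable]: "A \<in> sets M2" by simp
  have "emeasure (distr (density (M1 \<Otimes>\<^sub>M M2) \<rho>) M2 snd) A =
      (\<integral>\<^sup>+z. \<rho> z * indicator (snd -` A \<inter> space (M1 \<Otimes>\<^sub>M M2)) z \<partial>(M1 \<Otimes>\<^sub>M M2))"
    by (subst emeasure_distr) (auto simp: emeasure_density)
  also have "\<dots> = (\<integral>\<^sup>+z. \<rho> z * indicator A (snd z) \<partial>(M1 \<Otimes>\<^sub>M M2))"
    by (intro nn_integral_cong) (auto split: split_indicator)
  also have "\<dots> = (\<integral>\<^sup>+y. \<integral>\<^sup>+x. \<rho> (x, y) * indicator A y \<partial>M1 \<partial>M2)"
    by (subst P.nn_integral_snd[symmetric]) auto
  also have "\<dots> = (\<integral>\<^sup>+y. (\<integral>\<^sup>+x. \<rho> (x, y) \<partial>M1) * indicator A y \<partial>M2)"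
    by (intro nn_integral_cong nn_integral_multc) measurable
  also have "\<dots> = emeasure (density M2 (\<lambda>y. \<integral>\<^sup>+x. \<rho> (x, y) \<partial>M1)) A"
    by (subst emeasure_density) auto
  finally show "emeasure (distr (density (M1 \<Otimes>\<^sub>M M2) \<rho>) M2 snd) A =
      emeasure (density M2 (\<lambda>y. \<integral>\<^sup>+x. \<rho> (x, y) \<partial>M1)) A" .
qed simp

lemma measurable_eq_sets:
  assumes "sets M = sets M'" and "f \<in> M' \<rightarrow>\<^sub>M N"
  shows "f \<in> M \<rightarrow>\<^sub>M N"
  using assms(2) by (subst measurable_cong_sets[OF assms(1) refl])

lemma measurable_fst_borel: "fst \<in> borel_measurable (borel :: ('a::euclidean_space \<times> 'b::euclidean_space) measure)"
  by (intro borel_measurable_continuous_onI continuous_intros)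

lemma measurable_snd_borel: "snd \<in> borel_measurable (borel :: ('a::euclidean_space \<times> 'b::euclidean_space) measure)"
  by (intro borel_measurable_continuous_onI continuous_intros)

lemma sets_pair_borel:
  fixes \<mu> :: "'a::euclidean_space measure" and \<nu> :: "'b::euclidean_space measure"
  assumes "sets \<mu> = sets borel" "sets \<nu> = sets borel"
  shows "sets (\<mu> \<Otimes>\<^sub>M \<nu>) = sets borel"
  using sets_pair_measure_cong[OF assms] unfolding borel_prod .

text \<open>Lifting couplings uses both directions: one reads the marginal equations off a given
  coupling, the other makes a coupling out of the composed density.\<close>

lemma coupling_density_iff:
  fixes \<mu> \<nu> :: "'a::euclidean_space measure"
  assumes \<mu>: "prob_space \<mu>" "sets \<mu> = sets borel" and \<nu>: "prob_space \<nu>" "sets \<nu> = sets borel"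
    and \<rho> [measurable]: "\<rho> \<in> borel_measurable (\<mu> \<Otimes>\<^sub>M \<nu>)"
  shows "density (\<mu> \<Otimes>\<^sub>M \<nu>) \<rho> \<in> couplings \<mu> \<nu> \<longleftrightarrow>
    (AE x in \<mu>. (\<integral>\<^sup>+y. \<rho> (x, y) \<partial>\<nu>) = 1) \<and> (AE y in \<nu>. (\<integral>\<^sup>+x. \<rho> (x, y) \<partial>\<mu>) = 1)"
proof -
  interpret \<mu>: prob_space \<mu> by fact
  interpret \<nu>: prob_space \<nu> by fact
  interpret P: pair_sigma_finite \<mu> \<nu> ..
  let ?\<pi> = "density (\<mu> \<Otimes>\<^sub>M \<nu>) \<rho>"
  have sf: "sigma_finite_measure \<mu>" "sigma_finite_measure \<nu>" by unfold_locales
  have "distr ?\<pi> borel fst = density \<mu> (\<lambda>x. \<integral>\<^sup>+y. \<rho> (x, y) \<partial>\<nu>)"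
    using distr_fst_density[OF sf \<rho>] \<mu>(2) distr_cong[OF refl \<mu>(2), of ?\<pi> fst fst] by simp
  then have f: "distr ?\<pi> borel fst = \<mu> \<longleftrightarrow> (AE x in \<mu>. (\<integral>\<^sup>+y. \<rho> (x, y) \<partial>\<nu>) = 1)"
    using \<mu>.density_unique_iff[of "\<lambda>x. \<integral>\<^sup>+y. \<rho> (x, y) \<partial>\<nu>" "\<lambda>_. 1"] by (simp add: density_1)
  have "distr ?\<pi> borel snd = density \<nu> (\<lambda>y. \<integral>\<^sup>+x. \<rho> (x, y) \<partial>\<mu>)"
    using distr_snd_density[OF sf \<rho>] \<nu>(2) distr_cong[OF refl \<nu>(2), of ?\<pi> snd snd] by simp
  then have s: "distr ?\<pi> borel snd = \<nu> \<longleftrightarrow> (AE y in \<nu>. (\<integral>\<^sup>+x. \<rho> (x, y) \<partial>\<mu>) = 1)"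
    using \<nu>.density_unique_iff[of "\<lambda>y. \<integral>\<^sup>+x. \<rho> (x, y) \<partial>\<mu>" "\<lambda>_. 1"] by (simp add: density_1)
  have fm: "fst \<in> ?\<pi> \<rightarrow>\<^sub>M borel"
    using measurable_fst[of \<mu> \<nu>] unfolding measurable_cong_sets[OF refl \<mu>(2)] by simp
  have "prob_space ?\<pi>" if "distr ?\<pi> borel fst = \<mu>"
    by (rule prob_space_distrD[OF fm]) (simp add: that \<mu>(1))
  then show ?thesis using f s sets_pair_borel[OF \<mu>(2) \<nu>(2)] by (auto simp: couplings_def)
qed

text \<open>Finite entropy provides a density \<rho> with respect to the image product, and
  \<open>\<rho> \<circ> map_prod f g\<close> is the density of the lift. The image product is the
  push-forward of the original one, so the marginal equations and the integral of ln \<rho> are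
  preserved by substitution. Injectivity enters only afterwards, through the inverse maps in
  \<open>entropic_OT_distr\<close>.\<close>

lemma coupling_lift:
  fixes \<alpha> \<beta> :: "'a::euclidean_space measure"
  assumes \<alpha>: "prob_space \<alpha>" "sets \<alpha> = sets borel" and \<beta>: "prob_space \<beta>" "sets \<beta> = sets borel"
    and f: "f \<in> borel_measurable borel" and g: "g \<in> borel_measurable borel"
    and \<pi>: "\<pi> \<in> couplings (distr \<alpha> borel f) (distr \<beta> borel g)"
    and KL: "KL \<pi> (distr \<alpha> borel f \<Otimes>\<^sub>M distr \<beta> borel g) \<noteq> \<infinity>"
  shows "\<exists>\<pi>'\<in>couplings \<alpha> \<beta>. distr \<pi>' borel (map_prod f g) = \<pi> \<and>
    KL \<pi>' (\<alpha> \<Otimes>\<^sub>M \<beta>) = KL \<pi> (distr \<alpha> borel f \<Otimes>\<^sub>M distr \<beta> borel g)"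
proof -
  interpret \<alpha>: prob_space \<alpha> by fact
  interpret \<beta>: prob_space \<beta> by fact
  interpret P: pair_prob_space \<alpha> \<beta> ..
  define \<mu> where "\<mu> = distr \<alpha> borel f"
  define \<nu> where "\<nu> = distr \<beta> borel g"
  have f\<alpha> [measurable]: "f \<in> \<alpha> \<rightarrow>\<^sub>M borel" by (rule measurable_eq_sets[OF \<alpha>(2) f])
  have g\<beta> [measurable]: "g \<in> \<beta> \<rightarrow>\<^sub>M borel" by (rule measurable_eq_sets[OF \<beta>(2) g])
  have \<mu>: "prob_space \<mu>" "sets \<mu> = sets borel" by (simp_all add: \<mu>_def \<alpha>.prob_space_distr)
  have \<nu>: "prob_space \<nu>" "sets \<nu> = sets borel" by (simp_all add: \<nu>_def \<beta>.prob_space_distr)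
  interpret \<mu>: prob_space \<mu> by fact
  interpret \<nu>: prob_space \<nu> by fact
  interpret Q: pair_prob_space \<mu> \<nu> ..
  have sm: "sets (\<mu> \<Otimes>\<^sub>M \<nu>) = sets borel" by (rule sets_pair_borel[OF \<mu>(2) \<nu>(2)])
  have sa: "sets (\<alpha> \<Otimes>\<^sub>M \<beta>) = sets borel" by (rule sets_pair_borel[OF \<alpha>(2) \<beta>(2)])
  have prod: "\<mu> \<Otimes>\<^sub>M \<nu> = distr (\<alpha> \<Otimes>\<^sub>M \<beta>) borel (map_prod f g)"
  proof -
    have "\<mu> \<Otimes>\<^sub>M \<nu> = distr (\<alpha> \<Otimes>\<^sub>M \<beta>) (borel \<Otimes>\<^sub>M borel) (\<lambda>(x, y). (f x, g y))"
      unfolding \<mu>_def \<nu>_def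
      by (rule pair_measure_distr[OF f\<alpha> g\<beta>]) (use \<nu>.sigma_finite_measure_axioms in \<open>simp add: \<nu>_def\<close>)
    then show ?thesis by (simp add: borel_prod map_prod_def)
  qed
  have mp [measurable]: "map_prod f g \<in> \<alpha> \<Otimes>\<^sub>M \<beta> \<rightarrow>\<^sub>M borel"
    unfolding borel_prod[symmetric] map_prod_def by measurable
  have sets_\<pi>: "sets \<pi> = sets borel" and prob_\<pi>: "prob_space \<pi>" using \<pi> by (simp_all add: couplings_def)
  have ac: "absolutely_continuous (\<mu> \<Otimes>\<^sub>M \<nu>) \<pi>"
    using KL by (auto simp: KL_def \<mu>_def \<nu>_def split: if_splits)
  define \<rho> where "\<rho> = RN_deriv (\<mu> \<Otimes>\<^sub>M \<nu>) \<pi>"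
  have \<rho>m [measurable]: "\<rho> \<in> borel_measurable (\<mu> \<Otimes>\<^sub>M \<nu>)" by (simp add: \<rho>_def)
  have \<rho>b [measurable]: "\<rho> \<in> borel_measurable borel" by (rule measurable_eq_sets[OF sm[symmetric] \<rho>m])
  have dens: "density (\<mu> \<Otimes>\<^sub>M \<nu>) \<rho> = \<pi>"
    unfolding \<rho>_def by (rule Q.P.density_RN_deriv[OF ac]) (simp add: sets_\<pi> sm)
  have in_c: "density (\<mu> \<Otimes>\<^sub>M \<nu>) \<rho> \<in> couplings \<mu> \<nu>" unfolding dens using \<pi> by (simp add: \<mu>_def \<nu>_def)
  define \<rho>' where "\<rho>' = \<rho> \<circ> map_prod f g"
  have \<rho>'m [measurable]: "\<rho>' \<in> borel_measurable (\<alpha> \<Otimes>\<^sub>M \<beta>)" unfolding \<rho>'_def by measurable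
  define \<pi>' where "\<pi>' = density (\<alpha> \<Otimes>\<^sub>M \<beta>) \<rho>'"
  have marg: "AE x in \<mu>. (\<integral>\<^sup>+y. \<rho> (x, y) \<partial>\<nu>) = 1" "AE y in \<nu>. (\<integral>\<^sup>+x. \<rho> (x, y) \<partial>\<mu>) = 1"
    using in_c unfolding coupling_density_iff[OF \<mu> \<nu> \<rho>m] by simp_all
  have \<rho>x: "(\<lambda>y. \<rho> (x, y)) \<in> borel_measurable (distr \<beta> borel g)" for x
    using measurable_compose[OF borel_measurable_continuous_onI \<rho>b, of "\<lambda>y. (x, y)"]
    by (simp add: continuous_on_Pair)
  have \<rho>y: "(\<lambda>x. \<rho> (x, y)) \<in> borel_measurable (distr \<alpha> borel f)" for y
    using measurable_compose[OF borel_measurable_continuous_onI \<rho>b, of "\<lambda>x. (x, y)"]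
    by (simp add: continuous_on_Pair)
  have "AE x in \<alpha>. (\<integral>\<^sup>+y. \<rho> (f x, y) \<partial>\<nu>) = 1"
    using AE_distrD[OF f\<alpha> marg(1)[unfolded \<mu>_def]] .
  then have m1: "AE x in \<alpha>. (\<integral>\<^sup>+y. \<rho>' (x, y) \<partial>\<beta>) = 1"
    unfolding \<nu>_def by (simp add: nn_integral_distr[OF g\<beta> \<rho>x] \<rho>'_def)
  have "AE y in \<beta>. (\<integral>\<^sup>+x. \<rho> (x, g y) \<partial>\<mu>) = 1"
    using AE_distrD[OF g\<beta> marg(2)[unfolded \<nu>_def]] .
  then have m2: "AE y in \<beta>. (\<integral>\<^sup>+x. \<rho>' (x, y) \<partial>\<alpha>) = 1"
    unfolding \<mu>_def by (simp add: nn_integral_distr[OF f\<alpha> \<rho>y] \<rho>'_def)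
  have c': "\<pi>' \<in> couplings \<alpha> \<beta>"
    unfolding \<pi>'_def coupling_density_iff[OF \<alpha> \<beta> \<rho>'m] using m1 m2 by simp
  have push: "distr \<pi>' borel (map_prod f g) = \<pi>"
    unfolding \<pi>'_def \<rho>'_def using density_distr[OF \<rho>b mp] dens unfolding prod by (simp add: o_def)
  have mp': "map_prod f g \<in> \<pi>' \<rightarrow>\<^sub>M borel" using mp by (simp add: \<pi>'_def)
  have lnm: "(\<lambda>z. ln (enn2real (\<rho> z))) \<in> borel_measurable borel" by measurable
  have sfa: "sigma_finite_measure (\<alpha> \<Otimes>\<^sub>M \<beta>)" and sfm: "sigma_finite_measure (\<mu> \<Otimes>\<^sub>M \<nu>)" by unfold_locales
  have "KL \<pi>' (\<alpha> \<Otimes>\<^sub>M \<beta>) = KL \<pi> (\<mu> \<Otimes>\<^sub>M \<nu>)"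
    using KL_density_eq[OF sfa \<rho>'m] KL_density_eq[OF sfm \<rho>m]
      integrable_distr_eq[OF mp' lnm] integral_distr[OF mp' lnm]
    unfolding dens \<pi>'_def[symmetric] push by (simp add: \<rho>'_def)
  with c' push show ?thesis unfolding \<mu>_def \<nu>_def by blast
qed

text \<open>A coupling of infinite entropy has infinite value and imposes nothing; every other one
  lifts to a coupling with the same value.\<close>

lemma transport_inf_lift:
  fixes \<alpha> \<beta> :: "'a::euclidean_space measure"
  assumes \<alpha>: "prob_space \<alpha>" "sets \<alpha> = sets borel" and \<beta>: "prob_space \<beta>" "sets \<beta> = sets borel"
    and f: "f \<in> borel_measurable borel" and g: "g \<in> borel_measurable borel"
    and C: "C \<in> borel_measurable borel" and \<epsilon>: "0 < \<epsilon>"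
  shows "transport_inf (C \<circ> map_prod f g) \<epsilon> \<alpha> \<beta> \<le> transport_inf C \<epsilon> (distr \<alpha> borel f) (distr \<beta> borel g)"
  unfolding transport_inf_def[of C]
proof (rule INF_greatest)
  fix \<pi> assume \<pi>: "\<pi> \<in> couplings (distr \<alpha> borel f) (distr \<beta> borel g)"
  show "transport_inf (C \<circ> map_prod f g) \<epsilon> \<alpha> \<beta> \<le> transport_value C \<epsilon> (distr \<alpha> borel f) (distr \<beta> borel g) \<pi>"
  proof (cases "KL \<pi> (distr \<alpha> borel f \<Otimes>\<^sub>M distr \<beta> borel g) = \<infinity>")
    case True
    have "enn2ereal (\<integral>\<^sup>+ z. ennreal (C z) \<partial>\<pi>) \<noteq> - \<infinity>"
      using enn2ereal_nonneg[of "\<integral>\<^sup>+ z. ennreal (C z) \<partial>\<pi>"] by auto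
    then show ?thesis using \<epsilon> by (simp add: transport_value_def True)
  next
    case False
    from coupling_lift[OF \<alpha> \<beta> f g \<pi> False] obtain \<pi>' where \<pi>': "\<pi>' \<in> couplings \<alpha> \<beta>"
      and push: "distr \<pi>' borel (map_prod f g) = \<pi>"
      and KL: "KL \<pi>' (\<alpha> \<Otimes>\<^sub>M \<beta>) = KL \<pi> (distr \<alpha> borel f \<Otimes>\<^sub>M distr \<beta> borel g)" by blast
    have mp: "map_prod f g \<in> \<pi>' \<rightarrow>\<^sub>M borel"
    proof -
      have "map_prod f g \<in> borel \<rightarrow>\<^sub>M borel"
        unfolding borel_prod[symmetric] map_prod_def using f g by measurable
      moreover have "sets \<pi>' = sets borel" using \<pi>' by (simp add: couplings_def)
      ultimately show ?thesis by (rule measurable_eq_sets[rotated])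
    qed
    have "(\<integral>\<^sup>+ z. ennreal (C z) \<partial>\<pi>) = (\<integral>\<^sup>+ z. ennreal ((C \<circ> map_prod f g) z) \<partial>\<pi>')"
      unfolding push[symmetric] using C by (subst nn_integral_distr[OF mp]) auto
    then have "transport_value C \<epsilon> (distr \<alpha> borel f) (distr \<beta> borel g) \<pi> = transport_value (C \<circ> map_prod f g) \<epsilon> \<alpha> \<beta> \<pi>'"
      by (simp add: transport_value_def KL)
    then show ?thesis unfolding transport_inf_def using INF_lower[OF \<pi>'] by simp
  qed
qed

section \<open>Dependence of the entropic cost on the ground cost, and change of variables\<close>

lemma coupling_AE:
  assumes \<pi>: "\<pi> \<in> couplings \<mu> \<nu>"
    and P: "AE x in \<mu>. P x" "{x. P x} \<in> sets borel" and Q: "AE y in \<nu>. Q y" "{y. Q y} \<in> sets borel"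
  shows "AE z in \<pi>. P (fst z) \<and> Q (snd z)"
proof -
  have s: "sets \<pi> = sets borel" and d: "distr \<pi> borel fst = \<mu>" "distr \<pi> borel snd = \<nu>"
    using \<pi> by (simp_all add: couplings_def)
  note m = measurable_eq_sets[OF s measurable_fst_borel] measurable_eq_sets[OF s measurable_snd_borel]
  have "AE z in \<pi>. P (fst z)" using P(1) unfolding d(1)[symmetric] by (rule AE_distrD[OF m(1)])
  moreover have "AE z in \<pi>. Q (snd z)" using Q(1) unfolding d(2)[symmetric] by (rule AE_distrD[OF m(2)])
  ultimately show ?thesis by simp
qed

text \<open>The same coupling is tested on both sides: the entropy terms coincide, and the cost
  integrals differ by at most \<delta> because the coupling has mass 1 and sits on the pairs with
  \<open>P\<close> and \<open>Q\<close>.\<close>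

lemma transport_inf_le_add:
  fixes \<mu> \<nu> :: "'a::euclidean_space measure"
  assumes P: "AE x in \<mu>. P x" "{x. P x} \<in> sets borel" and Q: "AE y in \<nu>. Q y" "{y. Q y} \<in> sets borel"
    and C: "C2 \<in> borel_measurable borel" "\<And>z. 0 \<le> C2 z" and \<delta>: "0 \<le> \<delta>"
    and le: "\<And>x y. P x \<Longrightarrow> Q y \<Longrightarrow> C1 (x, y) \<le> C2 (x, y) + \<delta>"
  shows "transport_inf C1 \<epsilon> \<mu> \<nu> \<le> transport_inf C2 \<epsilon> \<mu> \<nu> + ereal \<delta>"
proof -
  have "transport_inf C1 \<epsilon> \<mu> \<nu> - ereal \<delta> \<le> transport_value C2 \<epsilon> \<mu> \<nu> \<pi>" if \<pi>: "\<pi> \<in> couplings \<mu> \<nu>" for \<pi>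
  proof -
    have s: "sets \<pi> = sets borel" and "prob_space \<pi>" using \<pi> by (simp_all add: couplings_def)
    interpret prob_space \<pi> by fact
    have C2: "(\<lambda>z. ennreal (C2 z)) \<in> borel_measurable \<pi>"
      using measurable_eq_sets[OF s C(1)] by measurable
    have "(\<integral>\<^sup>+ z. ennreal (C1 z) \<partial>\<pi>) \<le> (\<integral>\<^sup>+ z. ennreal (C2 z) + ennreal \<delta> \<partial>\<pi>)"
    proof (rule nn_integral_mono_AE, rule AE_mp[OF coupling_AE[OF \<pi> P Q]], rule AE_I2, rule impI)
      fix z assume "P (fst z) \<and> Q (snd z)"
      then have "C1 z \<le> C2 z + \<delta>" using le[of "fst z" "snd z"] by simp
      then show "ennreal (C1 z) \<le> ennreal (C2 z) + ennreal \<delta>"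
        using C(2) \<delta> by (simp add: ennreal_leI flip: ennreal_plus)
    qed
    also have "\<dots> = (\<integral>\<^sup>+ z. ennreal (C2 z) \<partial>\<pi>) + ennreal \<delta>"
      using C2 by (subst nn_integral_add) (auto simp: emeasure_space_1)
    finally have "enn2ereal (\<integral>\<^sup>+ z. ennreal (C1 z) \<partial>\<pi>) \<le> enn2ereal (\<integral>\<^sup>+ z. ennreal (C2 z) \<partial>\<pi>) + ereal \<delta>"
      using \<delta> by (simp add: less_eq_ennreal.rep_eq plus_ennreal.rep_eq)
    then have "transport_value C1 \<epsilon> \<mu> \<nu> \<pi> \<le> transport_value C2 \<epsilon> \<mu> \<nu> \<pi> + ereal \<delta>"
      unfolding transport_value_def by (simp add: add.assoc add.commute add_right_mono) (metis add.assoc add.commute add_left_mono)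
    moreover have "transport_inf C1 \<epsilon> \<mu> \<nu> \<le> transport_value C1 \<epsilon> \<mu> \<nu> \<pi>"
      unfolding transport_inf_def by (rule INF_lower[OF \<pi>])
    ultimately have "transport_inf C1 \<epsilon> \<mu> \<nu> \<le> transport_value C2 \<epsilon> \<mu> \<nu> \<pi> + ereal \<delta>" by (rule order_trans[rotated])
    then show ?thesis
      by (cases "transport_inf C1 \<epsilon> \<mu> \<nu>"; cases "transport_value C2 \<epsilon> \<mu> \<nu> \<pi>") auto
  qed
  then have "transport_inf C1 \<epsilon> \<mu> \<nu> - ereal \<delta> \<le> transport_inf C2 \<epsilon> \<mu> \<nu>"
    unfolding transport_inf_def[of C2] by (rule INF_greatest)
  then show ?thesis
    by (cases "transport_inf C1 \<epsilon> \<mu> \<nu>"; cases "transport_inf C2 \<epsilon> \<mu> \<nu>") auto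
qed

lemma entropic_OT_close:
  fixes \<mu> \<nu> :: "'a::euclidean_space measure"
  assumes PQ: "AE x in \<mu>. P x" "{x. P x} \<in> sets borel" "AE y in \<nu>. Q y" "{y. Q y} \<in> sets borel"
    and C: "C1 \<in> borel_measurable borel" "\<And>z. 0 \<le> C1 z" "C2 \<in> borel_measurable borel" "\<And>z. 0 \<le> C2 z"
    and close: "\<And>x y. P x \<Longrightarrow> Q y \<Longrightarrow> \<bar>C1 (x, y) - C2 (x, y)\<bar> \<le> \<delta>"
    and \<delta>: "0 \<le> \<delta>"
  shows "\<bar>entropic_OT C1 \<epsilon> \<mu> \<nu> - entropic_OT C2 \<epsilon> \<mu> \<nu>\<bar> \<le> \<delta>"
proof -
  have "transport_inf C1 \<epsilon> \<mu> \<nu> \<le> transport_inf C2 \<epsilon> \<mu> \<nu> + ereal \<delta>"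
    by (rule transport_inf_le_add[OF PQ C(3,4) \<delta>]) (use close in \<open>smt (verit)\<close>)
  moreover have "transport_inf C2 \<epsilon> \<mu> \<nu> \<le> transport_inf C1 \<epsilon> \<mu> \<nu> + ereal \<delta>"
    by (rule transport_inf_le_add[OF PQ C(1,2) \<delta>]) (use close in \<open>smt (verit)\<close>)
  \<comment> \<open>The two bounds make the infima infinite together, and then both real values are
    0, so the estimate holds before finiteness is known.\<close>
  ultimately show ?thesis
    unfolding entropic_OT_eq using \<delta>
    by (cases "transport_inf C1 \<epsilon> \<mu> \<nu>"; cases "transport_inf C2 \<epsilon> \<mu> \<nu>") auto
qed

text \<open>One inequality lifts couplings along \<open>f\<close> and \<open>g\<close>; the other
  lifts along the left inverses on the image measures, which push back to \<alpha> and
  \<beta>.\<close>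

lemma entropic_OT_distr:
  fixes \<alpha> \<beta> :: "'a::euclidean_space measure" and f f' g g' :: "'a \<Rightarrow> 'a"
  assumes \<alpha>: "prob_space \<alpha>" "sets \<alpha> = sets borel" and \<beta>: "prob_space \<beta>" "sets \<beta> = sets borel"
    and f: "f \<in> borel_measurable borel" "f' \<in> borel_measurable borel" "AE x in \<alpha>. f' (f x) = x"
    and g: "g \<in> borel_measurable borel" "g' \<in> borel_measurable borel" "AE x in \<beta>. g' (g x) = x"
    and C: "C \<in> borel_measurable borel" "\<And>z. 0 \<le> C z" and \<epsilon>: "0 < \<epsilon>"
  shows "entropic_OT C \<epsilon> (distr \<alpha> borel f) (distr \<beta> borel g) = entropic_OT (C \<circ> map_prod f g) \<epsilon> \<alpha> \<beta>"
proof -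
  have inv: "distr (distr \<gamma> borel h) borel h' = \<gamma>" "AE z in distr \<gamma> borel h. h (h' z) = z"
      "{z. h (h' z) = z} \<in> sets borel"
    if \<gamma>: "prob_space \<gamma>" "sets \<gamma> = sets borel"
      and h: "h \<in> borel_measurable borel" "h' \<in> borel_measurable borel" "AE x in \<gamma>. h' (h x) = x"
    for \<gamma> :: "'a measure" and h h' :: "'a \<Rightarrow> 'a"
  proof -
    have h\<gamma>: "h \<in> \<gamma> \<rightarrow>\<^sub>M borel" by (rule measurable_eq_sets[OF \<gamma>(2) h(1)])
    have "distr (distr \<gamma> borel h) borel h' = distr \<gamma> borel (h' \<circ> h)"
      by (rule distr_distr[OF h(2) h\<gamma>])
    also have "\<dots> = distr \<gamma> \<gamma> (\<lambda>x. x)"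
      using h(3) measurable_comp[OF h\<gamma> h(2)] \<gamma>(2)
      by (intro distr_cong_AE) (auto intro: measurable_ident_sets)
    finally show "distr (distr \<gamma> borel h) borel h' = \<gamma>" by simp
    show S: "{z. h (h' z) = z} \<in> sets borel"
    proof -
      have "(\<lambda>z. norm (h (h' z) - z)) \<in> borel_measurable borel"
        using measurable_compose[OF h(2,1)] by measurable
      then have "{z \<in> space borel. norm (h (h' z) - z) = 0} \<in> sets borel" by measurable
      then show ?thesis by simp
    qed
    have "AE x in \<gamma>. h (h' (h x)) = h x" using h(3) by (rule AE_mp) (auto intro!: AE_I2)
    then show "AE z in distr \<gamma> borel h. h (h' z) = z"
      using AE_distr_iff[OF h\<gamma>, of "\<lambda>z. h (h' z) = z"] S by simp
  qed
  note if' = inv[OF \<alpha> f] and ig' = inv[OF \<beta> g]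
  define \<mu> where "\<mu> = distr \<alpha> borel f"
  define \<nu> where "\<nu> = distr \<beta> borel g"
  have \<mu>: "prob_space \<mu>" "sets \<mu> = sets borel"
    using prob_space.prob_space_distr[OF \<alpha>(1) measurable_eq_sets[OF \<alpha>(2) f(1)]] by (simp_all add: \<mu>_def)
  have \<nu>: "prob_space \<nu>" "sets \<nu> = sets borel"
    using prob_space.prob_space_distr[OF \<beta>(1) measurable_eq_sets[OF \<beta>(2) g(1)]] by (simp_all add: \<nu>_def)
  have mp: "map_prod f g \<in> borel_measurable borel" "map_prod f' g' \<in> borel_measurable borel"
    unfolding borel_prod[symmetric] map_prod_def using f g by measurable
  have Cm: "C \<circ> map_prod f g \<in> borel_measurable borel"
    "C \<circ> map_prod f g \<circ> map_prod f' g' \<in> borel_measurable borel"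
    using measurable_comp[OF mp(1) C(1)] measurable_comp[OF mp(2) measurable_comp[OF mp(1) C(1)]] by simp_all
  \<comment> \<open>The two costs agree wherever \<open>f (f' x) = x\<close> and
    \<open>g (g' y) = y\<close>, which holds almost everywhere for the image measures; hence the
    error 0.\<close>
  have "transport_inf C \<epsilon> \<mu> \<nu> \<le> transport_inf (C \<circ> map_prod f g \<circ> map_prod f' g') \<epsilon> \<mu> \<nu> + ereal 0"
    by (rule transport_inf_le_add[OF if'(2)[folded \<mu>_def] if'(3) ig'(2)[folded \<nu>_def] ig'(3) Cm(2)])
      (use C(2) in auto)
  also have "\<dots> \<le> transport_inf (C \<circ> map_prod f g) \<epsilon> (distr \<mu> borel f') (distr \<nu> borel g')"
    using transport_inf_lift[OF \<mu> \<nu> f(2) g(2) Cm(1) \<epsilon>] by simp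
  also have "\<dots> = transport_inf (C \<circ> map_prod f g) \<epsilon> \<alpha> \<beta>"
    using if'(1) ig'(1) by (simp add: \<mu>_def \<nu>_def)
  finally have "transport_inf C \<epsilon> \<mu> \<nu> = transport_inf (C \<circ> map_prod f g) \<epsilon> \<alpha> \<beta>"
    using transport_inf_lift[OF \<alpha> \<beta> f(1) g(1) C(1) \<epsilon>] by (simp add: \<mu>_def \<nu>_def)
  then show ?thesis by (simp add: entropic_OT_eq \<mu>_def \<nu>_def)
qed

section \<open>Schrodinger potentials\<close>

locale compact_prob =
  fixes K :: "'a::euclidean_space set" and \<mu> :: "'a measure"
  assumes compact_K: "compact K" and prob: "prob_space \<mu>" and sets_\<mu>: "sets \<mu> = sets borel"
    and AE_K: "AE x in \<mu>. x \<in> K"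
begin

sublocale prob_space \<mu> by (rule prob)

lemma K_borel: "K \<in> sets borel"
  using compact_K by (simp add: borel_closed compact_imp_closed)

lemma K_sets: "K \<in> sets \<mu>"
  by (simp add: sets_\<mu> K_borel)

lemma measurable_restrict_K:
  fixes g :: "'a \<Rightarrow> real"
  assumes "continuous_on K g"
  shows "(\<lambda>x. indicat_real K x * g x) \<in> borel_measurable borel"
  using borel_measurable_continuous_on_indicator[OF K_borel assms] by simp

lemma integrable_K:
  fixes g :: "'a \<Rightarrow> real"
  assumes g: "continuous_on K g"
  shows "integrable \<mu> (\<lambda>x. indicat_real K x * g x)"
proof -
  have "bounded (g ` K)" using compact_continuous_image[OF g compact_K] by (rule compact_imp_bounded)
  then obtain B where B: "\<forall>x\<in>K. \<bar>g x\<bar> \<le> B" by (auto simp: bounded_iff)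
  have "AE x in \<mu>. norm (indicat_real K x * g x) \<le> \<bar>B\<bar>"
    using B by (intro AE_I2) (auto split: split_indicator intro: order_trans[OF _ abs_ge_self])
  then show ?thesis
    by (rule integrable_const_bound) (rule measurable_eq_sets[OF sets_\<mu> measurable_restrict_K[OF g]])
qed

text \<open>The indicator makes functions that are continuous on \<open>K\<close> alone measurable
  on the whole space; as \<mu> sits on \<open>K\<close>, it does not affect the value.\<close>

definition integral_K :: "('a \<Rightarrow> real) \<Rightarrow> real" where "integral_K g = (\<integral>x. indicat_real K x * g x \<partial>\<mu>)"

lemma integral_K_mono:
  assumes "continuous_on K g" "continuous_on K h" "\<And>x. x \<in> K \<Longrightarrow> g x \<le> h x"
  shows "integral_K g \<le> integral_K h"
  unfolding integral_K_def using assms by (intro integral_mono integrable_K) (auto split: split_indicator)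

lemma integral_K_const: "integral_K (\<lambda>_. r) = r"
proof -
  have "integral_K (\<lambda>_. r) = (\<integral>x. r \<partial>\<mu>)"
    unfolding integral_K_def
  proof (rule integral_cong_AE)
    show "(\<lambda>x. indicat_real K x * r) \<in> borel_measurable \<mu>" using K_sets by measurable
    show "AE x in \<mu>. indicat_real K x * r = r" using AE_K by (rule AE_mp) (auto intro!: AE_I2)
  qed simp
  then show ?thesis by (simp add: prob_space)
qed

lemma integral_K_mult: "integral_K (\<lambda>x. r * g x) = r * integral_K g"
  by (simp add: integral_K_def mult.left_commute)

lemma K_nonempty: "K \<noteq> {}"
  using AE_K AE_False by fastforce

end

text \<open>\<open>c\<close> plays the role of the ground cost divided by \<epsilon>, so that
  \<epsilon> disappears from the fixed point equation.\<close>

locale compact_cost = compact_prob +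
  fixes c :: "'a \<times> 'a \<Rightarrow> real" and M :: real
  assumes cont_c: "continuous_on UNIV c" and c_nonneg: "0 \<le> c z"
    and c_le: "\<lbrakk>x \<in> K; y \<in> K\<rbrakk> \<Longrightarrow> c (x, y) \<le> M"
begin

lemma M_nonneg: "0 \<le> M"
  using K_nonempty c_le c_nonneg order_trans by blast

lemma cont_c1: "continuous_on S (\<lambda>y. c (x, y))"
proof -
  have "continuous_on UNIV (c \<circ> (\<lambda>y. (x, y)))"
    by (intro continuous_on_compose continuous_intros continuous_on_subset[OF cont_c]) auto
  then have "continuous_on UNIV (\<lambda>y. c (x, y))" by (simp add: o_def)
  then show ?thesis by (rule continuous_on_subset) simp
qed

text \<open>The map \<open>f \<mapsto> - ln (Z f)\<close> is the Sinkhorn update (a soft minimum of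
  \<open>c (x, y) - f y\<close>); its fixed points are the symmetric potentials.\<close>

definition Z :: "('a \<Rightarrow> real) \<Rightarrow> 'a \<Rightarrow> real" where "Z f x = integral_K (\<lambda>y. exp (f y - c (x, y)))"

lemma cont_kernel: "continuous_on K f \<Longrightarrow> continuous_on K (\<lambda>y. exp (f y - c (x, y)))"
  by (intro continuous_intros cont_c1)

lemma Z_bounds:
  assumes f: "continuous_on K f" and l: "\<And>y. y \<in> K \<Longrightarrow> l \<le> f y" and u: "\<And>y. y \<in> K \<Longrightarrow> f y \<le> u" and x: "x \<in> K"
  shows "exp (l - M) \<le> Z f x" "Z f x \<le> exp u"
proof -
  have "integral_K (\<lambda>_. exp (l - M)) \<le> Z f x"
    unfolding Z_def using l c_le[OF x] by (intro integral_K_mono cont_kernel f) (auto intro: diff_mono)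
  then show "exp (l - M) \<le> Z f x" by (simp add: integral_K_const)
  have "Z f x \<le> integral_K (\<lambda>_. exp u)"
    unfolding Z_def
  proof (intro integral_K_mono cont_kernel f)
    fix y assume "y \<in> K"
    then show "exp (f y - c (x, y)) \<le> exp u" using u[of y] c_nonneg[of "(x, y)"] by simp
  qed simp
  then show "Z f x \<le> exp u" by (simp add: integral_K_const)
qed

lemma Z_pos:
  assumes f: "continuous_on K f" and x: "x \<in> K"
  shows "0 < Z f x"
proof -
  obtain y where "\<forall>z\<in>K. f y \<le> f z" using continuous_attains_inf[OF compact_K K_nonempty f] by blast
  moreover obtain w where "\<forall>z\<in>K. f z \<le> f w" using continuous_attains_sup[OF compact_K K_nonempty f] by blast
  ultimately have "exp (f y - M) \<le> Z f x" using Z_bounds(1)[OF f _ _ x, of "f y" "f w"] by blast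
  then show ?thesis using exp_gt_zero by (rule less_le_trans[rotated])
qed

lemma ln_Z_bounds:
  assumes f: "continuous_on K f" and l: "\<And>y. y \<in> K \<Longrightarrow> l \<le> f y" and u: "\<And>y. y \<in> K \<Longrightarrow> f y \<le> u" and x: "x \<in> K"
  shows "l - M \<le> ln (Z f x)" "ln (Z f x) \<le> u"
  using Z_bounds[OF f l u x] Z_pos[OF f x] ln_le_cancel_iff[of "Z f x" "exp u"] by (simp_all add: ln_ge_iff)

text \<open>Both the dependence on \<open>f\<close> and on the base point are controlled by the same comparison.\<close>

lemma ln_Z_compare:
  assumes f: "continuous_on K f" "continuous_on K g" and x: "x \<in> K" "x' \<in> K"
    and le: "\<And>y. y \<in> K \<Longrightarrow> f y - c (x, y) \<le> d + (g y - c (x', y))"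
  shows "ln (Z f x) \<le> d + ln (Z g x')"
proof -
  have "Z f x \<le> integral_K (\<lambda>y. exp d * exp (g y - c (x', y)))"
    unfolding Z_def using le by (intro integral_K_mono cont_kernel f continuous_intros) (simp flip: exp_add)
  also have "\<dots> = exp d * Z g x'" by (simp add: Z_def integral_K_mult)
  finally have "ln (Z f x) \<le> ln (exp d * Z g x')"
    using Z_pos[OF f(1) x(1)] Z_pos[OF f(2) x(2)] by (subst ln_le_cancel_iff) auto
  also have "\<dots> = d + ln (Z g x')" using Z_pos[OF f(2) x(2)] by (simp add: ln_mult)
  finally show ?thesis .
qed

lemma ln_Z_nonexpansive:
  assumes f: "continuous_on K f" "continuous_on K g" and x: "x \<in> K"
    and d: "\<And>y. y \<in> K \<Longrightarrow> \<bar>f y - g y\<bar> \<le> d"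
  shows "\<bar>ln (Z f x) - ln (Z g x)\<bar> \<le> d"
proof -
  have "ln (Z f x) \<le> d + ln (Z g x)"
    by (rule ln_Z_compare[OF f x x]) (use d in \<open>force simp: abs_le_iff\<close>)
  moreover have "ln (Z g x) \<le> d + ln (Z f x)"
    by (rule ln_Z_compare[OF f(2,1) x x]) (use d in \<open>force simp: abs_le_iff\<close>)
  ultimately show ?thesis by linarith
qed

lemma ln_Z_modulus:
  assumes f: "continuous_on K f" and x: "x \<in> K" "x' \<in> K"
    and w: "\<And>y. y \<in> K \<Longrightarrow> \<bar>c (x, y) - c (x', y)\<bar> \<le> w"
  shows "\<bar>ln (Z f x) - ln (Z f x')\<bar> \<le> w"
proof -
  have "ln (Z f x) \<le> w + ln (Z f x')"
    by (rule ln_Z_compare[OF f f x]) (use w in \<open>force simp: abs_le_iff\<close>)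
  moreover have "ln (Z f x') \<le> w + ln (Z f x)"
    by (rule ln_Z_compare[OF f f x(2,1)]) (use w in \<open>force simp: abs_le_iff\<close>)
  ultimately show ?thesis by linarith
qed

lemma cost_equicontinuous:
  assumes "0 < e"
  shows "\<exists>d>0. \<forall>x\<in>K. \<forall>x'\<in>K. dist x x' < d \<longrightarrow> (\<forall>y\<in>K. \<bar>c (x, y) - c (x', y)\<bar> \<le> e)"
proof -
  have "uniformly_continuous_on (K \<times> K) c"
    by (intro compact_uniformly_continuous continuous_on_subset[OF cont_c] compact_Times compact_K) simp
  then obtain d where d: "0 < d" "\<And>z z'. z \<in> K \<times> K \<Longrightarrow> z' \<in> K \<times> K \<Longrightarrow> dist z' z < d \<Longrightarrow> dist (c z') (c z) < e"
    using assms unfolding uniformly_continuous_on_def by metis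
  show ?thesis
  proof (intro exI[of _ d] conjI ballI impI d(1))
    fix x x' y assume "x \<in> K" "x' \<in> K" "dist x x' < d" "y \<in> K"
    then show "\<bar>c (x, y) - c (x', y)\<bar> \<le> e"
      using d(2)[of "(x', y)" "(x, y)"] by (simp add: dist_Pair_Pair dist_real_def)
  qed
qed

lemma continuous_ln_Z:
  assumes f: "continuous_on K f"
  shows "continuous_on K (\<lambda>x. ln (Z f x))"
  unfolding continuous_on_iff
proof (intro ballI allI impI)
  fix x and e :: real assume x: "x \<in> K" and e: "0 < e"
  then obtain d where d: "0 < d"
    "\<forall>x\<in>K. \<forall>x'\<in>K. dist x x' < d \<longrightarrow> (\<forall>y\<in>K. \<bar>c (x, y) - c (x', y)\<bar> \<le> e / 2)"
    using cost_equicontinuous[of "e / 2"] by auto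
  have "dist (ln (Z f x')) (ln (Z f x)) < e" if "x' \<in> K" "dist x' x < d" for x'
  proof -
    have "\<bar>ln (Z f x') - ln (Z f x)\<bar> \<le> e / 2" by (rule ln_Z_modulus[OF f]) (use d(2) that x in auto)
    then show ?thesis using e by (simp add: dist_real_def)
  qed
  then show "\<exists>d>0. \<forall>x'\<in>K. dist x' x < d \<longrightarrow> dist (ln (Z f x')) (ln (Z f x)) < e" using d(1) by blast
qed

text \<open>For \<open>\<theta> < 1\<close> the damped map \<open>f \<mapsto> - \<theta> ln (Z f)\<close> is a contraction for the supremum norm.
  Its iterates are bounded independently of \<open>\<theta>\<close>, because they oscillate by at most \<open>M\<close>.\<close>

lemma approximate_potential:
  assumes \<delta>: "0 < \<delta>" "\<delta> < 1"
  shows "\<exists>f. continuous_on K f \<and> (\<forall>x\<in>K. \<bar>f x\<bar> \<le> 1 + 2 * M) \<and>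
    (\<forall>x\<in>K. \<forall>x'\<in>K. \<forall>w. (\<forall>y\<in>K. \<bar>c (x, y) - c (x', y)\<bar> \<le> w) \<longrightarrow> \<bar>f x - f x'\<bar> \<le> w) \<and>
    (\<forall>x\<in>K. \<bar>f x + ln (Z f x)\<bar> \<le> \<delta> * (2 + 4 * M))"
proof -
  define \<theta> where "\<theta> = 1 - \<delta>"
  have \<theta>: "0 < \<theta>" "\<theta> < 1" using \<delta> by (simp_all add: \<theta>_def)
  define T where "T f x = - \<theta> * ln (Z f x)" for f x
  define F where "F n = (T ^^ n) (\<lambda>_. 0)" for n
  have F_Suc: "F (Suc n) = T (F n)" for n by (simp add: F_def)
  have cF: "continuous_on K (F n)" for n
  proof (induction n)
    case 0 show ?case by (simp add: F_def)
  next
    case (Suc n) then show ?case unfolding F_Suc T_def by (intro continuous_intros continuous_ln_Z)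
  qed
  have step: "\<bar>F (Suc n) x - F n x\<bar> \<le> \<theta> ^ n * M" if "x \<in> K" for n x
    using that
  proof (induction n arbitrary: x)
    case 0
    have "0 - M \<le> ln (Z (\<lambda>_. 0) x)" "ln (Z (\<lambda>_. 0) x) \<le> 0"
      by (rule ln_Z_bounds[of "\<lambda>_. 0" 0 0]; use 0 in simp)+
    then have "\<bar>ln (Z (\<lambda>_. 0) x)\<bar> \<le> M" by simp
    moreover have "\<theta> * \<bar>ln (Z (\<lambda>_. 0) x)\<bar> \<le> 1 * \<bar>ln (Z (\<lambda>_. 0) x)\<bar>"
      using \<theta> by (intro mult_right_mono) auto
    ultimately show ?case using \<theta> by (simp add: F_def T_def abs_mult)
  next
    case (Suc n)
    have "\<bar>ln (Z (F (Suc n)) x) - ln (Z (F n) x)\<bar> \<le> \<theta> ^ n * M"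
      by (rule ln_Z_nonexpansive[OF cF cF Suc.prems Suc.IH])
    then have "\<theta> * \<bar>ln (Z (F (Suc n)) x) - ln (Z (F n) x)\<bar> \<le> \<theta> * (\<theta> ^ n * M)"
      using \<theta> by (intro mult_left_mono) auto
    moreover have "F (Suc (Suc n)) x - F (Suc n) x = - \<theta> * (ln (Z (F (Suc n)) x) - ln (Z (F n) x))"
      unfolding F_Suc[of "Suc n"] F_Suc[of n] T_def by (simp add: algebra_simps)
    ultimately show ?case using \<theta> by (simp add: abs_mult)
  qed
  have "(\<lambda>n. \<theta> ^ Suc n * M) \<longlonglongrightarrow> 0 * M"
    using \<theta> by (intro tendsto_intros LIMSEQ_Suc LIMSEQ_power_zero) simp
  then have "\<forall>\<^sub>F n in sequentially. \<theta> ^ Suc n * M < \<delta>" using \<delta>(1) by (intro order_tendstoD(2)) auto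
  \<comment> \<open>A finite iterate suffices: once a step moves by less than \<delta>, the
    remaining error has the size that damping causes anyway.\<close>
  then obtain n where n: "\<theta> ^ Suc n * M < \<delta>" by (meson eventually_sequentially order_refl)
  define f where "f = F (Suc n)"
  have cf: "continuous_on K f" unfolding f_def by (rule cF)
  have modulus: "\<bar>f x - f x'\<bar> \<le> w"
    if x: "x \<in> K" "x' \<in> K" and w: "\<And>y. y \<in> K \<Longrightarrow> \<bar>c (x, y) - c (x', y)\<bar> \<le> w" for x x' w
  proof -
    have "f x - f x' = - \<theta> * (ln (Z (F n) x) - ln (Z (F n) x'))"
      by (simp add: f_def F_Suc T_def algebra_simps)
    then have "\<bar>f x - f x'\<bar> = \<theta> * \<bar>ln (Z (F n) x) - ln (Z (F n) x')\<bar>" using \<theta> by (simp add: abs_mult)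
    also have "\<dots> \<le> 1 * \<bar>ln (Z (F n) x) - ln (Z (F n) x')\<bar>" using \<theta> by (intro mult_right_mono) auto
    also have "\<dots> \<le> w" using ln_Z_modulus[OF cF x w] by simp
    finally show ?thesis .
  qed
  have osc: "\<bar>f x - f x'\<bar> \<le> M" if "x \<in> K" "x' \<in> K" for x x'
  proof (rule modulus[OF that])
    fix y assume "y \<in> K"
    then show "\<bar>c (x, y) - c (x', y)\<bar> \<le> M"
      using c_le[OF that(1), of y] c_le[OF that(2), of y] c_nonneg[of "(x, y)"] c_nonneg[of "(x', y)"] by linarith
  qed
  have fixed: "\<bar>f x + \<theta> * ln (Z f x)\<bar> \<le> \<delta>" if "x \<in> K" for x
  proof -
    have "F (Suc (Suc n)) x = - \<theta> * ln (Z f x)" by (simp add: f_def F_Suc[of "Suc n"] T_def)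
    then show ?thesis using step[OF that, of "Suc n"] n by (simp add: f_def)
  qed
  have lnZ: "f x - 2 * M \<le> ln (Z f x)" "ln (Z f x) \<le> f x + M" if x: "x \<in> K" for x
  proof -
    have "f x - M \<le> f y" "f y \<le> f x + M" if "y \<in> K" for y using osc[OF x that] by linarith+
    from ln_Z_bounds[OF cf this x] show "f x - 2 * M \<le> ln (Z f x)" "ln (Z f x) \<le> f x + M" by simp_all
  qed
  have bound: "\<bar>f x\<bar> \<le> 1 + 2 * M" if x: "x \<in> K" for x
  proof -
    have "\<theta> * (f x - 2 * M) \<le> \<theta> * ln (Z f x)" "\<theta> * ln (Z f x) \<le> \<theta> * (f x + M)"
      using \<theta> lnZ[OF x] by (simp_all add: mult_left_mono)
    then have 1: "(1 + \<theta>) * f x \<le> \<delta> + \<theta> * (2 * M)" "- \<delta> - \<theta> * M \<le> (1 + \<theta>) * f x"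
      using fixed[OF x] by (simp_all add: algebra_simps abs_le_iff)
    have 2: "\<theta> * (2 * M) \<le> 1 * (2 * M)" "\<theta> * M \<le> 1 * M" using \<theta> M_nonneg by (intro mult_right_mono; simp)+
    show ?thesis
    proof (cases "0 \<le> f x")
      case True
      then have "0 \<le> \<theta> * f x" using \<theta> by simp
      then show ?thesis using 1(1) 2(1) \<delta> True by (simp add: algebra_simps)
    next
      case False
      then have "\<theta> * f x \<le> 0" using \<theta> by (simp add: mult_nonneg_nonpos)
      then show ?thesis using 1(2) 2(2) \<delta> False M_nonneg by (simp add: algebra_simps)
    qed
  qed
  \<comment> \<open>The undamped expression differs from the damped one by
    \<open>\<delta> * ln (Z f x)\<close>, where the logarithm is at most \<open>1 + 4 * M\<close> in
    absolute value; the damped error adds one more \<delta>.\<close>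
  have "\<bar>f x + ln (Z f x)\<bar> \<le> \<delta> * (2 + 4 * M)" if x: "x \<in> K" for x
  proof -
    have "\<bar>ln (Z f x)\<bar> \<le> 1 + 4 * M" using lnZ[OF x] bound[OF x] M_nonneg by linarith
    then have "\<delta> * \<bar>ln (Z f x)\<bar> \<le> \<delta> * (1 + 4 * M)" using \<delta> by (intro mult_left_mono) auto
    then have "\<bar>\<delta> * ln (Z f x)\<bar> \<le> \<delta> * (1 + 4 * M)" using \<delta> by (simp add: abs_mult)
    moreover have "f x + ln (Z f x) = (f x + \<theta> * ln (Z f x)) + \<delta> * ln (Z f x)" by (simp add: \<theta>_def algebra_simps)
    moreover have "\<delta> * (2 + 4 * M) = \<delta> + \<delta> * (1 + 4 * M)" by (simp add: algebra_simps)
    ultimately show ?thesis using fixed[OF x] abs_triangle_ineq[of "f x + \<theta> * ln (Z f x)" "\<delta> * ln (Z f x)"] by linarith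
  qed
  with cf bound modulus show ?thesis by blast
qed

text \<open>The sup bound and the modulus of the approximate potentials do not depend on the
  damping, so Arzela-Ascoli gives a uniform limit as it vanishes. The equation passes to the limit
  because the Sinkhorn update is nonexpansive.\<close>

lemma potential_exists: "\<exists>f. continuous_on K f \<and> (\<forall>x\<in>K. exp (f x) * Z f x = 1)"
proof -
  \<comment> \<open>The offset 2 keeps every value strictly below 1.\<close>
  define \<delta> where "\<delta> n = 1 / real (n + 2)" for n
  have \<delta>: "0 < \<delta> n" "\<delta> n < 1" for n by (simp_all add: \<delta>_def)
  obtain F where cF: "\<And>n. continuous_on K (F n)" and bF: "\<And>n x. x \<in> K \<Longrightarrow> \<bar>F n x\<bar> \<le> 1 + 2 * M"
    and mF: "\<And>n x x' w. x \<in> K \<Longrightarrow> x' \<in> K \<Longrightarrow> \<forall>y\<in>K. \<bar>c (x, y) - c (x', y)\<bar> \<le> w \<Longrightarrow> \<bar>F n x - F n x'\<bar> \<le> w"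
    and eF: "\<And>n x. x \<in> K \<Longrightarrow> \<bar>F n x + ln (Z (F n) x)\<bar> \<le> \<delta> n * (2 + 4 * M)"
    using approximate_potential[OF \<delta>] by metis
  have equi: "\<exists>d. 0 < d \<and> (\<forall>n y. y \<in> K \<and> norm (x - y) < d \<longrightarrow> norm (F n x - F n y) < e)"
    if x: "x \<in> K" and e: "0 < e" for x e
  proof -
    obtain d where d: "0 < d"
      "\<forall>x\<in>K. \<forall>x'\<in>K. dist x x' < d \<longrightarrow> (\<forall>y\<in>K. \<bar>c (x, y) - c (x', y)\<bar> \<le> e / 2)"
      using cost_equicontinuous[of "e / 2"] e by auto
    have "norm (F n x - F n y) < e" if "y \<in> K" "norm (x - y) < d" for n y
    proof -
      have "\<forall>z\<in>K. \<bar>c (x, z) - c (y, z)\<bar> \<le> e / 2" using d(2) x that by (simp add: dist_norm)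
      from mF[OF x that(1) this, of n] show ?thesis using e by simp
    qed
    with d(1) show ?thesis by blast
  qed
  obtain g r where g: "continuous_on K g" and r: "strict_mono (r :: nat \<Rightarrow> nat)"
    and lim: "\<And>e. 0 < e \<Longrightarrow> \<exists>N. \<forall>n x. n \<ge> N \<and> x \<in> K \<longrightarrow> norm (F (r n) x - g x) < e"
  proof (rule Arzela_Ascoli[OF compact_K, of F "1 + 2 * M"])
    show "norm (F n x) \<le> 1 + 2 * M" if "x \<in> K" for n x using bF[OF that] by simp
  qed (use equi in blast)+
  have "exp (g x) * Z g x = 1" if x: "x \<in> K" for x
  proof -
    have "\<bar>g x + ln (Z g x)\<bar> \<le> e" if e: "0 < e" for e
    proof -
      obtain N where N: "\<forall>n x. n \<ge> N \<and> x \<in> K \<longrightarrow> norm (F (r n) x - g x) < e / 4" using lim[of "e / 4"] e by auto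
      have "(\<lambda>n. \<delta> n * (2 + 4 * M)) \<longlonglongrightarrow> 0 * (2 + 4 * M)"
        unfolding \<delta>_def using LIMSEQ_ignore_initial_segment[OF lim_1_over_n, of 2] by (intro tendsto_mult tendsto_const) simp
      then have "\<forall>\<^sub>F n in sequentially. \<delta> n * (2 + 4 * M) < e / 4" using e by (intro order_tendstoD(2)) auto
      then obtain N' where N': "\<And>n. n \<ge> N' \<Longrightarrow> \<delta> n * (2 + 4 * M) < e / 4" by (auto simp: eventually_sequentially)
      define n where "n = max N N'"
      have close: "\<bar>F (r n) y - g y\<bar> \<le> e / 4" if "y \<in> K" for y
        using N that by (force simp: n_def intro: less_imp_le)
      have "n \<le> r n" by (rule seq_suble[OF r])
      then have "\<bar>F (r n) x + ln (Z (F (r n)) x)\<bar> < e / 4"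
        using eF[OF x, of "r n"] N'[of "r n"] by (simp add: n_def)
      moreover have "\<bar>ln (Z (F (r n)) x) - ln (Z g x)\<bar> \<le> e / 4"
        by (rule ln_Z_nonexpansive[OF cF g x close])
      ultimately show ?thesis using close[OF x] e by linarith
    qed
    then have "\<bar>g x + ln (Z g x)\<bar> \<le> 0" by (rule field_le_epsilon[where y = 0, simplified])
    then have "ln (Z g x) = - g x" by simp
    then have "Z g x = exp (- g x)" using Z_pos[OF g x] by (metis exp_ln)
    then show ?thesis by (simp flip: exp_add)
  qed
  with g show ?thesis by blast
qed

end

section \<open>Nonnegativity of the Sinkhorn divergence\<close>

text \<open>Approximating the identity by simple functions turns the double integrals into finite sums,
  to which positive definiteness applies.\<close>

lemma positive_definite_integral:
  fixes k :: "'a::euclidean_space \<Rightarrow> 'a \<Rightarrow> real"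
  assumes k: "continuous_on UNIV (\<lambda>(x, y). k x y)" "\<And>x y. k x y = k y x" "positive_definite_kernel k"
    and \<mu>: "compact_prob K \<mu>" and \<nu>: "compact_prob K \<nu>"
    and a: "continuous_on K a" and b: "continuous_on K b"
  shows "2 * (\<integral>z. (indicat_real K (fst z) * a (fst z)) * (indicat_real K (snd z) * b (snd z)) * k (fst z) (snd z) \<partial>(\<mu> \<Otimes>\<^sub>M \<nu>))
    \<le> (\<integral>z. (indicat_real K (fst z) * a (fst z)) * (indicat_real K (snd z) * a (snd z)) * k (fst z) (snd z) \<partial>(\<mu> \<Otimes>\<^sub>M \<mu>))
    + (\<integral>z. (indicat_real K (fst z) * b (fst z)) * (indicat_real K (snd z) * b (snd z)) * k (fst z) (snd z) \<partial>(\<nu> \<Otimes>\<^sub>M \<nu>))"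
proof -
  have K: "compact K" using \<mu> by (simp add: compact_prob_def)
  obtain s :: "nat \<Rightarrow> 'a \<Rightarrow> 'a" where s: "\<And>n. simple_function borel (s n)"
    and s_lim: "\<And>x. (\<lambda>n. s n x) \<longlonglongrightarrow> x" and s_le: "\<And>n x. norm (s n x) \<le> 2 * norm x"
    using borel_measurable_implies_sequence_metric[of "\<lambda>x. x" "borel :: 'a measure" 0] by auto
  have sm: "s n \<in> borel_measurable borel" for n by (rule borel_measurable_simple_function[OF s])
  define R where "R n = range (s n)" for n
  have R: "finite (R n)" for n using s[of n] by (simp add: simple_function_def R_def)
  define w where "w h x = indicat_real K x * h x" for h :: "'a \<Rightarrow> real" and x
  \<comment> \<open>The mass at \<open>p\<close> of the image under \<open>s n\<close> of the signed
    measure with density \<open>w h\<close>.\<close>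
  define A where "A \<gamma> h n p = (\<integral>x. w h x * indicat_real {p} (s n x) \<partial>\<gamma>)" for \<gamma> :: "'a measure" and h n p
  define B where "B \<gamma> g \<gamma>' h = (\<integral>z. w g (fst z) * w h (snd z) * k (fst z) (snd z) \<partial>(\<gamma> \<Otimes>\<^sub>M \<gamma>'))"
    for \<gamma> \<gamma>' :: "'a measure" and g h
  have k_eq: "(\<lambda>(x, y). k x y) = (\<lambda>z. k (fst z) (snd z))" by auto
  have kb: "(\<lambda>z. k (fst z) (snd z)) \<in> borel_measurable borel"
    using borel_measurable_continuous_onI[OF k(1)] unfolding k_eq .
  have lim: "(\<lambda>n. \<Sum>p\<in>R n. \<Sum>q\<in>R n. A \<gamma> g n p * A \<gamma>' h n q * k p q) \<longlonglongrightarrow> B \<gamma> g \<gamma>' h"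
    if \<gamma>: "compact_prob K \<gamma>" and \<gamma>': "compact_prob K \<gamma>'" and g: "continuous_on K g" and h: "continuous_on K h"
    for \<gamma> \<gamma>' :: "'a measure" and g h
  proof -
    interpret \<gamma>: compact_prob K \<gamma> by fact
    interpret \<gamma>': compact_prob K \<gamma>' by fact
    interpret P: pair_prob_space \<gamma> \<gamma>' ..
    have sets_P: "sets (\<gamma> \<Otimes>\<^sub>M \<gamma>') = sets borel" by (rule sets_pair_borel[OF \<gamma>.sets_\<mu> \<gamma>'.sets_\<mu>])
    have wg: "w g \<in> borel_measurable borel" and wh: "w h \<in> borel_measurable borel"
      using \<gamma>.measurable_restrict_K[OF g] \<gamma>.measurable_restrict_K[OF h] by (simp_all add: w_def[abs_def])
    have bnd: "\<exists>b\<ge>0. \<forall>x. \<bar>w f x\<bar> \<le> b" if f: "continuous_on K f" for f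
    proof -
      have "bounded (f ` K)" using compact_continuous_image[OF f K] by (rule compact_imp_bounded)
      then obtain b where b: "\<forall>x\<in>K. \<bar>f x\<bar> \<le> b" by (auto simp: bounded_iff)
      have "\<bar>w f x\<bar> \<le> \<bar>b\<bar>" for x
        using b by (auto simp: w_def split: split_indicator intro: order_trans[OF _ abs_ge_self])
      then show ?thesis by (intro exI[of _ "\<bar>b\<bar>"]) simp
    qed
    obtain bg where bg: "0 \<le> bg" "\<And>x. \<bar>w g x\<bar> \<le> bg" using bnd[OF g] by blast
    obtain bh where bh: "0 \<le> bh" "\<And>x. \<bar>w h x\<bar> \<le> bh" using bnd[OF h] by blast
    obtain r where r: "\<forall>x\<in>K. norm x \<le> r" using compact_imp_bounded[OF K] by (auto simp: bounded_iff)
    have "compact ((\<lambda>(x, y). k x y) ` (cball 0 (2 * r) \<times> cball 0 (2 * r)))"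
      by (intro compact_continuous_image continuous_on_subset[OF k(1)] compact_Times compact_cball) simp
    then have "bounded ((\<lambda>(x, y). k x y) ` (cball 0 (2 * r) \<times> cball 0 (2 * r)))" by (rule compact_imp_bounded)
    then obtain bk where bk': "\<forall>z\<in>cball 0 (2 * r) \<times> cball 0 (2 * r). norm (case z of (x, y) \<Rightarrow> k x y) \<le> bk"
      unfolding bounded_iff by blast
    \<comment> \<open>The bound \<open>s_le\<close> keeps the images of \<open>K\<close> under all
      \<open>s n\<close> in one ball, on which \<open>k\<close> is bounded; this yields the
      dominating constant.\<close>
    have bk: "\<bar>k (s n x) (s n y)\<bar> \<le> \<bar>bk\<bar>" if "x \<in> K" "y \<in> K" for n x y
    proof -
      have "norm (s n x) \<le> 2 * r" "norm (s n y) \<le> 2 * r"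
        using s_le[of n x] s_le[of n y] bspec[OF r that(1)] bspec[OF r that(2)] by linarith+
      then show ?thesis using bspec[OF bk', of "(s n x, s n y)"] by simp
    qed
    let ?u = "\<lambda>n z. w g (fst z) * w h (snd z) * k (s n (fst z)) (s n (snd z))"
    have m1: "(\<lambda>z. f (fst z)) \<in> borel_measurable (\<gamma> \<Otimes>\<^sub>M \<gamma>')" "(\<lambda>z. f (snd z)) \<in> borel_measurable (\<gamma> \<Otimes>\<^sub>M \<gamma>')"
      if "f \<in> borel_measurable borel" for f :: "'a \<Rightarrow> 'c::topological_space"
      using measurable_eq_sets[OF sets_P measurable_compose[OF measurable_fst_borel that]]
        measurable_eq_sets[OF sets_P measurable_compose[OF measurable_snd_borel that]] .
    have km: "(\<lambda>z. k (s n (fst z)) (s n (snd z))) \<in> borel_measurable (\<gamma> \<Otimes>\<^sub>M \<gamma>')" for n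
    proof -
      have "(\<lambda>z. (s n (fst z), s n (snd z))) \<in> \<gamma> \<Otimes>\<^sub>M \<gamma>' \<rightarrow>\<^sub>M borel"
        unfolding borel_prod[symmetric] using m1[OF sm[of n]] by measurable
      from measurable_compose[OF this kb] show ?thesis by simp
    qed
    have kP: "(\<lambda>z. k (fst z) (snd z)) \<in> borel_measurable (\<gamma> \<Otimes>\<^sub>M \<gamma>')" by (rule measurable_eq_sets[OF sets_P kb])
    have "(\<lambda>n. \<integral>z. ?u n z \<partial>(\<gamma> \<Otimes>\<^sub>M \<gamma>')) \<longlonglongrightarrow> B \<gamma> g \<gamma>' h"
      unfolding B_def
    proof (rule integral_dominated_convergence[where w = "\<lambda>_. bg * bh * \<bar>bk\<bar>"])
      show "(\<lambda>z. w g (fst z) * w h (snd z) * k (fst z) (snd z)) \<in> borel_measurable (\<gamma> \<Otimes>\<^sub>M \<gamma>')"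
        using m1(1)[OF wg] m1(2)[OF wh] kP by measurable
      show "?u n \<in> borel_measurable (\<gamma> \<Otimes>\<^sub>M \<gamma>')" for n
        using m1(1)[OF wg] m1(2)[OF wh] km[of n] by measurable
      show "AE z in \<gamma> \<Otimes>\<^sub>M \<gamma>'. (\<lambda>n. ?u n z) \<longlonglongrightarrow> w g (fst z) * w h (snd z) * k (fst z) (snd z)"
      proof (rule AE_I2)
        fix z :: "'a \<times> 'a"
        have "(\<lambda>n. (s n (fst z), s n (snd z))) \<longlonglongrightarrow> (fst z, snd z)" by (intro tendsto_Pair s_lim)
        from continuous_on_tendsto_compose[OF k(1) this]
        show "(\<lambda>n. ?u n z) \<longlonglongrightarrow> w g (fst z) * w h (snd z) * k (fst z) (snd z)"
          by (intro tendsto_mult tendsto_const) (simp add: k_eq)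
      qed
      show "AE z in \<gamma> \<Otimes>\<^sub>M \<gamma>'. norm (?u n z) \<le> bg * bh * \<bar>bk\<bar>" for n
      proof (rule AE_I2)
        fix z :: "'a \<times> 'a"
        show "norm (?u n z) \<le> bg * bh * \<bar>bk\<bar>"
        proof (cases "fst z \<in> K \<and> snd z \<in> K")
          case True
          then have "\<bar>w g (fst z)\<bar> * \<bar>w h (snd z)\<bar> * \<bar>k (s n (fst z)) (s n (snd z))\<bar> \<le> bg * bh * \<bar>bk\<bar>"
            using bg bh by (intro mult_mono bk) auto
          then show ?thesis by (simp add: abs_mult)
        next
          case False
          then have "w g (fst z) * w h (snd z) = 0" by (auto simp: w_def)
          then have "?u n z = 0" by simp
          then show ?thesis using bg(1) bh(1) by (simp only: norm_zero) simp
        qed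
      qed
    qed simp
    moreover have "(\<integral>z. ?u n z \<partial>(\<gamma> \<Otimes>\<^sub>M \<gamma>')) = (\<Sum>p\<in>R n. \<Sum>q\<in>R n. A \<gamma> g n p * A \<gamma>' h n q * k p q)" for n
    proof -
      define i where "i p x = indicat_real {p} (s n x)" for p x
      have im: "i p \<in> borel_measurable borel" for p
      proof -
        have "(indicat_real {p}) \<in> borel_measurable (borel :: 'a measure)" by measurable
        from measurable_compose[OF sm this] show ?thesis by (simp add: i_def[abs_def])
      qed
      \<comment> \<open>At each \<open>z\<close> exactly one pair (p, q) of values of
        \<open>s n\<close> contributes, and the terms have separated variables, so Fubini gives
        products of masses.\<close>
      have one: "?u n z = (\<Sum>p\<in>R n. \<Sum>q\<in>R n. (w g (fst z) * i p (fst z)) * (w h (snd z) * i q (snd z)) * k p q)" for z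
      proof -
        have "(\<Sum>q\<in>R n. (w g (fst z) * i p (fst z)) * (w h (snd z) * i q (snd z)) * k p q)
            = (w g (fst z) * i p (fst z)) * w h (snd z) * k p (s n (snd z))" for p
        proof -
          have "(\<Sum>q\<in>R n. (w g (fst z) * i p (fst z)) * (w h (snd z) * i q (snd z)) * k p q)
              = (\<Sum>q\<in>R n. if q = s n (snd z) then (w g (fst z) * i p (fst z)) * w h (snd z) * k p q else 0)"
            by (intro sum.cong) (auto simp: i_def split: split_indicator)
          then show ?thesis using R[of n] by (simp add: R_def)
        qed
        then have "(\<Sum>p\<in>R n. \<Sum>q\<in>R n. (w g (fst z) * i p (fst z)) * (w h (snd z) * i q (snd z)) * k p q)
            = (\<Sum>p\<in>R n. if p = s n (fst z) then w g (fst z) * w h (snd z) * k p (s n (snd z)) else 0)"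
          by (intro sum.cong) (auto simp: i_def split: split_indicator)
        then show ?thesis using R[of n] by (simp add: R_def)
      qed
      have ig: "integrable \<gamma> (\<lambda>x. w g x * i p x)" for p
      proof (rule \<gamma>.integrable_const_bound[where B = bg])
        show "AE x in \<gamma>. norm (w g x * i p x) \<le> bg"
          using bg by (intro AE_I2) (auto simp: i_def split: split_indicator)
        show "(\<lambda>x. w g x * i p x) \<in> borel_measurable \<gamma>"
          using measurable_eq_sets[OF \<gamma>.sets_\<mu> wg] measurable_eq_sets[OF \<gamma>.sets_\<mu> im[of p]] by measurable
      qed
      have ih: "integrable \<gamma>' (\<lambda>x. w h x * i p x)" for p
      proof (rule \<gamma>'.integrable_const_bound[where B = bh])
        show "AE x in \<gamma>'. norm (w h x * i p x) \<le> bh"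
          using bh by (intro AE_I2) (auto simp: i_def split: split_indicator)
        show "(\<lambda>x. w h x * i p x) \<in> borel_measurable \<gamma>'"
          using measurable_eq_sets[OF \<gamma>'.sets_\<mu> wh] measurable_eq_sets[OF \<gamma>'.sets_\<mu> im[of p]] by measurable
      qed
      have ip: "integrable (\<gamma> \<Otimes>\<^sub>M \<gamma>') (\<lambda>z. (w g (fst z) * i p (fst z)) * (w h (snd z) * i q (snd z)))" for p q
      proof (rule P.integrable_const_bound[where B = "bg * bh"])
        have "\<bar>w g x * i p x\<bar> \<le> bg" "\<bar>w h x * i q x\<bar> \<le> bh" for x
          using bg bh by (auto simp: i_def split: split_indicator)
        then show "AE z in \<gamma> \<Otimes>\<^sub>M \<gamma>'. norm ((w g (fst z) * i p (fst z)) * (w h (snd z) * i q (snd z))) \<le> bg * bh"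
          using bg bh unfolding real_norm_def abs_mult[of "_ * _" "_ * _"] by (intro AE_I2 mult_mono) auto
        show "(\<lambda>z. (w g (fst z) * i p (fst z)) * (w h (snd z) * i q (snd z))) \<in> borel_measurable (\<gamma> \<Otimes>\<^sub>M \<gamma>')"
          using m1(1)[OF wg] m1(2)[OF wh] m1(1)[OF im[of p]] m1(2)[OF im[of q]] by measurable
      qed
      have "(\<integral>z. (w g (fst z) * i p (fst z)) * (w h (snd z) * i q (snd z)) \<partial>(\<gamma> \<Otimes>\<^sub>M \<gamma>')) = A \<gamma> g n p * A \<gamma>' h n q" for p q
        using P.integral_fst'[OF ip[of p q]] by (simp add: A_def i_def)
      then show ?thesis unfolding one using ip
        by (simp add: Bochner_Integration.integral_sum)
    qed
    ultimately show ?thesis by simp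
  qed
  have "(\<lambda>n. (\<Sum>p\<in>R n. \<Sum>q\<in>R n. A \<mu> a n p * A \<mu> a n q * k p q)
      - 2 * (\<Sum>p\<in>R n. \<Sum>q\<in>R n. A \<mu> a n p * A \<nu> b n q * k p q)
      + (\<Sum>p\<in>R n. \<Sum>q\<in>R n. A \<nu> b n p * A \<nu> b n q * k p q))
    \<longlonglongrightarrow> B \<mu> a \<mu> a - 2 * B \<mu> a \<nu> b + B \<nu> b \<nu> b" (is "?S \<longlonglongrightarrow> _")
    by (intro tendsto_intros lim \<mu> \<nu> a b)
  moreover have "0 \<le> ?S n" for n
  proof -
    \<comment> \<open>The same \<open>s n\<close> serves both measures, so the difference of their
      masses lives on the one finite set \<open>R n\<close>, and the combination is the quadratic
      form of \<open>k\<close> at \<open>d\<close>.\<close>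
    define d where "d p = A \<mu> a n p - A \<nu> b n p" for p
    have "(\<Sum>p\<in>R n. \<Sum>q\<in>R n. A \<nu> b n p * A \<mu> a n q * k p q) = (\<Sum>p\<in>R n. \<Sum>q\<in>R n. A \<mu> a n p * A \<nu> b n q * k p q)"
      by (subst sum.swap) (simp add: k(2) mult.commute)
    then have "?S n = (\<Sum>p\<in>R n. \<Sum>q\<in>R n. d p * d q * k p q)"
      by (simp add: d_def algebra_simps sum.distrib sum_subtractf)
    also have "0 \<le> \<dots>" using k(3) R[of n] unfolding positive_definite_kernel_def by blast
    finally show ?thesis .
  qed
  ultimately have "0 \<le> B \<mu> a \<mu> a - 2 * B \<mu> a \<nu> b + B \<nu> b \<nu> b"
    by (intro LIMSEQ_le_const) auto
  then show ?thesis by (simp add: B_def w_def)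
qed

section \<open>Gibbs densities: lower bounds by duality and upper bounds by explicit
  couplings\<close>

locale compact_cost2 = \<mu>: compact_cost K \<mu> c M + \<nu>: compact_cost K \<nu> c M
  for K :: "'a::euclidean_space set" and \<mu> \<nu> :: "'a measure" and c M +
  fixes C :: "'a \<times> 'a \<Rightarrow> real" and \<epsilon> :: real
  assumes \<epsilon>: "0 < \<epsilon>" and C_eq: "C z = \<epsilon> * c z"
begin

interpretation P: pair_prob_space \<mu> \<nu> ..

lemma sets_P: "sets (\<mu> \<Otimes>\<^sub>M \<nu>) = sets borel"
  by (rule sets_pair_borel[OF \<mu>.sets_\<mu> \<nu>.sets_\<mu>])

lemma c_borel: "c \<in> borel_measurable borel"
  by (rule borel_measurable_continuous_onI[OF \<mu>.cont_c])

lemma C_nonneg: "0 \<le> C z"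
  using \<epsilon> \<mu>.c_nonneg[of z] by (simp add: C_eq)

lemma couplingD:
  assumes "\<pi> \<in> couplings \<mu> \<nu>"
  shows "prob_space \<pi>" "sets \<pi> = sets borel" "distr \<pi> borel fst = \<mu>" "distr \<pi> borel snd = \<nu>"
    "fst \<in> \<pi> \<rightarrow>\<^sub>M borel" "snd \<in> \<pi> \<rightarrow>\<^sub>M borel" "AE z in \<pi>. fst z \<in> K \<and> snd z \<in> K"
proof -
  show s: "sets \<pi> = sets borel" and "prob_space \<pi>" "distr \<pi> borel fst = \<mu>" "distr \<pi> borel snd = \<nu>"
    using assms by (simp_all add: couplings_def)
  show "fst \<in> \<pi> \<rightarrow>\<^sub>M borel" by (rule measurable_eq_sets[OF s measurable_fst_borel])
  show "snd \<in> \<pi> \<rightarrow>\<^sub>M borel" by (rule measurable_eq_sets[OF s measurable_snd_borel])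
  show "AE z in \<pi>. fst z \<in> K \<and> snd z \<in> K"
    by (rule coupling_AE[OF assms \<mu>.AE_K _ \<nu>.AE_K]) (simp_all add: \<mu>.K_borel)
qed

definition lift :: "('a \<Rightarrow> real) \<Rightarrow> 'a \<Rightarrow> real" where "lift f x = indicat_real K x * f x"

lemma lift_borel: "continuous_on K f \<Longrightarrow> lift f \<in> borel_measurable borel"
  unfolding lift_def[abs_def] by (rule \<mu>.measurable_restrict_K)

lemma coupling_integral:
  assumes \<pi>: "\<pi> \<in> couplings \<mu> \<nu>" and f: "continuous_on K f"
  shows "integrable \<pi> (\<lambda>z. lift f (fst z))" "(\<integral>z. lift f (fst z) \<partial>\<pi>) = \<mu>.integral_K f"
    "integrable \<pi> (\<lambda>z. lift f (snd z))" "(\<integral>z. lift f (snd z) \<partial>\<pi>) = \<nu>.integral_K f"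
proof -
  note D = couplingD[OF \<pi>]
  have "integrable (distr \<pi> borel fst) (lift f)" unfolding D(3) lift_def[abs_def] by (rule \<mu>.integrable_K[OF f])
  then show "integrable \<pi> (\<lambda>z. lift f (fst z))" by (rule integrable_distr[OF D(5)])
  show "(\<integral>z. lift f (fst z) \<partial>\<pi>) = \<mu>.integral_K f"
    using integral_distr[OF D(5) lift_borel[OF f]] unfolding D(3) \<mu>.integral_K_def lift_def by simp
  have "integrable (distr \<pi> borel snd) (lift f)" unfolding D(4) lift_def[abs_def] by (rule \<nu>.integrable_K[OF f])
  then show "integrable \<pi> (\<lambda>z. lift f (snd z))" by (rule integrable_distr[OF D(6)])
  show "(\<integral>z. lift f (snd z) \<partial>\<pi>) = \<nu>.integral_K f"
    using integral_distr[OF D(6) lift_borel[OF f]] unfolding D(4) \<nu>.integral_K_def lift_def by simp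
qed

lemma coupling_cost:
  assumes \<pi>: "\<pi> \<in> couplings \<mu> \<nu>"
  shows "integrable \<pi> c" "enn2ereal (\<integral>\<^sup>+ z. ennreal (C z) \<partial>\<pi>) = ereal (\<epsilon> * (\<integral>z. c z \<partial>\<pi>))"
proof -
  note D = couplingD[OF \<pi>]
  interpret \<pi>: prob_space \<pi> by (rule D(1))
  show i: "integrable \<pi> c"
  proof (rule \<pi>.integrable_const_bound[where B = M])
    show "c \<in> borel_measurable \<pi>" by (rule measurable_eq_sets[OF D(2) c_borel])
    show "AE z in \<pi>. norm (c z) \<le> M"
    proof (rule AE_mp[OF D(7)], rule AE_I2, rule impI)
      fix z assume "fst z \<in> K \<and> snd z \<in> K"
      then show "norm (c z) \<le> M" using \<mu>.c_le[of "fst z" "snd z"] \<mu>.c_nonneg[of z] by simp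
    qed
  qed
  have "(\<integral>\<^sup>+ z. ennreal (C z) \<partial>\<pi>) = ennreal (\<integral>z. C z \<partial>\<pi>)"
    using i C_nonneg by (intro nn_integral_eq_integral) (auto simp: C_eq[abs_def])
  moreover have "(\<integral>z. C z \<partial>\<pi>) = \<epsilon> * (\<integral>z. c z \<partial>\<pi>)" by (simp add: C_eq)
  moreover have "0 \<le> \<epsilon> * (\<integral>z. c z \<partial>\<pi>)" using \<epsilon> \<mu>.c_nonneg by (intro mult_nonneg_nonneg integral_nonneg) auto
  ultimately show "enn2ereal (\<integral>\<^sup>+ z. ennreal (C z) \<partial>\<pi>) = ereal (\<epsilon> * (\<integral>z. c z \<partial>\<pi>))"
    by (simp add: enn2ereal_ennreal)
qed

text \<open>The Gibbs density with potentials \<open>f\<close> and \<open>g\<close> relative to the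
  product measure, cut off outside \<open>K\<close>. The factors are grouped as two weights and a
  kernel, the form that \<open>positive_definite_integral\<close> handles.\<close>

definition gibbs :: "('a \<Rightarrow> real) \<Rightarrow> ('a \<Rightarrow> real) \<Rightarrow> 'a \<times> 'a \<Rightarrow> real" where
  "gibbs f g z = (indicat_real K (fst z) * exp (f (fst z))) * (indicat_real K (snd z) * exp (g (snd z))) * exp (- c z)"

lemma gibbs_nonneg: "0 \<le> gibbs f g z"
  by (simp add: gibbs_def)

lemma gibbs_borel:
  assumes "continuous_on K f" "continuous_on K g"
  shows "gibbs f g \<in> borel_measurable borel"
proof -
  have "(\<lambda>x. indicat_real K x * exp (h x)) \<in> borel_measurable borel" if "continuous_on K h" for h
    by (intro \<mu>.measurable_restrict_K continuous_intros that)
  from measurable_compose[OF measurable_fst_borel this[OF assms(1)]] measurable_compose[OF measurable_snd_borel this[OF assms(2)]]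
  show ?thesis unfolding gibbs_def[abs_def] using c_borel by measurable
qed

lemma gibbs_integrable:
  assumes f: "continuous_on K f" and g: "continuous_on K g"
  shows "integrable (\<mu> \<Otimes>\<^sub>M \<nu>) (gibbs f g)"
proof -
  have b: "\<exists>b. \<forall>x\<in>K. h x \<le> b" if "continuous_on K h" for h :: "'a \<Rightarrow> real"
    using compact_continuous_image[OF that \<mu>.compact_K, THEN compact_imp_bounded] by (auto simp: bounded_iff abs_le_iff)
  obtain u v where u: "\<forall>x\<in>K. f x \<le> u" and v: "\<forall>x\<in>K. g x \<le> v" using b[OF f] b[OF g] by blast
  have "norm (gibbs f g z) \<le> exp u * exp v * 1" for z
  proof -
    have "norm (gibbs f g z) = gibbs f g z" using gibbs_nonneg by simp
    also have "\<dots> \<le> exp u * exp v * 1"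
      unfolding gibbs_def using u v \<mu>.c_nonneg[of z]
      by (intro mult_mono) (auto split: split_indicator)
    finally show ?thesis .
  qed
  then show ?thesis
    by (intro P.integrable_const_bound[where B = "exp u * exp v * 1"] AE_I2 measurable_eq_sets[OF sets_P gibbs_borel[OF f g]])
qed

text \<open>Integrating \<open>ln r \<ge> h + 1 - exp h / r\<close> for the density \<open>r\<close> of the coupling.\<close>

lemma weak_duality:
  assumes f: "continuous_on K f" and g: "continuous_on K g"
  shows "ereal (\<epsilon> * (\<mu>.integral_K f + \<nu>.integral_K g + 1 - (\<integral>z. gibbs f g z \<partial>(\<mu> \<Otimes>\<^sub>M \<nu>)))) \<le> transport_inf C \<epsilon> \<mu> \<nu>"
  unfolding transport_inf_def
proof (rule INF_greatest)
  fix \<pi> assume \<pi>: "\<pi> \<in> couplings \<mu> \<nu>"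
  note D = couplingD[OF \<pi>] and I = coupling_integral[OF \<pi>]
  interpret \<pi>: prob_space \<pi> by (rule D(1))
  let ?m = "\<mu> \<Otimes>\<^sub>M \<nu>"
  show "ereal (\<epsilon> * (\<mu>.integral_K f + \<nu>.integral_K g + 1 - (\<integral>z. gibbs f g z \<partial>?m))) \<le> transport_value C \<epsilon> \<mu> \<nu> \<pi>"
  proof (cases "KL \<pi> ?m = \<infinity>")
    case True
    then show ?thesis using \<epsilon> by (simp add: transport_value_def coupling_cost(2)[OF \<pi>])
  next
    case False
    then have ac: "absolutely_continuous ?m \<pi>" by (auto simp: KL_def split: if_splits)
    define \<rho> where "\<rho> = RN_deriv ?m \<pi>"
    have \<rho>m [measurable]: "\<rho> \<in> borel_measurable ?m" by (simp add: \<rho>_def)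
    have dens: "density ?m \<rho> = \<pi>"
      unfolding \<rho>_def by (rule P.P.density_RN_deriv[OF ac]) (simp add: D(2) sets_P)
    define l where "l z = ln (enn2real (\<rho> z))" for z
    have sf: "sigma_finite_measure ?m" by unfold_locales
    have li: "integrable \<pi> l" and KL: "KL \<pi> ?m = ereal (\<integral>z. l z \<partial>\<pi>)"
      using KL_density_eq[OF sf \<rho>m] False unfolding dens l_def by (auto split: if_splits)
    define r where "r z = enn2real (\<rho> z)" for z
    have fin: "AE z in ?m. \<rho> z \<noteq> \<infinity>"
      by (rule P.P.RN_deriv_finite[of \<pi>, folded \<rho>_def]) (use \<pi>.sigma_finite_measure_axioms ac D(2) sets_P in auto)
    have rm: "r \<in> borel_measurable ?m" unfolding r_def[abs_def] by measurable
    have r0: "0 \<le> r z" for z by (simp add: r_def)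
    have dens_r: "density ?m (\<lambda>z. ennreal (r z)) = \<pi>"
    proof -
      have "density ?m (\<lambda>z. ennreal (r z)) = density ?m \<rho>"
        using fin rm by (intro density_cong) (auto simp: r_def less_top elim!: AE_mp)
      then show ?thesis using dens by simp
    qed
    \<comment> \<open>\<open>\<pi>\<close> gives no mass to the zero set of its own density, so
      logarithm and quotient are meaningful where they are integrated.\<close>
    have pos: "AE z in \<pi>. 0 < r z"
      unfolding dens_r[symmetric] using rm by (subst AE_density) auto
    let ?h = "\<lambda>z. lift f (fst z) + lift g (snd z) - c z"
    let ?q = "\<lambda>z. gibbs f g z / r z"
    \<comment> \<open>In general only an inequality: where \<open>r z = 0\<close> the quotient is 0,
      while the Gibbs density may be positive.\<close>
    have q_int: "integrable \<pi> ?q" and q_le: "(\<integral>z. ?q z \<partial>\<pi>) \<le> (\<integral>z. gibbs f g z \<partial>?m)"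
    proof -
      have gm: "gibbs f g \<in> borel_measurable ?m" by (rule measurable_eq_sets[OF sets_P gibbs_borel[OF f g]])
      have qm: "?q \<in> borel_measurable ?m" using gm rm by measurable
      have i: "integrable ?m (\<lambda>z. r z *\<^sub>R ?q z)"
      proof (rule Bochner_Integration.integrable_bound[OF gibbs_integrable[OF f g]])
        show "(\<lambda>z. r z *\<^sub>R ?q z) \<in> borel_measurable ?m" using qm rm by measurable
        show "AE z in ?m. norm (r z *\<^sub>R ?q z) \<le> norm (gibbs f g z)" by (intro AE_I2) auto
      qed
      show "integrable \<pi> ?q"
        unfolding dens_r[symmetric] using integrable_density[OF qm rm] r0 i by simp
      have "(\<integral>z. ?q z \<partial>\<pi>) = (\<integral>z. r z *\<^sub>R ?q z \<partial>?m)"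
        unfolding dens_r[symmetric] by (rule integral_density[OF qm rm]) (use r0 in auto)
      also have "\<dots> \<le> (\<integral>z. gibbs f g z \<partial>?m)"
        using gibbs_nonneg by (intro integral_mono i gibbs_integrable[OF f g]) auto
      finally show "(\<integral>z. ?q z \<partial>\<pi>) \<le> (\<integral>z. gibbs f g z \<partial>?m)" .
    qed
    have "AE z in \<pi>. ?h z + 1 - ?q z \<le> l z"
    proof (rule AE_mp[OF pos], rule AE_mp[OF D(7)], rule AE_I2, rule impI, rule impI)
      fix z assume z: "fst z \<in> K \<and> snd z \<in> K" and rp: "0 < r z"
      have "gibbs f g z = exp (?h z)" using z by (simp add: gibbs_def lift_def exp_add exp_diff exp_minus divide_inverse)
      then have "exp (?h z - l z) = ?q z" using rp by (simp add: l_def r_def[symmetric] exp_diff)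
      then show "?h z + 1 - ?q z \<le> l z" using exp_ge_add_one_self[of "?h z - l z"] by linarith
    qed
    then have "(\<integral>z. ?h z + 1 - ?q z \<partial>\<pi>) \<le> (\<integral>z. l z \<partial>\<pi>)"
      using I(1)[OF f] I(3)[OF g] coupling_cost(1)[OF \<pi>] q_int li by (intro integral_mono_AE) auto
    moreover have "(\<integral>z. ?h z + 1 - ?q z \<partial>\<pi>) = \<mu>.integral_K f + \<nu>.integral_K g - (\<integral>z. c z \<partial>\<pi>) + 1 - (\<integral>z. ?q z \<partial>\<pi>)"
      using I(1,2)[OF f] I(3,4)[OF g] coupling_cost(1)[OF \<pi>] q_int by (simp add: \<pi>.prob_space)
    ultimately have "\<mu>.integral_K f + \<nu>.integral_K g + 1 - (\<integral>z. gibbs f g z \<partial>?m) \<le> (\<integral>z. c z \<partial>\<pi>) + (\<integral>z. l z \<partial>\<pi>)"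
      using q_le by linarith
    then have "\<epsilon> * (\<mu>.integral_K f + \<nu>.integral_K g + 1 - (\<integral>z. gibbs f g z \<partial>?m)) \<le> \<epsilon> * ((\<integral>z. c z \<partial>\<pi>) + (\<integral>z. l z \<partial>\<pi>))"
      using \<epsilon> by (intro mult_left_mono) auto
    then show ?thesis by (simp add: transport_value_def coupling_cost(2)[OF \<pi>] KL distrib_left)
  qed
qed

text \<open>The parameter \<open>b\<close> covers two explicit couplings: \<open>b = 0\<close> with
  density 1 is the product measure and gives finiteness, \<open>b = 1\<close> is a Gibbs density,
  for which the cost cancels against the entropy.\<close>

lemma transport_inf_le:
  assumes \<rho>: "\<rho> \<in> borel_measurable borel" "\<And>z. 0 \<le> \<rho> z"
    and 1: "AE x in \<mu>. (\<integral>\<^sup>+y. ennreal (\<rho> (x, y)) \<partial>\<nu>) = 1" "AE y in \<nu>. (\<integral>\<^sup>+x. ennreal (\<rho> (x, y)) \<partial>\<mu>) = 1"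
    and f: "continuous_on K f" and g: "continuous_on K g"
    and ln: "\<And>x y. x \<in> K \<Longrightarrow> y \<in> K \<Longrightarrow> ln (\<rho> (x, y)) = f x + g y - b * c (x, y)"
  shows "\<exists>\<pi>\<in>couplings \<mu> \<nu>. transport_inf C \<epsilon> \<mu> \<nu> \<le> ereal (\<epsilon> * (\<mu>.integral_K f + \<nu>.integral_K g + (1 - b) * (\<integral>z. c z \<partial>\<pi>)))"
proof -
  let ?m = "\<mu> \<Otimes>\<^sub>M \<nu>"
  let ?r = "\<lambda>z. ennreal (\<rho> z)"
  have rm: "?r \<in> borel_measurable ?m" using measurable_eq_sets[OF sets_P \<rho>(1)] by measurable
  define \<pi> where "\<pi> = density ?m ?r"
  have \<pi>: "\<pi> \<in> couplings \<mu> \<nu>"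
    unfolding \<pi>_def coupling_density_iff[OF \<mu>.prob \<mu>.sets_\<mu> \<nu>.prob \<nu>.sets_\<mu> rm] using 1 by simp
  note D = couplingD[OF \<pi>] and I = coupling_integral[OF \<pi>]
  have sf: "sigma_finite_measure ?m" by unfold_locales
  let ?h = "\<lambda>z. lift f (fst z) + lift g (snd z) - b * c z"
  have hi: "integrable \<pi> ?h"
    using I(1)[OF f] I(3)[OF g] coupling_cost(1)[OF \<pi>] by simp
  have lm: "(\<lambda>z. ln (enn2real (?r z))) \<in> borel_measurable \<pi>"
    using measurable_eq_sets[OF D(2) \<rho>(1)] by measurable
  have ae: "AE z in \<pi>. ln (enn2real (?r z)) = ?h z"
  proof (rule AE_mp[OF D(7)], rule AE_I2, rule impI)
    fix z assume z: "fst z \<in> K \<and> snd z \<in> K"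
    then show "ln (enn2real (?r z)) = ?h z" using ln[of "fst z" "snd z"] \<rho>(2)[of z] by (simp add: lift_def)
  qed
  have "KL \<pi> ?m = ereal (\<integral>z. ?h z \<partial>\<pi>)"
    using KL_density_eq[OF sf rm] integrable_cong_AE[OF lm borel_measurable_integrable[OF hi] ae]
      integral_cong_AE[OF lm borel_measurable_integrable[OF hi] ae] hi
    by (simp add: \<pi>_def)
  moreover have "(\<integral>z. ?h z \<partial>\<pi>) = \<mu>.integral_K f + \<nu>.integral_K g - b * (\<integral>z. c z \<partial>\<pi>)"
    using I(1,2)[OF f] I(3,4)[OF g] coupling_cost(1)[OF \<pi>] by simp
  ultimately have "transport_value C \<epsilon> \<mu> \<nu> \<pi> = ereal (\<epsilon> * (\<mu>.integral_K f + \<nu>.integral_K g + (1 - b) * (\<integral>z. c z \<partial>\<pi>)))"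
    by (simp add: transport_value_def coupling_cost(2)[OF \<pi>] algebra_simps)
  moreover have "transport_inf C \<epsilon> \<mu> \<nu> \<le> transport_value C \<epsilon> \<mu> \<nu> \<pi>"
    unfolding transport_inf_def by (rule INF_lower[OF \<pi>])
  ultimately show ?thesis using \<pi> by auto
qed

lemma transport_inf_finite: "transport_inf C \<epsilon> \<mu> \<nu> \<noteq> \<infinity>"
proof -
  have "\<exists>\<pi>\<in>couplings \<mu> \<nu>. transport_inf C \<epsilon> \<mu> \<nu> \<le> ereal (\<epsilon> * (\<mu>.integral_K (\<lambda>_. 0) + \<nu>.integral_K (\<lambda>_. 0) + (1 - 0) * (\<integral>z. c z \<partial>\<pi>)))"
    by (rule transport_inf_le[of "\<lambda>_. 1"]) (simp_all add: \<mu>.emeasure_space_1 \<nu>.emeasure_space_1)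
  then show ?thesis by auto
qed

lemma entropic_OT_ge:
  assumes "continuous_on K f" "continuous_on K g"
  shows "\<epsilon> * (\<mu>.integral_K f + \<nu>.integral_K g + 1 - (\<integral>z. gibbs f g z \<partial>(\<mu> \<Otimes>\<^sub>M \<nu>))) \<le> entropic_OT C \<epsilon> \<mu> \<nu>"
  using weak_duality[OF assms] transport_inf_finite
  unfolding entropic_OT_eq by (cases "transport_inf C \<epsilon> \<mu> \<nu>") auto

text \<open>The section integral at \<open>x\<close> in \<open>K\<close> factors as
  \<open>exp (f x) * \<nu>.Z g x\<close>, so the hypothesis on \<open>f\<close> and \<open>g\<close>
  is one of the two Schrodinger equations. Applied to a single measure and its symmetric potential,
  it makes the diagonal Gibbs integrals equal to 1.\<close>

lemma gibbs_integral_eq_1: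
  assumes f: "continuous_on K f" and g: "continuous_on K g" and gf: "\<And>x. x \<in> K \<Longrightarrow> exp (f x) * \<nu>.Z g x = 1"
  shows "(\<integral>y. gibbs f g (x, y) \<partial>\<nu>) = indicat_real K x" and "(\<integral>z. gibbs f g z \<partial>(\<mu> \<Otimes>\<^sub>M \<nu>)) = 1"
proof -
  show 1: "(\<integral>y. gibbs f g (x, y) \<partial>\<nu>) = indicat_real K x" for x
  proof -
    have "(\<integral>y. gibbs f g (x, y) \<partial>\<nu>) = (\<integral>y. (indicat_real K x * exp (f x)) * (indicat_real K y * exp (g y - c (x, y))) \<partial>\<nu>)"
      by (intro Bochner_Integration.integral_cong) (auto simp: gibbs_def exp_diff exp_minus divide_inverse)
    also have "\<dots> = indicat_real K x * (exp (f x) * \<nu>.Z g x)" by (simp add: \<nu>.Z_def \<nu>.integral_K_def)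
    finally show ?thesis using gf[of x] by (auto split: split_indicator)
  qed
  have "(\<integral>z. gibbs f g z \<partial>(\<mu> \<Otimes>\<^sub>M \<nu>)) = (\<integral>x. indicat_real K x * 1 \<partial>\<mu>)"
    using P.integral_fst'[OF gibbs_integrable[OF f g]] 1 by simp
  also have "\<dots> = 1" using \<mu>.integral_K_const[of 1] by (simp only: \<mu>.integral_K_def)
  finally show "(\<integral>z. gibbs f g z \<partial>(\<mu> \<Otimes>\<^sub>M \<nu>)) = 1" .
qed

end

text \<open>For a symmetric cost the Gibbs density of \<open>f\<close> with itself is symmetric, so
  a single Schrodinger equation gives both marginals. Its transport value is \<epsilon> times twice
  the integral of the potential.\<close>

lemma entropic_OT_self_le:
  assumes "compact_cost2 K \<mu> \<mu> c M C \<epsilon>" and sym: "\<And>x y. c (x, y) = c (y, x)"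
    and f: "continuous_on K f" and eq: "\<And>x. x \<in> K \<Longrightarrow> exp (f x) * compact_cost.Z K \<mu> c f x = 1"
  shows "entropic_OT C \<epsilon> \<mu> \<mu> \<le> 2 * \<epsilon> * compact_prob.integral_K K \<mu> f"
proof -
  interpret compact_cost2 K \<mu> \<mu> c M C \<epsilon> by fact
  note one = gibbs_integral_eq_1(1)[OF f f eq]
  have gsym: "gibbs f f (x, y) = gibbs f f (y, x)" for x y by (simp add: gibbs_def sym[of x y])
  have nn: "AE x in \<mu>. (\<integral>\<^sup>+y. ennreal (gibbs f f (x, y)) \<partial>\<mu>) = 1"
  proof (rule AE_mp[OF \<mu>.AE_K], rule AE_I2, rule impI)
    fix x assume x: "x \<in> K"
    \<comment> \<open>A Bochner integral with nonzero value certifies integrability, as the default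
      value for non-integrable functions is 0.\<close>
    have "integrable \<mu> (\<lambda>y. gibbs f f (x, y))"
    proof (rule ccontr)
      assume "\<not> integrable \<mu> (\<lambda>y. gibbs f f (x, y))"
      then have "(\<integral>y. gibbs f f (x, y) \<partial>\<mu>) = 0" by (rule not_integrable_integral_eq)
      then show False using one[of x] x by simp
    qed
    then have "(\<integral>\<^sup>+y. ennreal (gibbs f f (x, y)) \<partial>\<mu>) = ennreal (\<integral>y. gibbs f f (x, y) \<partial>\<mu>)"
      by (intro nn_integral_eq_integral) (auto simp: gibbs_nonneg)
    then show "(\<integral>\<^sup>+y. ennreal (gibbs f f (x, y)) \<partial>\<mu>) = 1" using one[of x] x by simp
  qed
  have "\<exists>\<pi>\<in>couplings \<mu> \<mu>. transport_inf C \<epsilon> \<mu> \<mu> \<le> ereal (\<epsilon> * (\<mu>.integral_K f + \<mu>.integral_K f + (1 - 1) * (\<integral>z. c z \<partial>\<pi>)))"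
  proof (rule transport_inf_le[OF gibbs_borel[OF f f] gibbs_nonneg nn _ f f])
    show "AE y in \<mu>. (\<integral>\<^sup>+x. ennreal (gibbs f f (x, y)) \<partial>\<mu>) = 1" using nn by (simp add: gsym)
    show "ln (gibbs f f (x, y)) = f x + f y - 1 * c (x, y)" if "x \<in> K" "y \<in> K" for x y
      using that by (simp add: gibbs_def ln_mult)
  qed
  then have "transport_inf C \<epsilon> \<mu> \<mu> \<le> ereal (2 * \<epsilon> * \<mu>.integral_K f)" by (auto simp: algebra_simps)
  moreover have "transport_inf C \<epsilon> \<mu> \<mu> \<noteq> - \<infinity>" using weak_duality[OF f f] by auto
  ultimately show ?thesis
    unfolding entropic_OT_eq by (cases "transport_inf C \<epsilon> \<mu> \<mu>") auto
qed

text \<open>The three Gibbs integrals are values of one bilinear form, with weights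
  \<open>exp (f x)\<close> on \<mu> and \<open>exp (g x)\<close> on \<nu>. Positive definiteness
  bounds the mixed value by the mean of the diagonal ones, which are 1, so the dual value for \<mu>,
  \<nu> is at least half the sum of the two upper bounds for the self-transport terms.\<close>

lemma sinkhorn_divergence_nonneg:
  fixes C :: "'a::euclidean_space \<times> 'a \<Rightarrow> real"
  assumes \<mu>: "compact_prob K \<mu>" and \<nu>: "compact_prob K \<nu>" and \<epsilon>: "0 < \<epsilon>"
    and C: "continuous_on UNIV C" "\<And>z. 0 \<le> C z"
    and k: "positive_universal_kernel (\<lambda>x y. exp (- C (x, y) / \<epsilon>))"
  shows "0 \<le> sinkhorn_divergence C \<epsilon> \<mu> \<nu>"
proof -
  define c where "c z = C z / \<epsilon>" for z
  have cont_c: "continuous_on UNIV c" unfolding c_def[abs_def] using \<epsilon> by (intro continuous_intros C(1)) simp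
  have K: "compact K" using \<mu> by (simp add: compact_prob_def)
  have "compact (c ` (K \<times> K))"
    by (intro compact_continuous_image continuous_on_subset[OF cont_c] compact_Times K) simp
  then have "bounded (c ` (K \<times> K))" by (rule compact_imp_bounded)
  then obtain M where M: "\<forall>z\<in>K \<times> K. norm (c z) \<le> M" by (auto simp: bounded_iff)
  have cc: "compact_cost K \<gamma> c M" if "compact_prob K \<gamma>" for \<gamma>
  proof -
    interpret compact_prob K \<gamma> by fact
    show ?thesis
    proof
      show "continuous_on UNIV c" by (rule cont_c)
      show "0 \<le> c z" for z using C(2)[of z] \<epsilon> by (simp add: c_def)
      show "c (x, y) \<le> M" if "x \<in> K" "y \<in> K" for x y using bspec[OF M, of "(x, y)"] that by simp
    qed
  qed
  have cc2: "compact_cost2 K \<gamma> \<gamma>' c M C \<epsilon>" if "compact_prob K \<gamma>" "compact_prob K \<gamma>'" for \<gamma> \<gamma>'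
    using cc[OF that(1)] cc[OF that(2)] \<epsilon> by (simp add: compact_cost2_def compact_cost2_axioms_def c_def)
  interpret mn: compact_cost2 K \<mu> \<nu> c M C \<epsilon> by (rule cc2[OF \<mu> \<nu>])
  interpret mm: compact_cost2 K \<mu> \<mu> c M C \<epsilon> by (rule cc2[OF \<mu> \<mu>])
  interpret nn: compact_cost2 K \<nu> \<nu> c M C \<epsilon> by (rule cc2[OF \<nu> \<nu>])
  \<comment> \<open>Symmetry of the cost comes from that of the kernel, \<open>exp\<close> being
    injective.\<close>
  have sym: "c (x, y) = c (y, x)" for x y
    using k \<epsilon> unfolding positive_universal_kernel_def c_def by (simp add: divide_eq_eq)
  obtain f where f: "continuous_on K f" and fe: "\<And>x. x \<in> K \<Longrightarrow> exp (f x) * mn.\<mu>.Z f x = 1"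
    using mn.\<mu>.potential_exists by blast
  obtain g where g: "continuous_on K g" and ge: "\<And>x. x \<in> K \<Longrightarrow> exp (g x) * mn.\<nu>.Z g x = 1"
    using mn.\<nu>.potential_exists by blast
  have kk: "exp (- C (x, y) / \<epsilon>) = exp (- c (x, y))" for x y by (simp add: c_def)
  have ce: "continuous_on K (\<lambda>x. exp (f x))" "continuous_on K (\<lambda>x. exp (g x))"
    by (intro continuous_intros f g)+
  have "2 * (\<integral>z. mn.gibbs f g z \<partial>(\<mu> \<Otimes>\<^sub>M \<nu>)) \<le> (\<integral>z. mm.gibbs f f z \<partial>(\<mu> \<Otimes>\<^sub>M \<mu>)) + (\<integral>z. nn.gibbs g g z \<partial>(\<nu> \<Otimes>\<^sub>M \<nu>))"
    using positive_definite_integral[OF _ _ _ \<mu> \<nu> ce, of "\<lambda>x y. exp (- C (x, y) / \<epsilon>)"] k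
    unfolding positive_universal_kernel_def mn.gibbs_def mm.gibbs_def nn.gibbs_def kk by simp
  then have "(\<integral>z. mn.gibbs f g z \<partial>(\<mu> \<Otimes>\<^sub>M \<nu>)) \<le> 1"
    using mm.gibbs_integral_eq_1(2)[OF f f fe] nn.gibbs_integral_eq_1(2)[OF g g ge] by simp
  then have "\<epsilon> * (mn.\<mu>.integral_K f + mn.\<nu>.integral_K g) \<le> \<epsilon> * (mn.\<mu>.integral_K f + mn.\<nu>.integral_K g + 1 - (\<integral>z. mn.gibbs f g z \<partial>(\<mu> \<Otimes>\<^sub>M \<nu>)))"
    using \<epsilon> by (intro mult_left_mono) auto
  also have "\<dots> \<le> entropic_OT C \<epsilon> \<mu> \<nu>" by (rule mn.entropic_OT_ge[OF f g])
  finally have "\<epsilon> * (mn.\<mu>.integral_K f + mn.\<nu>.integral_K g) \<le> entropic_OT C \<epsilon> \<mu> \<nu>" .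
  moreover have "entropic_OT C \<epsilon> \<mu> \<mu> \<le> 2 * \<epsilon> * mn.\<mu>.integral_K f"
    by (rule entropic_OT_self_le[OF cc2[OF \<mu> \<mu>] sym f fe])
  moreover have "entropic_OT C \<epsilon> \<nu> \<nu> \<le> 2 * \<epsilon> * mn.\<nu>.integral_K g"
    by (rule entropic_OT_self_le[OF cc2[OF \<nu> \<nu>] sym g ge])
  ultimately show ?thesis by (simp add: sinkhorn_divergence_def algebra_simps)
qed

section \<open>Weak continuity and existence of minimizers\<close>

lemma uniform_limit_prod:
  fixes f :: "nat \<Rightarrow> 'a \<Rightarrow> 'c::metric_space" and g :: "nat \<Rightarrow> 'b \<Rightarrow> 'd::metric_space"
  assumes f: "uniform_limit X f l F" and g: "uniform_limit Y g m F"
  shows "uniform_limit (X \<times> Y) (\<lambda>n. map_prod (f n) (g n)) (map_prod l m) F"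
proof (rule uniform_limitI)
  fix e :: real assume e: "0 < e"
  have "\<forall>\<^sub>F n in F. (\<forall>x\<in>X. dist (f n x) (l x) < e / 2) \<and> (\<forall>y\<in>Y. dist (g n y) (m y) < e / 2)"
    using uniform_limitD[OF f, of "e / 2"] uniform_limitD[OF g, of "e / 2"] e by (simp add: eventually_conj)
  then show "\<forall>\<^sub>F n in F. \<forall>z\<in>X \<times> Y. dist (map_prod (f n) (g n) z) (map_prod l m z) < e"
  proof (rule eventually_mono, intro ballI)
    fix n z
    assume *: "(\<forall>x\<in>X. dist (f n x) (l x) < e / 2) \<and> (\<forall>y\<in>Y. dist (g n y) (m y) < e / 2)" and z: "z \<in> X \<times> Y"
    have "dist (map_prod (f n) (g n) z) (map_prod l m z)
        \<le> dist (f n (fst z)) (l (fst z)) + dist (g n (snd z)) (m (snd z))"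
      by (simp add: map_prod_def case_prod_beta dist_Pair_Pair sqrt_sum_squares_le_sum)
    also have "\<dots> < e" using * z by (auto dest!: bspec)
    finally show "dist (map_prod (f n) (g n) z) (map_prod l m z) < e" .
  qed
qed

lemma prob_measure_onD:
  assumes "prob_measure_on X \<mu>" "compact X"
  shows "prob_space \<mu>" "sets \<mu> = sets borel" "AE x in \<mu>. x \<in> X" "X \<in> sets borel"
proof -
  show p: "prob_space \<mu>" and s: "sets \<mu> = sets borel" using assms by (simp_all add: prob_measure_on_def)
  show b: "X \<in> sets borel" using assms(2) by (simp add: borel_closed compact_imp_closed)
  interpret prob_space \<mu> by fact
  have "prob X = 1" using assms(1) by (simp add: prob_measure_on_def measure_def)
  then show "AE x in \<mu>. x \<in> X" using b s by (subst AE_in_set_eq_1) auto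
qed

text \<open>After the change of variables the marginals \<alpha>, \<beta> stay fixed and only the
  cost varies, converging uniformly on \<open>X \<times> X\<close>. Two sequences of maps are
  allowed because the divergence contains both the mixed term, where one map is the identity, and
  the self term, where the maps coincide.\<close>

lemma tendsto_entropic_OT_distr:
  fixes C :: "'a::euclidean_space \<times> 'a \<Rightarrow> real" and f g :: "nat \<Rightarrow> 'a \<Rightarrow> 'a"
  assumes X: "compact X" and \<alpha>: "prob_measure_on X \<alpha>" and \<beta>: "prob_measure_on X \<beta>"
    and C: "continuous_on UNIV C" "\<And>z. 0 \<le> C z" and \<epsilon>: "0 < \<epsilon>"
    and f: "\<And>n. continuous_on UNIV (f n)" "\<And>n. inj (f n)" "continuous_on UNIV l" "inj l" "uniform_limit X f l sequentially"
    and g: "\<And>n. continuous_on UNIV (g n)" "\<And>n. inj (g n)" "continuous_on UNIV m" "inj m" "uniform_limit X g m sequentially"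
  shows "(\<lambda>n. entropic_OT C \<epsilon> (distr \<alpha> borel (f n)) (distr \<beta> borel (g n)))
    \<longlonglongrightarrow> entropic_OT C \<epsilon> (distr \<alpha> borel l) (distr \<beta> borel m)"
proof -
  note A = prob_measure_onD[OF \<alpha> X] and B = prob_measure_onD[OF \<beta> X]
  have Cb: "C \<in> borel_measurable borel" by (rule borel_measurable_continuous_onI[OF C(1)])
  have eq: "entropic_OT C \<epsilon> (distr \<alpha> borel h) (distr \<beta> borel h') = entropic_OT (C \<circ> map_prod h h') \<epsilon> \<alpha> \<beta>"
    if h: "continuous_on UNIV h" "inj h" "continuous_on UNIV h'" "inj h'" for h h' :: "'a \<Rightarrow> 'a"
  proof -
    obtain i where i: "i \<in> borel_measurable borel" "\<forall>x\<in>X. i (h x) = x"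
      using continuous_injective_borel_inverse[OF X continuous_on_subset[OF h(1)] inj_on_subset[OF h(2)]] by auto
    obtain i' where i': "i' \<in> borel_measurable borel" "\<forall>x\<in>X. i' (h' x) = x"
      using continuous_injective_borel_inverse[OF X continuous_on_subset[OF h(3)] inj_on_subset[OF h(4)]] by auto
    have "AE x in \<alpha>. i (h x) = x" by (rule AE_mp[OF A(3)]) (use i(2) in \<open>auto intro!: AE_I2\<close>)
    moreover have "AE x in \<beta>. i' (h' x) = x" by (rule AE_mp[OF B(3)]) (use i'(2) in \<open>auto intro!: AE_I2\<close>)
    ultimately show ?thesis
      by (rule entropic_OT_distr[OF A(1,2) B(1,2) borel_measurable_continuous_onI[OF h(1)] i(1) _
            borel_measurable_continuous_onI[OF h(3)] i'(1) _ Cb C(2) \<epsilon>])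
  qed
  have Ccomp: "C \<circ> map_prod h h' \<in> borel_measurable borel" if "continuous_on UNIV h" "continuous_on UNIV h'" for h h' :: "'a \<Rightarrow> 'a"
  proof -
    have "continuous_on UNIV (map_prod h h')"
      unfolding map_prod_def case_prod_beta
      by (intro continuous_intros continuous_on_compose2[OF that(1)] continuous_on_compose2[OF that(2)]) auto
    then show ?thesis
      by (intro borel_measurable_continuous_onI continuous_on_compose continuous_on_subset[OF C(1)]) auto
  qed
  have "bounded (l ` X)" "bounded (m ` X)"
    using f(3) g(3) X by (auto intro!: compact_imp_bounded compact_continuous_image intro: continuous_on_subset)
  then obtain r r' where r: "\<forall>x\<in>X. norm (l x) \<le> r" "\<forall>x\<in>X. norm (m x) \<le> r'" by (auto simp: bounded_iff)
  \<comment> \<open>Eventually the maps are within 1 of their limits on \<open>X\<close>, so one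
    compact set contains all relevant images and \<open>C\<close> is uniformly continuous on
    it.\<close>
  define S where "S = cball (0::'a) (r + 1) \<times> cball (0::'a) (r' + 1)"
  have cS: "compact S" by (simp add: S_def compact_Times)
  have "uniform_limit (X \<times> X) (\<lambda>n z. C (map_prod (f n) (g n) z)) (\<lambda>z. C (map_prod l m z)) sequentially"
  proof (rule uniform_limit_compose_uniformly_continuous_on[OF uniform_limit_prod[OF f(5) g(5)]])
    show "uniformly_continuous_on S C"
      by (intro compact_uniformly_continuous continuous_on_subset[OF C(1)] cS) simp
    show "closed S" by (rule compact_imp_closed[OF cS])
    have "\<forall>\<^sub>F n in sequentially. (\<forall>x\<in>X. dist (f n x) (l x) < 1) \<and> (\<forall>x\<in>X. dist (g n x) (m x) < 1)"
      using uniform_limitD[OF f(5), of 1] uniform_limitD[OF g(5), of 1] by (simp add: eventually_conj)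
    then show "\<forall>\<^sub>F n in sequentially. \<forall>z\<in>X \<times> X. map_prod (f n) (g n) z \<in> S"
    proof (rule eventually_mono, intro ballI)
      fix n z assume *: "(\<forall>x\<in>X. dist (f n x) (l x) < 1) \<and> (\<forall>x\<in>X. dist (g n x) (m x) < 1)" and z: "z \<in> X \<times> X"
      then have d: "dist (f n (fst z)) (l (fst z)) < 1" "dist (g n (snd z)) (m (snd z)) < 1" by auto
      have "norm (f n (fst z)) \<le> r + 1" "norm (g n (snd z)) \<le> r' + 1"
        using d z r norm_triangle_sub[of "f n (fst z)" "l (fst z)"] norm_triangle_sub[of "g n (snd z)" "m (snd z)"]
        unfolding dist_norm by (fastforce dest!: bspec)+
      then show "map_prod (f n) (g n) z \<in> S" by (simp add: S_def map_prod_def case_prod_beta)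
    qed
  qed
  note ul = this
  show ?thesis
  proof (rule tendstoI)
    fix e :: real assume e: "0 < e"
    have "\<forall>\<^sub>F n in sequentially. \<forall>z\<in>X \<times> X. dist (C (map_prod (f n) (g n) z)) (C (map_prod l m z)) < e / 2"
      using uniform_limitD[OF ul, of "e / 2"] e by simp
    then show "\<forall>\<^sub>F n in sequentially. dist (entropic_OT C \<epsilon> (distr \<alpha> borel (f n)) (distr \<beta> borel (g n)))
        (entropic_OT C \<epsilon> (distr \<alpha> borel l) (distr \<beta> borel m)) < e"
    proof (rule eventually_mono)
      fix n assume *: "\<forall>z\<in>X \<times> X. dist (C (map_prod (f n) (g n) z)) (C (map_prod l m z)) < e / 2"
      have "\<bar>entropic_OT (C \<circ> map_prod (f n) (g n)) \<epsilon> \<alpha> \<beta> - entropic_OT (C \<circ> map_prod l m) \<epsilon> \<alpha> \<beta>\<bar> \<le> e / 2"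
      proof (rule entropic_OT_close[OF A(3) _ B(3)])
        show "C \<circ> map_prod (f n) (g n) \<in> borel_measurable borel" by (rule Ccomp[OF f(1) g(1)])
        show "C \<circ> map_prod l m \<in> borel_measurable borel" by (rule Ccomp[OF f(3) g(3)])
        show "\<bar>(C \<circ> map_prod (f n) (g n)) (x, y) - (C \<circ> map_prod l m) (x, y)\<bar> \<le> e / 2" if "x \<in> X" "y \<in> X" for x y
          using bspec[OF *, of "(x, y)"] that by (simp add: dist_real_def)
      qed (use A(4) C(2) e in auto)
      then show "dist (entropic_OT C \<epsilon> (distr \<alpha> borel (f n)) (distr \<beta> borel (g n)))
          (entropic_OT C \<epsilon> (distr \<alpha> borel l) (distr \<beta> borel m)) < e"
        unfolding eq[OF f(1,2) g(1,2)] eq[OF f(3,4) g(3,4)] using e by (simp add: dist_real_def)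
    qed
  qed
qed

context vector_fields
begin

lemma sinkhorn_weakly_continuous:
  fixes C :: "'a \<times> 'a \<Rightarrow> real"
  assumes X: "compact X" and \<alpha>: "prob_measure_on X \<alpha>" and \<beta>: "prob_measure_on X \<beta>"
    and C: "continuous_on UNIV C" "\<And>z. 0 \<le> C z" and \<epsilon>: "0 < \<epsilon>"
  shows "L2V_weakly_continuous (\<lambda>v. sinkhorn_divergence C \<epsilon> (distr \<alpha> borel (flow1 v)) \<beta>)"
  unfolding L2V_weakly_continuous_def
proof (intro allI impI)
  fix vs :: "nat \<Rightarrow> real \<Rightarrow> 'v" and v :: "real \<Rightarrow> 'v"
  assume vs: "\<forall>n. vs n \<in> L2V" and v: "v \<in> L2V" and weak: "L2V_weakly_converges vs v"
  from vs have vs: "\<And>n. vs n \<in> L2V" by simp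
  let ?f = "\<lambda>n. flow1 (vs n)" and ?l = "flow1 v"
  note f = flow_continuous[OF vs] flow_inj[OF vs] flow_continuous[OF v] flow_inj[OF v] flow_uniform_limit[OF vs v weak X]
  \<comment> \<open>Writing \<beta> as its own image under the identity brings the mixed term into
    the form of the two-map lemma.\<close>
  have \<beta>_id: "distr \<beta> borel (\<lambda>x. x) = \<beta>"
    using prob_measure_onD(2)[OF \<beta> X] by (intro distr_id2) simp
  have id: "continuous_on UNIV (\<lambda>x::'a. x)" "inj (\<lambda>x::'a. x)" by (simp_all add: continuous_on_id)
  have ulid: "uniform_limit X (\<lambda>_ x. x) (\<lambda>x. x) sequentially" by (rule uniform_limit_const)
  have "(\<lambda>n. entropic_OT C \<epsilon> (distr \<alpha> borel (?f n)) (distr \<beta> borel (\<lambda>x. x)))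
      \<longlonglongrightarrow> entropic_OT C \<epsilon> (distr \<alpha> borel ?l) (distr \<beta> borel (\<lambda>x. x))"
    by (rule tendsto_entropic_OT_distr[OF X \<alpha> \<beta> C \<epsilon> f id id ulid])
  moreover have "(\<lambda>n. entropic_OT C \<epsilon> (distr \<alpha> borel (?f n)) (distr \<alpha> borel (?f n)))
      \<longlonglongrightarrow> entropic_OT C \<epsilon> (distr \<alpha> borel ?l) (distr \<alpha> borel ?l)"
    by (rule tendsto_entropic_OT_distr[OF X \<alpha> \<alpha> C \<epsilon> f f])
  ultimately show "(\<lambda>n. sinkhorn_divergence C \<epsilon> (distr \<alpha> borel (?f n)) \<beta>) \<longlonglongrightarrow> sinkhorn_divergence C \<epsilon> (distr \<alpha> borel ?l) \<beta>"
    unfolding sinkhorn_divergence_def \<beta>_id by (intro tendsto_intros) auto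
qed

text \<open>Nonnegativity of \<open>\<Psi>\<close> makes the quadratic term alone bounded along a
  minimizing sequence, so a weakly convergent subsequence exists.\<close>

lemma L2V_direct_method:
  fixes \<Psi> :: "(real \<Rightarrow> 'v) \<Rightarrow> real"
  assumes \<Psi>: "L2V_weakly_continuous \<Psi>" and nonneg: "\<And>v. v \<in> L2V \<Longrightarrow> 0 \<le> \<Psi> v" and lam: "0 < lam"
  shows "\<exists>v\<in>L2V. \<forall>u\<in>L2V. \<Psi> v + lam * (L2V_norm v)\<^sup>2 \<le> \<Psi> u + lam * (L2V_norm u)\<^sup>2"
proof -
  interpret L2: semi_hilbert "L2V :: (real \<Rightarrow> 'v) set" "\<lambda>u v t. u t + v t" "\<lambda>a u t. a *\<^sub>R u t" L2V_inner
    by (rule semi_hilbert_L2V)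
  have norm_sq: "(L2V_norm u)\<^sup>2 = L2V_inner u u" if "u \<in> L2V" for u :: "real \<Rightarrow> 'v"
    using L2.ip_nonneg[OF that] by (simp add: L2V_norm_def)
  define J where "J u = \<Psi> u + lam * L2V_inner u u" for u
  have J_nonneg: "0 \<le> J u" if "u \<in> L2V" for u
    using nonneg[OF that] L2.ip_nonneg[OF that] lam by (simp add: J_def)
  define I where "I = Inf (J ` L2V)"
  have I_le: "I \<le> J u" if "u \<in> L2V" for u
    unfolding I_def by (rule cInf_lower) (use that J_nonneg in \<open>auto simp: bdd_below_def\<close>)
  have "\<exists>u\<in>L2V. J u < I + 1 / Suc n" for n
    using cInf_lessD[of "J ` L2V" "I + 1 / Suc n"] zero_L2V by (auto simp: I_def)
  then obtain U where U: "\<And>n. U n \<in> L2V" and JU: "\<And>n. J (U n) < I + 1 / Suc n" by metis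
  have U_le: "L2.nrm (U n) \<le> sqrt ((I + 1) / lam)" for n
  proof -
    have "lam * L2V_inner (U n) (U n) \<le> J (U n)" using nonneg[OF U] by (simp add: J_def)
    also have "J (U n) \<le> I + 1 / Suc n" using JU less_imp_le by blast
    also have "\<dots> \<le> I + 1" by simp
    finally show ?thesis using lam unfolding L2.nrm_def by (intro real_sqrt_le_mono) (simp add: field_simps)
  qed
  obtain r v where r: "strict_mono r" and v: "v \<in> L2V"
    and weak: "\<And>u. u \<in> L2V \<Longrightarrow> (\<lambda>n. L2V_inner (U (r n)) u) \<longlonglongrightarrow> L2V_inner v u"
    using L2.weak_compactness[of U, OF U U_le] by blast
  have "L2V_weakly_converges (\<lambda>n. U (r n)) v" using weak by (simp add: L2V_weakly_converges_def)
  then have \<Psi>_lim: "(\<lambda>n. \<Psi> (U (r n))) \<longlonglongrightarrow> \<Psi> v" using \<Psi> U v unfolding L2V_weakly_continuous_def by simp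
  have "J v \<le> I"
  proof (rule LIMSEQ_le)
    \<comment> \<open>Weak lower semicontinuity of the squared norm: it is replaced by its affine
      minorant at \<open>v\<close>, which passes to the weak limit and is exact there.\<close>
    show "(\<lambda>n. \<Psi> (U (r n)) + lam * (2 * L2V_inner (U (r n)) v - L2V_inner v v)) \<longlonglongrightarrow> J v"
    proof -
      have "(\<lambda>n. \<Psi> (U (r n)) + lam * (2 * L2V_inner (U (r n)) v - L2V_inner v v))
          \<longlonglongrightarrow> \<Psi> v + lam * (2 * L2V_inner v v - L2V_inner v v)"
        by (intro tendsto_intros \<Psi>_lim weak v)
      then show ?thesis by (simp add: J_def)
    qed
    have "(\<lambda>n. I + inverse (real (Suc n))) \<longlonglongrightarrow> I" by (rule LIMSEQ_inverse_real_of_nat_add)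
    then show "(\<lambda>n. I + 1 / Suc n) \<longlonglongrightarrow> I" by (simp add: inverse_eq_divide)
    have "\<Psi> (U (r n)) + lam * (2 * L2V_inner (U (r n)) v - L2V_inner v v) \<le> I + 1 / Suc n" for n
    proof -
      have "0 \<le> (L2.dst (U (r n)) v)\<^sup>2" by simp
      then have "2 * L2V_inner (U (r n)) v - L2V_inner v v \<le> L2V_inner (U (r n)) (U (r n))"
        by (simp add: L2.dst_square[OF U v])
      then have "lam * (2 * L2V_inner (U (r n)) v - L2V_inner v v) \<le> lam * L2V_inner (U (r n)) (U (r n))"
        using lam by (intro mult_left_mono) auto
      then have "\<Psi> (U (r n)) + lam * (2 * L2V_inner (U (r n)) v - L2V_inner v v) \<le> J (U (r n))" by (simp add: J_def)
      also have "\<dots> \<le> I + 1 / Suc (r n)" using JU less_imp_le by blast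
      also have "\<dots> \<le> I + 1 / Suc n" using seq_suble[OF r, of n] by (intro add_left_mono divide_left_mono) auto
      finally show ?thesis .
    qed
    then show "\<exists>N. \<forall>n\<ge>N. \<Psi> (U (r n)) + lam * (2 * L2V_inner (U (r n)) v - L2V_inner v v) \<le> I + 1 / Suc n" by blast
  qed
  then have "\<forall>u\<in>L2V. J v \<le> J u" using I_le order_trans by blast
  then show ?thesis using v by (intro bexI[of _ v]) (simp_all add: J_def norm_sq)
qed

end

section \<open>From operator norms of derivatives to sup and Lipschitz bounds on fields\<close>

lemma mlin_norm_0:
  fixes L :: "'a::real_normed_vector list \<Rightarrow> 'b::real_normed_vector"
  shows "mlin_norm 0 L = norm (L [])"
proof -
  have "{ds :: 'a list. length ds = 0 \<and> (\<forall>d\<in>set ds. norm d \<le> 1)} = {[]}" by auto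
  then show ?thesis by (simp add: mlin_norm_def)
qed

lemma mlin_norm_1:
  fixes l :: "'a::real_normed_vector \<Rightarrow> 'b::real_normed_vector"
  assumes l: "bounded_linear l"
  shows "mlin_norm (Suc 0) (\<lambda>ds. l (hd ds)) = onorm l"
proof (rule antisym)
  let ?S = "{ds. length ds = Suc 0 \<and> (\<forall>d\<in>set ds. norm d \<le> 1)} :: 'a list set"
  have le: "norm (l (hd ds)) \<le> onorm l" if "ds \<in> ?S" for ds
  proof -
    have "norm (hd ds) \<le> 1" using that by (cases ds) auto
    then have "onorm l * norm (hd ds) \<le> onorm l * 1" by (intro mult_left_mono onorm_pos_le l)
    then show ?thesis using onorm[OF l, of "hd ds"] by simp
  qed
  have zero: "[0] \<in> ?S" by simp
  then have "?S \<noteq> {}" by blast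
  then show "mlin_norm (Suc 0) (\<lambda>ds. l (hd ds)) \<le> onorm l"
    unfolding mlin_norm_def by (rule cSUP_least) (rule le)
  have bdd: "bdd_above ((\<lambda>ds. norm (l (hd ds))) ` ?S)" using le by (auto simp: bdd_above_def)
  show "onorm l \<le> mlin_norm (Suc 0) (\<lambda>ds. l (hd ds))"
  proof (rule onorm_bound)
    show "0 \<le> mlin_norm (Suc 0) (\<lambda>ds. l (hd ds))"
      unfolding mlin_norm_def by (rule order_trans[OF norm_ge_zero cSUP_upper[OF zero bdd]])
    fix x
    show "norm (l x) \<le> mlin_norm (Suc 0) (\<lambda>ds. l (hd ds)) * norm x"
    proof (cases "x = 0")
      case True
      then show ?thesis using linear_0[OF bounded_linear.linear[OF l]] by simp
    next
      case False
      have "norm (l (hd [x /\<^sub>R norm x])) \<le> mlin_norm (Suc 0) (\<lambda>ds. l (hd ds))"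
        unfolding mlin_norm_def by (rule cSUP_upper[OF _ bdd]) (use False in simp)
      then show ?thesis
        using False linear_scale[OF bounded_linear.linear[OF l], of "inverse (norm x)" x] by (simp add: field_simps)
    qed
  qed
qed

text \<open>A real \<open>SUP\<close> bounds its values only over a set that is bounded above; this
  is what allows \<open>Cp_norm\<close> to dominate the pointwise norms. The function is below 1
  outside a ball and bounded on the ball by compactness.\<close>

lemma bdd_above_vanishing:
  fixes g :: "'a::euclidean_space \<Rightarrow> real"
  assumes g: "continuous_on UNIV g" "(g \<longlongrightarrow> 0) at_infinity"
  shows "bdd_above (range g)"
proof -
  have "\<forall>\<^sub>F x in at_infinity. g x < 1" by (rule order_tendstoD(2)[OF g(2)]) simp
  then obtain b where b: "\<And>x. b \<le> norm x \<Longrightarrow> g x < 1" by (auto simp: eventually_at_infinity)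
  have "bounded (g ` cball 0 b)"
    by (intro compact_imp_bounded compact_continuous_image continuous_on_subset[OF g(1)]) auto
  then obtain B where B: "\<forall>x\<in>cball 0 b. \<bar>g x\<bar> \<le> B" by (auto simp: bounded_iff)
  have "g x \<le> max 1 B" for x
    using b[of x] bspec[OF B, of x] by (cases "b \<le> norm x") auto
  then show ?thesis by (auto simp: bdd_above_def)
qed

lemma C_class_continuous:
  assumes "F \<in> C_class p"
  shows "continuous_on UNIV F"
proof -
  have "isCont F x" for x
  proof -
    have "((\<lambda>y. mlin_norm 0 (\<lambda>ds. nderiv 0 F y ds - nderiv 0 F x ds)) \<longlongrightarrow> 0) (at x)"
      using assms unfolding C_class_def by blast
    then have "((\<lambda>y. norm (F y - F x)) \<longlongrightarrow> 0) (at x)" by (simp add: mlin_norm_0)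
    then show ?thesis unfolding isCont_def by (rule LIM_zero_cancel[OF tendsto_norm_zero_cancel])
  qed
  then show ?thesis by (simp add: continuous_at_imp_continuous_on)
qed

text \<open>The order 1 operator norm is the \<open>onorm\<close> of the Frechet derivative,
  continuous and vanishing at infinity, hence dominated by its supremum; the mean value inequality
  turns it into a Lipschitz constant. Here \<open>1 \<le> p\<close> makes the first derivative
  available.\<close>

lemma B_space_bounds:
  fixes F :: "'a::euclidean_space \<Rightarrow> 'a"
  assumes F: "F \<in> B_space p" and p: "1 \<le> p"
  shows "norm (F x) \<le> Cp_norm p F" and "norm (F x - F y) \<le> Cp_norm p F * norm (x - y)"
proof -
  have FC: "F \<in> C_class p" using F by (simp add: B_space_def)
  have vanish: "((\<lambda>x. mlin_norm k (nderiv k F x)) \<longlongrightarrow> 0) at_infinity" if "k \<le> p" for k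
    using F that by (simp add: B_space_def)
  have Cp: "mlin_norm k (nderiv k F x) \<le> Cp_norm p F"
    if "k \<le> p" "continuous_on UNIV (\<lambda>x. mlin_norm k (nderiv k F x))" for k x
  proof -
    have "mlin_norm k (nderiv k F x) \<le> (SUP x. mlin_norm k (nderiv k F x))"
      by (intro cSUP_upper bdd_above_vanishing that vanish) simp
    also have "\<dots> \<le> Cp_norm p F" unfolding Cp_norm_def using that(1) by (intro Max_ge) auto
    finally show ?thesis .
  qed
  have "continuous_on UNIV (\<lambda>x. norm (F x))" by (intro continuous_intros C_class_continuous[OF FC])
  then show "norm (F x) \<le> Cp_norm p F" for x using Cp[of 0 x] by (simp add: mlin_norm_0)
  define D where "D x = frechet_derivative F (at x)" for x
  have der: "(F has_derivative D x) (at x)" for x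
  proof -
    have "\<forall>k<p. \<forall>x. \<forall>ds. length ds = k \<longrightarrow> (\<lambda>y. nderiv k F y ds) differentiable (at x)"
      using FC unfolding C_class_def by blast
    then have "(\<lambda>y. nderiv 0 F y []) differentiable (at x)" using p by auto
    then show ?thesis by (simp add: D_def frechet_derivative_works)
  qed
  have bl: "bounded_linear (D x)" for x by (rule has_derivative_bounded_linear[OF der])
  have nd: "nderiv (Suc 0) F x = (\<lambda>ds. D x (hd ds))" for x by (auto simp: D_def)
  have m1: "mlin_norm (Suc 0) (nderiv (Suc 0) F x) = onorm (D x)" for x
    unfolding nd by (rule mlin_norm_1[OF bl])
  have "isCont (\<lambda>x. onorm (D x)) x" for x
  proof -
    have "((\<lambda>y. mlin_norm (Suc 0) (\<lambda>ds. nderiv (Suc 0) F y ds - nderiv (Suc 0) F x ds)) \<longlongrightarrow> 0) (at x)"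
    proof -
      have "\<forall>k\<le>p. \<forall>x. ((\<lambda>y. mlin_norm k (\<lambda>ds. nderiv k F y ds - nderiv k F x ds)) \<longlongrightarrow> 0) (at x)"
        using FC unfolding C_class_def by blast
      from this[rule_format, of "Suc 0" x] p show ?thesis by simp
    qed
    moreover have "mlin_norm (Suc 0) (\<lambda>ds. nderiv (Suc 0) F y ds - nderiv (Suc 0) F x ds) = onorm (\<lambda>h. D y h - D x h)" for y
      unfolding nd by (rule mlin_norm_1[OF bounded_linear_sub[OF bl bl]])
    ultimately have lim: "((\<lambda>y. onorm (\<lambda>h. D y h - D x h)) \<longlongrightarrow> 0) (at x)" by simp
    have tri: "onorm (D u) \<le> onorm (D v) + onorm (\<lambda>h. D u h - D v h)" for u v
      using onorm_triangle[OF bl[of v] bounded_linear_sub[OF bl[of u] bl[of v]]] by simp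
    have "onorm (\<lambda>h. D x h - D y h) = onorm (\<lambda>h. D y h - D x h)" for y
      using onorm_neg[of "\<lambda>h. D y h - D x h"] by simp
    then have "norm (onorm (D y) - onorm (D x)) \<le> onorm (\<lambda>h. D y h - D x h)" for y
      using tri[of x y] tri[of y x] by (simp add: abs_le_iff)
    then have "((\<lambda>y. onorm (D y) - onorm (D x)) \<longlongrightarrow> 0) (at x)"
      by (intro Lim_null_comparison[OF _ lim]) auto
    then show ?thesis unfolding isCont_def by (rule LIM_zero_cancel)
  qed
  then have "continuous_on UNIV (\<lambda>x. mlin_norm (Suc 0) (nderiv (Suc 0) F x))"
    unfolding m1 by (simp add: continuous_at_imp_continuous_on)
  then have "onorm (D x) \<le> Cp_norm p F" for x using Cp[of "Suc 0" x] p unfolding m1 by simp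
  then show "norm (F x - F y) \<le> Cp_norm p F * norm (x - y)"
    by (intro differentiable_bound[of UNIV F D]) (auto intro: der)
qed

theorem proposition5p1:
  fixes C :: "'a::euclidean_space \<times> 'a \<Rightarrow> real"
    and \<iota> :: "'v::{real_inner, banach} \<Rightarrow> 'a \<Rightarrow> 'a"
    and \<alpha> \<beta> :: "'a measure"
    and X :: "'a set"
    and lam \<epsilon> c\<^sub>V :: real
    and p :: nat
  assumes "0 < lam" and "0 < \<epsilon>"
    and "compact X" and "prob_measure_on X \<alpha>" and "prob_measure_on X \<beta>"
    and "C \<in> C_class 1" and "\<forall>z. 0 \<le> C z"
    and "1 \<le> p"
    and "\<forall>x. linear (\<lambda>w. \<iota> w x)" and "inj \<iota>"
    and "\<forall>w. \<iota> w \<in> B_space p"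
    and "0 < c\<^sub>V" and "\<forall>w. Cp_norm p (\<iota> w) \<le> c\<^sub>V * norm w"
  shows "L2V_weakly_continuous (\<lambda>v. sinkhorn_divergence C \<epsilon> (distr \<alpha> borel (flow (\<lambda>t. \<iota> (v t)) 1)) \<beta>) \<and>
         (positive_universal_kernel (\<lambda>x y. exp (- C (x, y) / \<epsilon>)) \<longrightarrow>
            (\<exists>v\<in>L2V. \<forall>u\<in>L2V. J_functional lam \<iota> C \<epsilon> \<alpha> \<beta> v \<le> J_functional lam \<iota> C \<epsilon> \<alpha> \<beta> u))"
proof -
  interpret vector_fields \<iota> c\<^sub>V
  proof (rule vector_fields.intro)
    fix w and x y :: 'a
    note le = assms(13)[rule_format, of w] and B = B_space_bounds[OF assms(11)[rule_format, of w] assms(8)]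
    show "norm (\<iota> w x) \<le> c\<^sub>V * norm w" using B(1)[of x] le by (rule order_trans)
    have "Cp_norm p (\<iota> w) * norm (x - y) \<le> c\<^sub>V * norm w * norm (x - y)" by (intro mult_right_mono le) simp
    with B(2)[of x y] show "norm (\<iota> w x - \<iota> w y) \<le> c\<^sub>V * norm w * norm (x - y)" by (rule order_trans)
  qed (use assms in auto)
  let ?\<Psi> = "\<lambda>v. sinkhorn_divergence C \<epsilon> (distr \<alpha> borel (flow1 v)) \<beta>"
  have C: "continuous_on UNIV C" "\<And>z. 0 \<le> C z" using C_class_continuous[OF assms(6)] assms(7) by auto
  have weak: "L2V_weakly_continuous ?\<Psi>"
    by (rule sinkhorn_weakly_continuous[OF assms(3-5) C assms(2)])
  have "\<exists>v\<in>L2V. \<forall>u\<in>L2V. J_functional lam \<iota> C \<epsilon> \<alpha> \<beta> v \<le> J_functional lam \<iota> C \<epsilon> \<alpha> \<beta> u"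
    if k: "positive_universal_kernel (\<lambda>x y. exp (- C (x, y) / \<epsilon>))"
  proof -
    note A = prob_measure_onD[OF assms(4,3)] and B = prob_measure_onD[OF assms(5,3)]
    have "0 \<le> ?\<Psi> v" if v: "v \<in> L2V" for v
    proof -
      let ?f = "flow1 v"
      \<comment> \<open>Nonnegativity of the divergence is stated for two measures on one compact
        set; this one carries both \<beta> and the transported \<alpha>.\<close>
      define K where "K = X \<union> ?f ` X"
      have fX: "compact (?f ` X)"
        by (intro compact_continuous_image continuous_on_subset[OF flow_continuous[OF v]] assms(3)) simp
      then have K: "compact K" unfolding K_def by (intro compact_Un assms(3))
      have Kb: "K \<in> sets borel" using K by (simp add: borel_closed compact_imp_closed)
      have fm: "?f \<in> \<alpha> \<rightarrow>\<^sub>M borel"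
        by (rule measurable_eq_sets[OF A(2) borel_measurable_continuous_onI[OF flow_continuous[OF v]]])
      have "AE x in \<alpha>. ?f x \<in> K" by (rule AE_mp[OF A(3)]) (auto simp: K_def)
      then have "AE z in distr \<alpha> borel ?f. z \<in> K"
        using Kb by (subst AE_distr_iff[OF fm]) auto
      then have "compact_prob K (distr \<alpha> borel ?f)"
        using K prob_space.prob_space_distr[OF A(1) fm] by (simp add: compact_prob_def)
      moreover have "AE z in \<beta>. z \<in> K" by (rule AE_mp[OF B(3)]) (auto simp: K_def)
      then have "compact_prob K \<beta>" using K B(1,2) by (simp add: compact_prob_def)
      ultimately show ?thesis by (rule sinkhorn_divergence_nonneg[OF _ _ assms(2) C k])
    qed
    from L2V_direct_method[OF weak this assms(1)] show ?thesis by (simp add: J_functional_def)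
  qed
  with weak show ?thesis by blast
qed

end
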